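(* Let $s$ be a fixed positive integer and $c>1/s$ a constant. Assume that $p=p(n)$ satisfies $\frac{c\ln n}{n}<p<\frac12$, and let $W$ be a symmetric $n\times n$ complex matrix all of whose off-diagonal entries are nonzero. Then with probability $1-O\left(\frac{1}{(\ln\ln n)^{1/4}}\right)=1-o(1)$, the rank of the random matrix $Q(W,p)$ equals the size of the largest unobstructed set of vertices in its graph $G(Q(W,p))$.
   Context: Random model: $W=(w_{ij})$ is a symmetric $n\times n$ complex matrix with $w_{ij}\ne 0$ for $i\neq j$ (no restriction on the diagonal entries $w_{ii}$). Let $\xi_{ij}$, $1\le i\le j\le n$, be independent Bernoulli random variables equal to $1$ with probability $p$ and $0$ with probability $1-p$. $Q(W,p)$ is the random symmetric matrix with entries $q_{ij}=q_{ji}=w_{ij}\xi_{ij}$ for $1\le i\le j\le n$. The graph $G(Q)$ of a symmetric $n\times n$ matrix $Q$ has the rows $1,\dots,n$ of $Q$ as vertices, with $i$ adjacent to $j$ if and only if $q_{ij}\ne 0$ (self-loops allowed). For a set $S$ of vertices, $N(S)$ is the set of vertices adjacent to at least one vertex of $S$ (it may contain elements of $S$). $S$ is non-expanding if $|N(S)|<|S|$. A set of vertices is unobstructed if it contains no non-expanding subset. *)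

theory Defs
  imports
    "HOL-Probability.Probability"
    "HOL-Library.Landau_Symbols"
    "Jordan_Normal_Form.Matrix"
    "Jordan_Normal_Form.DL_Rank"
begin

(* Matrices are indexed from 0, so the rows 1, ..., n of the paper are 0, ..., n - 1 here. *)

definition graph_verts :: "complex mat \<Rightarrow> nat set" where
  "graph_verts Q = {..<dim_row Q}"

definition graph_adj :: "complex mat \<Rightarrow> nat \<Rightarrow> nat \<Rightarrow> bool" where
  "graph_adj Q i j \<longleftrightarrow> i \<in> graph_verts Q \<and> j \<in> graph_verts Q \<and> Q $$ (i, j) \<noteq> 0"

definition neighbourhood :: "complex mat \<Rightarrow> nat set \<Rightarrow> nat set" where
  "neighbourhood Q S = {v \<in> graph_verts Q. \<exists>u\<in>S. graph_adj Q u v}"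

definition non_expanding :: "complex mat \<Rightarrow> nat set \<Rightarrow> bool" where
  "non_expanding Q S \<longleftrightarrow> card (neighbourhood Q S) < card S"

definition unobstructed :: "complex mat \<Rightarrow> nat set \<Rightarrow> bool" where
  "unobstructed Q S \<longleftrightarrow> S \<subseteq> graph_verts Q \<and> \<not> (\<exists>T\<subseteq>S. non_expanding Q T)"

definition max_unobstructed_size :: "complex mat \<Rightarrow> nat" where
  "max_unobstructed_size Q = Max {card S | S. unobstructed Q S}"

definition admissible_weights :: "nat \<Rightarrow> complex mat \<Rightarrow> bool" where
  "admissible_weights n W \<longleftrightarrow>
     W \<in> carrier_mat n n \<and> transpose_mat W = W \<and>
     (\<forall>i<n. \<forall>j<n. i \<noteq> j \<longrightarrow> W $$ (i, j) \<noteq> 0)"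

definition masked_mat :: "nat \<Rightarrow> complex mat \<Rightarrow> (nat \<times> nat \<Rightarrow> bool) \<Rightarrow> complex mat" where
  "masked_mat n W \<xi> = mat n n (\<lambda>(i, j).
     if i \<le> j then W $$ (i, j) * of_bool (\<xi> (i, j)) else W $$ (j, i) * of_bool (\<xi> (j, i)))"

(* The law of Q(W,p): Pi_pmf is the joint law of independent Bernoulli(p) variables indexed by
   the pairs i <= j < n; the value False outside this index set is never used. *)
definition Q_pmf :: "nat \<Rightarrow> complex mat \<Rightarrow> real \<Rightarrow> complex mat pmf" where
  "Q_pmf n W p = map_pmf (masked_mat n W)
     (Pi_pmf {(i, j). i \<le> j \<and> j < n} False (\<lambda>_. bernoulli_pmf p))"

end

theory Submission
  imports Defs "HOL-Real_Asymp.Real_Asymp"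
begin

text \<open>
  A column basis is unobstructed, and an unobstructed set has at most \<open>n - |T| + |N(T)|\<close> elements for
  every \<open>T\<close>; so it suffices to find, with high probability, a set \<open>T\<close> with corank at most
  \<open>|T| - |N(T)|\<close>. The set \<open>T\<close> is the union of the supports of all kernel vectors.

  A union bound over supports shows that no vector with support of intermediate size, between
  \<open>n powr (1 - a)\<close> and a constant multiple of \<open>n\<close>, is mapped to a vector with comparably small
  support. Kernel vectors of linear support are excluded by deleting a vertex \<open>i\<close> of the support: the
  deleted column \<open>x\<close> must then be orthogonal to a kernel vector of linear support of the minor, which
  is unlikely by the Littlewood--Offord inequality, or it must satisfy a quadratic equation
  given by a generalized inverse of the minor. Most rows of that inverse have
  linear support (otherwise generic combinations of few of them would have support of intermediate
  size), so a quadratic Littlewood--Offord inequality applies. Averaging over \<open>i\<close> costs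
  only a constant factor because the support is linear.

  If \<open>T\<close> is small, every vertex of \<open>N(T)\<close> has two neighbours in \<open>T\<close>. If the rows \<open>N(T)\<close> restricted
  to \<open>T\<close> were dependent, some connected component of the graph of edges meeting \<open>T\<close> would contain a
  cycle, and such components are ruled out by a first moment computation; otherwise the corank
  is at most \<open>|T| - |N(T)|\<close>.
\<close>

section \<open>Linear algebra over finite index sets\<close>

text \<open>The union bound over supports of size \<open>t\<close> pays an entropy of order
  \<open>t * ln (n / t)\<close> against a gain of order \<open>n * min (t * p) 1\<close>. It fails
  for linear supports, where only anticoncentration helps, and, when \<open>n * p\<close> is a small
  multiple of \<open>ln n\<close>, for supports below \<open>n powr (1 - a)\<close>, where genuine
  obstructions such as isolated vertices exist. Hence two regimes. If
  \<open>n * p \<ge> 256 * (1 + ln n)\<close>, all sizes from 1 up to the linear threshold are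
  excluded. Otherwise \<open>n * p\<close> is logarithmic, and this upper bound makes the first
  moment over cyclic components converge: each vertex of a component costs a power of
  \<open>ln n\<close>, whereas each of its vertices in \<open>T\<close> saves a factor
  \<open>exp (- n * p)\<close>, below \<open>n powr (- c)\<close>.

  For small \<open>c\<close> the minors may be singular with high probability, so invertibility
  cannot be assumed, and inverses are taken relative to a column basis. The quadratic step fails
  with probability of order \<open>(n * p) powr (- 1 / 4)\<close>, far too large for a union bound
  over the deleted vertex; this is also the dominant error term.\<close>

lemma underdetermined_system:
  fixes a :: "'i \<Rightarrow> 'j \<Rightarrow> 'a::field"
  assumes "finite I" "finite J" "card I < card J"
  shows "\<exists>v. (\<forall>i\<in>I. (\<Sum>j\<in>J. a i j * v j) = 0) \<and> (\<exists>j\<in>J. v j \<noteq> 0)"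
  using assms
proof (induction I arbitrary: J a rule: finite_induct)
  case empty
  then have "J \<noteq> {}" by auto
  then show ?case by (intro exI[of _ "\<lambda>_. 1"]) auto
next
  case (insert i I)
  show ?case
  proof (cases "\<forall>j\<in>J. a i j = 0")
    case True
    obtain v where "\<forall>i\<in>I. (\<Sum>j\<in>J. a i j * v j) = 0" "\<exists>j\<in>J. v j \<noteq> 0"
      using insert.IH[of J a] insert.prems insert.hyps by auto
    with True show ?thesis by (intro exI[of _ v]) auto
  next
    case False
    then obtain k where k: "k \<in> J" "a i k \<noteq> 0" by auto
    define b where "b = (\<lambda>l j. a l j - a l k * a i j / a i k)"
    have "card I < card (J - {k})" using insert k by auto
    then obtain v where v: "\<forall>l\<in>I. (\<Sum>j\<in>J-{k}. b l j * v j) = 0" "\<exists>j\<in>J-{k}. v j \<noteq> 0"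
      using insert.IH[of "J - {k}" b] insert.prems by auto
    define t where "t = - (\<Sum>j\<in>J-{k}. a i j * v j) / a i k"
    have split: "(\<Sum>j\<in>J. a l j * (v(k := t)) j) = a l k * t + (\<Sum>j\<in>J-{k}. a l j * v j)" for l
      using k insert.prems by (subst sum.remove[of J k]) (auto intro!: sum.cong)
    have "(\<Sum>j\<in>J. a l j * (v(k := t)) j) = 0" if "l \<in> insert i I" for l
    proof (cases "l = i")
      case True
      have "(\<Sum>j\<in>J. a i j * (v(k := t)) j) = 0" unfolding split using k by (simp add: t_def)
      then show ?thesis using True by simp
    next
      case False
      then have "(\<Sum>j\<in>J-{k}. b l j * v j) = 0" using v that by auto
      moreover have "(\<Sum>j\<in>J-{k}. b l j * v j) =
          (\<Sum>j\<in>J-{k}. a l j * v j) - a l k / a i k * (\<Sum>j\<in>J-{k}. a i j * v j)"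
        unfolding b_def sum_distrib_left sum_subtractf[symmetric]
        by (intro sum.cong) (auto simp: field_simps)
      ultimately show ?thesis unfolding split by (simp add: t_def)
    qed
    moreover have "\<exists>j\<in>J. (v(k := t)) j \<noteq> 0" using v(2) by auto
    ultimately show ?thesis by blast
  qed
qed

text \<open>Stated for index sets, so that a submatrix is named by its rows and columns and never
  reindexed. Swapping the arguments of \<open>a\<close> gives the same notions for rows.\<close>

definition indep_cols :: "('i \<Rightarrow> 'j \<Rightarrow> 'a::field) \<Rightarrow> 'i set \<Rightarrow> 'j set \<Rightarrow> bool" where
  "indep_cols a I R \<longleftrightarrow> (\<forall>v. (\<forall>i\<in>I. (\<Sum>j\<in>R. a i j * v j) = 0) \<longrightarrow> (\<forall>j\<in>R. v j = 0))"

definition col_basis :: "('i \<Rightarrow> 'j \<Rightarrow> 'a::field) \<Rightarrow> 'i set \<Rightarrow> 'j set \<Rightarrow> 'j set \<Rightarrow> bool" where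
  "col_basis a I J R \<longleftrightarrow> R \<subseteq> J \<and> indep_cols a I R \<and>
     (\<forall>j\<in>J. \<exists>c. \<forall>i\<in>I. a i j = (\<Sum>k\<in>R. a i k * c k))"

lemma indep_colsD:
  "indep_cols a I R \<Longrightarrow> (\<And>i. i \<in> I \<Longrightarrow> (\<Sum>j\<in>R. a i j * v j) = 0) \<Longrightarrow> j \<in> R \<Longrightarrow> v j = 0"
  unfolding indep_cols_def by blast

lemma indep_cols_card_le:
  assumes "indep_cols a I R" "finite I" "finite R"
  shows "card R \<le> card I"
proof (rule ccontr)
  assume "\<not> card R \<le> card I"
  then have "card I < card R" by simp
  from underdetermined_system[OF assms(2,3) this, of a] assms(1) show False
    unfolding indep_cols_def by blast
qed

lemma col_basis_exists:
  fixes a :: "'i \<Rightarrow> 'j \<Rightarrow> 'a::field"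
  assumes "finite J"
  shows "\<exists>R. col_basis a I J R"
proof -
  define X where "X = {R. R \<subseteq> J \<and> indep_cols a I R}"
  have "finite X" unfolding X_def using assms by auto
  moreover have "{} \<in> X" unfolding X_def indep_cols_def by auto
  ultimately obtain R where R: "R \<in> X" and max: "\<And>S. S \<in> X \<Longrightarrow> R \<subseteq> S \<Longrightarrow> R = S"
    using finite_has_maximal[of X] by (metis empty_iff)
  have finR: "finite R" using R assms unfolding X_def by (auto intro: finite_subset)
  have "\<exists>c. \<forall>i\<in>I. a i j = (\<Sum>k\<in>R. a i k * c k)" if j: "j \<in> J" for j
  proof (cases "j \<in> R")
    case True
    then show ?thesis using finR
      by (intro exI[of _ "\<lambda>k. if k = j then 1 else 0"]) (auto simp: if_distrib cong: if_cong)
  next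
    case False
    then have "insert j R \<notin> X" using max by blast
    then have "\<not> indep_cols a I (insert j R)" using R j unfolding X_def by auto
    then have "\<exists>v. (\<forall>i\<in>I. (\<Sum>l\<in>insert j R. a i l * v l) = 0) \<and> (\<exists>k\<in>insert j R. v k \<noteq> 0)"
      by (simp only: indep_cols_def Ball_def Bex_def not_all not_imp)
    then obtain v k where v: "\<forall>i\<in>I. (\<Sum>l\<in>insert j R. a i l * v l) = 0"
      and k: "k \<in> insert j R" "v k \<noteq> 0"
      by (elim exE conjE bexE)
    have eq: "(\<Sum>l\<in>R. a i l * v l) = - (a i j * v j)" if "i \<in> I" for i
      using v that False finR by (metis add.commute eq_neg_iff_add_eq_0 sum.insert)
    have vj: "v j \<noteq> 0"
    proof
      assume "v j = 0"
      then have "\<forall>i\<in>I. (\<Sum>l\<in>R. a i l * v l) = 0" using eq by simp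
      then have "\<forall>l\<in>R. v l = 0" using R unfolding X_def indep_cols_def by blast
      then show False using k \<open>v j = 0\<close> by auto
    qed
    have "a i j = (\<Sum>l\<in>R. a i l * (- v l / v j))" if "i \<in> I" for i
    proof -
      have "(\<Sum>l\<in>R. a i l * (- v l / v j)) = - (\<Sum>l\<in>R. a i l * v l) / v j"
        by (simp add: sum_negf sum_divide_distrib)
      also have "\<dots> = a i j" using eq[OF that] vj by simp
      finally show ?thesis by simp
    qed
    then show ?thesis by (intro exI[of _ "\<lambda>l. - v l / v j"]) auto
  qed
  then show ?thesis using R unfolding col_basis_def X_def by auto
qed

text \<open>A cancellation at \<open>i\<close> forces \<open>c = - u i / v i\<close>, so only
  finitely many values of \<open>c\<close> are bad.\<close>

lemma generic_combination:
  fixes u v :: "'i \<Rightarrow> complex"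
  assumes "finite V"
  shows "\<exists>c. \<forall>i\<in>V. u i + c * v i = 0 \<longleftrightarrow> u i = 0 \<and> v i = 0"
proof -
  have "finite (insert 0 ((\<lambda>i. - u i / v i) ` V))" using assms by auto
  then obtain c where c: "c \<notin> insert 0 ((\<lambda>i. - u i / v i) ` V)"
    using ex_new_if_finite[OF infinite_UNIV_char_0] by blast
  have "u i + c * v i = 0 \<longleftrightarrow> u i = 0 \<and> v i = 0" if "i \<in> V" for i
  proof
    assume eq: "u i + c * v i = 0"
    show "u i = 0 \<and> v i = 0"
    proof (cases "v i = 0")
      case False
      then have "c = - u i / v i" using eq by (simp add: field_simps eq_neg_iff_add_eq_0)
      then show ?thesis using c that by auto
    qed (use eq in auto)
  qed auto
  then show ?thesis by blast
qed

section \<open>Supports and kernels\<close>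

definition supp_on :: "'i set \<Rightarrow> ('i \<Rightarrow> complex) \<Rightarrow> 'i set" where
  "supp_on V v = {i \<in> V. v i \<noteq> 0}"

lemma finite_supp_on [simp]: "finite V \<Longrightarrow> finite (supp_on V v)"
  and supp_on_subset: "supp_on V v \<subseteq> V"
  unfolding supp_on_def by auto

definition app :: "'i set \<Rightarrow> ('i \<Rightarrow> 'i \<Rightarrow> complex) \<Rightarrow> ('i \<Rightarrow> complex) \<Rightarrow> 'i \<Rightarrow> complex" where
  "app V q v i = (\<Sum>j\<in>V. q i j * v j)"

definition kern :: "'i set \<Rightarrow> ('i \<Rightarrow> 'i \<Rightarrow> complex) \<Rightarrow> ('i \<Rightarrow> complex) set" where
  "kern V q = {v. \<forall>i\<in>V. app V q v i = 0}"

lemma app_add: "app V q (\<lambda>i. u i + c * v i) k = app V q u k + c * app V q v k"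
  unfolding app_def by (simp add: algebra_simps sum.distrib sum_distrib_left)

lemma app_sum: "app V q (\<lambda>i. \<Sum>j\<in>J. c j * f j i) k = (\<Sum>j\<in>J. c j * app V q (f j) k)"
  unfolding app_def sum_distrib_left
  by (subst sum.swap) (simp add: algebra_simps)

lemma app_restrict:
  assumes "finite V" "T \<subseteq> V" "\<And>i. i \<in> V \<Longrightarrow> i \<notin> T \<Longrightarrow> v i = 0"
  shows "app V q v k = (\<Sum>j\<in>T. q k j * v j)"
  unfolding app_def using assms by (intro sum.mono_neutral_right) auto

lemma app_sym:
  assumes "\<And>i j. i \<in> V \<Longrightarrow> j \<in> V \<Longrightarrow> q i j = q j i"
  shows "(\<Sum>i\<in>V. u i * app V q v i) = (\<Sum>i\<in>V. v i * app V q u i)"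
proof -
  have "(\<Sum>i\<in>V. u i * app V q v i) = (\<Sum>i\<in>V. \<Sum>j\<in>V. u i * (q i j * v j))"
    unfolding app_def by (simp add: sum_distrib_left)
  also have "\<dots> = (\<Sum>j\<in>V. \<Sum>i\<in>V. u i * (q i j * v j))" by (rule sum.swap)
  also have "\<dots> = (\<Sum>j\<in>V. v j * app V q u j)"
    unfolding app_def sum_distrib_left using assms by (intro sum.cong) (auto simp: algebra_simps)
  finally show ?thesis .
qed

text \<open>A generic combination of two kernel vectors has the union of their supports, so a kernel
  vector of maximal support size already covers every other one.\<close>

lemma kern_full_support:
  assumes "finite V"
  shows "\<exists>v\<in>kern V q. \<forall>w\<in>kern V q. supp_on V w \<subseteq> supp_on V v"
proof -
  have "(\<lambda>_. 0) \<in> kern V q" unfolding kern_def app_def by auto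
  moreover have "\<forall>v. v \<in> kern V q \<longrightarrow> card (supp_on V v) < Suc (card V)"
    using assms by (auto intro!: card_mono supp_on_subset simp: less_Suc_eq_le)
  ultimately obtain v where v: "v \<in> kern V q"
    and max: "\<And>w. w \<in> kern V q \<Longrightarrow> card (supp_on V w) \<le> card (supp_on V v)"
    using ex_has_greatest_nat[of "\<lambda>v. v \<in> kern V q" _ "\<lambda>v. card (supp_on V v)" "Suc (card V)"]
    by blast
  have "supp_on V w \<subseteq> supp_on V v" if w: "w \<in> kern V q" for w
  proof -
    obtain c where c: "\<forall>i\<in>V. v i + c * w i = 0 \<longleftrightarrow> v i = 0 \<and> w i = 0"
      using generic_combination[OF assms, of v w] by blast
    have "(\<lambda>i. v i + c * w i) \<in> kern V q"
      using v w unfolding kern_def by (auto simp: app_add)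
    from max[OF this] have "card (supp_on V (\<lambda>i. v i + c * w i)) \<le> card (supp_on V v)" .
    moreover have "supp_on V (\<lambda>i. v i + c * w i) = supp_on V v \<union> supp_on V w"
      using c unfolding supp_on_def by auto
    ultimately have "supp_on V v = supp_on V v \<union> supp_on V w"
      using assms by (intro card_seteq) auto
    then show ?thesis by auto
  qed
  with v show ?thesis by blast
qed

section \<open>Symmetric matrices relative to a column basis\<close>

locale sym_matrix =
  fixes V :: "'i set" and q :: "'i \<Rightarrow> 'i \<Rightarrow> complex"
  assumes finV: "finite V"
    and sym: "\<And>i j. i \<in> V \<Longrightarrow> j \<in> V \<Longrightarrow> q i j = q j i"
begin

context
  fixes R assumes R: "col_basis q V V R"
begin

lemma R_sub: "R \<subseteq> V" and finR: "finite R"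
  using R finV unfolding col_basis_def by (auto intro: finite_subset)

lemma basis_col:
  assumes "s \<in> V"
  obtains c where "\<And>i. i \<in> V \<Longrightarrow> q i s = (\<Sum>k\<in>R. q i k * c k)"
  using R assms unfolding col_basis_def by blast

text \<open>By symmetry the rows in \<open>R\<close> span all rows.\<close>

lemma app_vanish_basis:
  assumes z: "\<And>k. k \<in> R \<Longrightarrow> app V q u k = 0" and i: "i \<in> V"
  shows "app V q u i = 0"
proof -
  obtain c where c: "\<And>j. j \<in> V \<Longrightarrow> q j i = (\<Sum>k\<in>R. q j k * c k)"
    using basis_col[OF i] by blast
  have "app V q u i = (\<Sum>j\<in>V. (\<Sum>k\<in>R. q k j * c k) * u j)"
    unfolding app_def
  proof (intro sum.cong refl)
    fix j assume j: "j \<in> V"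
    have "q i j = q j i" using sym i j by auto
    also have "\<dots> = (\<Sum>k\<in>R. q j k * c k)" using c j by auto
    also have "\<dots> = (\<Sum>k\<in>R. q k j * c k)" using sym j R_sub by (intro sum.cong) auto
    finally show "q i j * u j = (\<Sum>k\<in>R. q k j * c k) * u j" by simp
  qed
  also have "\<dots> = (\<Sum>k\<in>R. c k * app V q u k)"
    unfolding app_def sum_distrib_left sum_distrib_right
    by (subst sum.swap) (simp add: algebra_simps)
  also have "\<dots> = 0" using z by simp
  finally show ?thesis .
qed

text \<open>In other words, the principal block on \<open>R\<close> is invertible: vanishing on the
  rows in \<open>R\<close> propagates to all rows, and the columns in \<open>R\<close> are
  independent.\<close>

lemma basis_inj:
  assumes "\<And>k. k \<in> R \<Longrightarrow> app V q u k = 0" "\<And>i. i \<in> V \<Longrightarrow> i \<notin> R \<Longrightarrow> u i = 0" "i \<in> V"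
  shows "u i = 0"
proof (cases "i \<in> R")
  case True
  have z: "(\<Sum>j\<in>R. q l j * u j) = 0" if "l \<in> V" for l
    using app_vanish_basis[OF assms(1) that] app_restrict[OF finV R_sub, of u q l] assms(2) by simp
  have "indep_cols q V R" using R unfolding col_basis_def by simp
  then show ?thesis using z True by (rule indep_colsD)
qed (use assms in auto)

text \<open>\<open>r\<close> is row \<open>j\<close> of the inverse of the principal block on
  \<open>R\<close>, extended by zero.\<close>

lemma inverse_row:
  assumes j: "j \<in> R"
  shows "\<exists>r. (\<forall>i. i \<notin> R \<longrightarrow> r i = 0) \<and> (\<forall>k\<in>R. app V q r k = (if k = j then 1 else 0))"
proof -
  \<comment> \<open>The extra unknown \<open>None\<close> is the right-hand side at
    \<open>j\<close>. It makes the system homogeneous with one unknown too many, and by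
    \<open>basis_inj\<close> its value is nonzero and can be scaled to 1.\<close>
  define J where "J = insert None (Some ` R)"
  define a where "a = (\<lambda>k l. case l of None \<Rightarrow> (if k = j then - 1 else 0) | Some m \<Rightarrow> q k m)"
  have "card J = Suc (card R)" unfolding J_def using finR by (auto simp: card_image)
  then have "card R < card J" by simp
  from underdetermined_system[OF finR _ this, of a] obtain v where
    v: "\<forall>k\<in>R. (\<Sum>l\<in>J. a k l * v l) = 0" "\<exists>l\<in>J. v l \<noteq> 0"
    unfolding J_def using finR by auto
  define u where "u = (\<lambda>i. if i \<in> R then v (Some i) else 0)"
  have appu: "app V q u k = (\<Sum>m\<in>R. q k m * v (Some m))" for k
    using app_restrict[OF finV R_sub, of u q k] unfolding u_def by simp
  have sumJ: "(\<Sum>l\<in>J. a k l * v l) = (if k = j then - v None else 0) + app V q u k" for k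
    unfolding J_def appu using finR
    by (subst sum.insert) (auto simp: a_def sum.reindex)
  have eq: "app V q u k = (if k = j then v None else 0)" if "k \<in> R" for k
  proof -
    have "(if k = j then - v None else 0) + app V q u k = 0" using v(1) that sumJ[of k] by simp
    then show ?thesis by (cases "k = j") (simp_all add: add_eq_0_iff)
  qed
  have "v None \<noteq> 0"
  proof
    assume n: "v None = 0"
    then have "u i = 0" if "i \<in> V" for i
      using basis_inj[of u i] eq that unfolding u_def by auto
    then have "v (Some i) = 0" if "i \<in> R" for i
      using that R_sub unfolding u_def by (metis subsetD)
    then show False using v(2) n unfolding J_def by auto
  qed
  have "app V q (\<lambda>i. u i / v None) k = app V q u k / v None" for k
    unfolding app_def by (simp add: sum_divide_distrib)
  then have "\<forall>k\<in>R. app V q (\<lambda>i. u i / v None) k = (if k = j then 1 else 0)"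
    using eq \<open>v None \<noteq> 0\<close> by simp
  moreover have "\<forall>i. i \<notin> R \<longrightarrow> u i / v None = 0" by (simp add: u_def)
  ultimately show ?thesis by (intro exI[of _ "\<lambda>i. u i / v None"]) blast
qed

text \<open>Moving the dependent column \<open>s\<close> to the other side of its expansion gives a
  kernel vector with entry \<open>- 1\<close> at \<open>s\<close>. This ties the corank to supports
  of kernel vectors.\<close>

lemma fundamental_kernel_vector:
  assumes s: "s \<in> V" "s \<notin> R"
  obtains c where "\<And>i. i \<in> V \<Longrightarrow> q i s = (\<Sum>k\<in>R. q i k * c k)"
    "(\<lambda>i. if i = s then - 1 else if i \<in> R then c i else 0) \<in> kern V q"
proof -
  obtain c where c: "\<And>j. j \<in> V \<Longrightarrow> q j s = (\<Sum>k\<in>R. q j k * c k)"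
    using basis_col s by blast
  define w where "w = (\<lambda>i. if i = s then - 1 else if i \<in> R then c i else 0)"
  have "app V q w i = 0" if "i \<in> V" for i
  proof -
    have "app V q w i = (\<Sum>j\<in>insert s R. q i j * w j)"
      using s R_sub by (intro app_restrict[OF finV]) (auto simp: w_def)
    also have "\<dots> = - q i s + (\<Sum>j\<in>R. q i j * w j)"
      using s finR by (simp add: w_def)
    also have "(\<Sum>j\<in>R. q i j * w j) = (\<Sum>j\<in>R. q i j * c j)"
      using s by (intro sum.cong) (auto simp: w_def)
    also have "- q i s + \<dots> = 0" using c[OF that] by simp
    finally show ?thesis .
  qed
  then have "w \<in> kern V q" unfolding kern_def by auto
  with c show ?thesis using that unfolding w_def by blast
qed

lemma corank_le_support:
  assumes T: "\<And>w. w \<in> kern V q \<Longrightarrow> supp_on V w \<subseteq> T"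
  shows "V - R \<subseteq> T"
proof
  fix s assume s: "s \<in> V - R"
  obtain c where "(\<lambda>i. if i = s then - 1 else if i \<in> R then c i else 0) \<in> kern V q"
    using fundamental_kernel_vector[of s] s by blast
  from T[OF this] show "s \<in> T" using s unfolding supp_on_def by auto
qed

text \<open>If the rows in \<open>N\<close> restricted to \<open>T\<close> are independent, the columns in \<open>T \<inter> R\<close> must
  be able to separate them.\<close>

lemma corank_le_deficiency:
  assumes TV: "T \<subseteq> V" and T: "\<And>w. w \<in> kern V q \<Longrightarrow> supp_on V w \<subseteq> T"
    and NV: "N \<subseteq> V" and N: "indep_cols q T N"
  shows "card (V - R) + card N \<le> card T"
proof -
  have fin: "finite T" "finite N" using TV NV finV by (auto intro: finite_subset)
  have "card N \<le> card (T \<inter> R)"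
  proof (rule indep_cols_card_le)
    show "indep_cols q (T \<inter> R) N"
      unfolding indep_cols_def
    proof (intro allI impI)
      fix l assume l: "\<forall>i\<in>T \<inter> R. (\<Sum>y\<in>N. q i y * l y) = 0"
      have "(\<Sum>y\<in>N. q s y * l y) = 0" if s: "s \<in> T" for s
      proof (cases "s \<in> R")
        case False
        have sV: "s \<in> V" using s TV by auto
        obtain c where c: "\<And>j. j \<in> V \<Longrightarrow> q j s = (\<Sum>k\<in>R. q j k * c k)"
          and w: "(\<lambda>i. if i = s then - 1 else if i \<in> R then c i else 0) \<in> kern V q"
          using fundamental_kernel_vector[OF sV False] by blast
        \<comment> \<open>The kernel vector of \<open>s\<close> is supported in \<open>T\<close>, so
          row \<open>s\<close> restricted to \<open>N\<close> is a combination of rows from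
          \<open>T \<inter> R\<close> alone. A relation \<open>l\<close> on those rows thus holds on
          all of \<open>T\<close>.\<close>
        have cz: "c k = 0" if k: "k \<in> R - T" for k
        proof -
          have "k \<in> V" "k \<noteq> s" using k R_sub s by auto
          then show ?thesis using T[OF w] k unfolding supp_on_def by auto
        qed
        have qs: "q s y = (\<Sum>k\<in>T \<inter> R. q k y * c k)" if y: "y \<in> N" for y
        proof -
          have yV: "y \<in> V" using y NV by auto
          have "q s y = q y s" using sym sV yV by auto
          also have "\<dots> = (\<Sum>k\<in>R. q y k * c k)" by (rule c[OF yV])
          also have "\<dots> = (\<Sum>k\<in>T \<inter> R. q y k * c k)"
            using cz finR by (intro sum.mono_neutral_right) auto
          also have "\<dots> = (\<Sum>k\<in>T \<inter> R. q k y * c k)"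
            using sym yV TV by (intro sum.cong) auto
          finally show ?thesis .
        qed
        have "(\<Sum>y\<in>N. q s y * l y) = (\<Sum>y\<in>N. (\<Sum>k\<in>T \<inter> R. q k y * c k) * l y)"
          by (intro sum.cong) (auto simp: qs)
        also have "\<dots> = (\<Sum>k\<in>T \<inter> R. c k * (\<Sum>y\<in>N. q k y * l y))"
          unfolding sum_distrib_left sum_distrib_right
          by (subst sum.swap) (simp add: algebra_simps)
        also have "\<dots> = 0" using l by simp
        finally show ?thesis .
      qed (use l s in auto)
      then show "\<forall>j\<in>N. l j = 0" using N unfolding indep_cols_def by blast
    qed
  qed (use fin in auto)
  moreover have "card T = card (T \<inter> R) + card (T - R)"
    using fin by (simp add: card_Int_Diff)
  moreover have "card (V - R) \<le> card (T - R)"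
    using corank_le_support[OF T] fin by (intro card_mono) auto
  ultimately show ?thesis by linarith
qed

end

end

section \<open>Random subsets\<close>

text \<open>\<open>ex p I f\<close> is the expectation of \<open>f F\<close> for the random subset \<open>F\<close> of \<open>I\<close> that contains
  every element independently with probability \<open>p\<close>.\<close>

definition bwt :: "real \<Rightarrow> 'i set \<Rightarrow> 'i set \<Rightarrow> real" where
  "bwt p I F = (\<Prod>i\<in>I. if i \<in> F then p else 1 - p)"

definition ex :: "real \<Rightarrow> 'i set \<Rightarrow> ('i set \<Rightarrow> real) \<Rightarrow> real" where
  "ex p I f = (\<Sum>F\<in>Pow I. bwt p I F * f F)"

definition pr :: "real \<Rightarrow> 'i set \<Rightarrow> ('i set \<Rightarrow> bool) \<Rightarrow> real" where
  "pr p I P = ex p I (\<lambda>F. of_bool (P F))"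

lemma ex_cong: "(\<And>F. F \<subseteq> I \<Longrightarrow> f F = g F) \<Longrightarrow> ex p I f = ex p I g"
  unfolding ex_def by (intro sum.cong) auto

lemma pr_cong: "(\<And>F. F \<subseteq> I \<Longrightarrow> P F = Q F) \<Longrightarrow> pr p I P = pr p I Q"
  unfolding pr_def by (intro ex_cong) auto

lemma ex_empty [simp]: "ex p {} f = f {}"
  unfolding ex_def bwt_def by simp

lemma ex_insert:
  assumes "finite I" "x \<notin> I"
  shows "ex p (insert x I) f = p * ex p I (\<lambda>F. f (insert x F)) + (1 - p) * ex p I f"
proof -
  have disj: "Pow I \<inter> insert x ` Pow I = {}" using assms by auto
  have inj: "inj_on (insert x) (Pow I)" using assms unfolding inj_on_def by auto
  have w1: "bwt p (insert x I) F = (1 - p) * bwt p I F" if "F \<in> Pow I" for F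
    using assms that unfolding bwt_def by (subst prod.insert) auto
  have w2: "bwt p (insert x I) (insert x F) = p * bwt p I F" if "F \<in> Pow I" for F
    using assms that unfolding bwt_def
    by (subst prod.insert) (auto intro!: prod.cong)
  have "ex p (insert x I) f =
      (\<Sum>F\<in>Pow I. bwt p (insert x I) F * f F) +
      (\<Sum>F\<in>Pow I. bwt p (insert x I) (insert x F) * f (insert x F))"
    unfolding ex_def Pow_insert using assms disj inj
    by (subst sum.union_disjoint) (auto simp: sum.reindex)
  also have "\<dots> = (\<Sum>F\<in>Pow I. (1 - p) * (bwt p I F * f F)) +
      (\<Sum>F\<in>Pow I. p * (bwt p I F * f (insert x F)))"
    by (intro arg_cong2[of _ _ _ _ "(+)"] sum.cong) (auto simp: w1 w2 mult.assoc)
  finally show ?thesis unfolding ex_def by (simp add: sum_distrib_left)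
qed

text \<open>Fubini for independent coordinates; every conditioning argument below reduces to
  it.\<close>

lemma ex_Un:
  assumes "finite I" "finite J" "I \<inter> J = {}"
  shows "ex p (I \<union> J) f = ex p I (\<lambda>F. ex p J (\<lambda>G. f (F \<union> G)))"
  using assms(1,3)
proof (induction I arbitrary: f rule: finite_induct)
  case (insert x I)
  then show ?case using assms(2) by (simp add: ex_insert)
qed simp

lemma ex_image:
  assumes "finite I" "inj_on g I"
  shows "ex p (g ` I) f = ex p I (\<lambda>F. f (g ` F))"
  using assms
proof (induction I arbitrary: f rule: finite_induct)
  case (insert x I)
  then show ?case by (simp add: ex_insert)
qed simp

lemma ex_const [simp]: "finite I \<Longrightarrow> ex p I (\<lambda>_. c) = c"
  by (induction I rule: finite_induct) (auto simp: ex_insert algebra_simps)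

lemma ex_cmult: "ex p I (\<lambda>F. c * f F) = c * ex p I f"
  unfolding ex_def by (simp add: sum_distrib_left algebra_simps)

lemma ex_add: "ex p I (\<lambda>F. f F + g F) = ex p I f + ex p I g"
  unfolding ex_def by (simp add: sum.distrib algebra_simps)

lemma ex_sum: "ex p I (\<lambda>F. \<Sum>x\<in>X. f x F) = (\<Sum>x\<in>X. ex p I (f x))"
  unfolding ex_def sum_distrib_left by (rule sum.swap)

lemma ex_swap: "ex p I (\<lambda>F. ex p J (\<lambda>G. f F G)) = ex p J (\<lambda>G. ex p I (\<lambda>F. f F G))"
  unfolding ex_def sum_distrib_left
  by (subst sum.swap) (simp add: algebra_simps)

locale bern =
  fixes p :: real
  assumes p0: "0 \<le> p" and p1: "p \<le> 1"
begin

lemma bwt_nonneg: "0 \<le> bwt p I F"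
  unfolding bwt_def using p0 p1 by (intro prod_nonneg) auto

lemma ex_mono: "(\<And>F. F \<subseteq> I \<Longrightarrow> f F \<le> g F) \<Longrightarrow> ex p I f \<le> ex p I g"
  unfolding ex_def by (intro sum_mono mult_left_mono bwt_nonneg) auto

lemma pr_mono: "(\<And>F. F \<subseteq> I \<Longrightarrow> P F \<Longrightarrow> Q F) \<Longrightarrow> pr p I P \<le> pr p I Q"
  unfolding pr_def by (intro ex_mono) auto

lemma ex_nonneg: "(\<And>F. F \<subseteq> I \<Longrightarrow> 0 \<le> f F) \<Longrightarrow> 0 \<le> ex p I f"
  unfolding ex_def by (intro sum_nonneg mult_nonneg_nonneg bwt_nonneg) auto

lemma pr_nonneg: "0 \<le> pr p I P"
  unfolding pr_def by (intro ex_nonneg) auto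

lemma ex_le_const: "finite I \<Longrightarrow> (\<And>F. F \<subseteq> I \<Longrightarrow> f F \<le> c) \<Longrightarrow> ex p I f \<le> c"
  using ex_mono[of I f "\<lambda>_. c"] by simp

lemma pr_eq_0: "finite I \<Longrightarrow> (\<And>F. F \<subseteq> I \<Longrightarrow> \<not> P F) \<Longrightarrow> pr p I P = 0"
  using pr_cong[of I P "\<lambda>_. False" p] by (simp add: pr_def)

lemma pr_union_bound:
  assumes "finite X" "\<And>F. F \<subseteq> I \<Longrightarrow> P F \<Longrightarrow> \<exists>x\<in>X. Q x F"
  shows "pr p I P \<le> (\<Sum>x\<in>X. pr p I (Q x))"
  unfolding pr_def ex_sum[symmetric]
proof (rule ex_mono)
  fix F assume F: "F \<subseteq> I"
  show "of_bool (P F) \<le> (\<Sum>x\<in>X. of_bool (Q x F) :: real)"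
  proof (cases "P F")
    case True
    then obtain x where x: "x \<in> X" "Q x F" using assms F by blast
    have "of_bool (Q x F) \<le> (\<Sum>x\<in>X. of_bool (Q x F) :: real)"
      using x assms by (intro member_le_sum) auto
    then show ?thesis using x by simp
  qed (auto intro: sum_nonneg)
qed

lemma pr_disj_le:
  assumes "\<And>F. F \<subseteq> I \<Longrightarrow> P F \<Longrightarrow> Q F \<or> R F"
  shows "pr p I P \<le> pr p I Q + pr p I R"
  unfolding pr_def ex_add[symmetric] by (rule ex_mono) (use assms in auto)

lemma pr_compl: "finite I \<Longrightarrow> pr p I (\<lambda>F. \<not> P F) = 1 - pr p I P"
proof -
  assume "finite I"
  then have "1 = ex p I (\<lambda>F. of_bool (P F) + of_bool (\<not> P F))"
    by (subst ex_cong[where g = "\<lambda>_. 1"]) auto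
  then show ?thesis unfolding pr_def ex_add by simp
qed

text \<open>The total probability is an average over the revealed outcome \<open>G\<close>, hence at
  most the worst conditional probability.\<close>

lemma pr_cond_le:
  assumes "finite I" "finite J" "I \<inter> J = {}"
    and "\<And>G. G \<subseteq> J \<Longrightarrow> pr p I (\<lambda>F. P (F \<union> G)) \<le> b"
  shows "pr p (I \<union> J) P \<le> b"
proof -
  have "pr p (I \<union> J) P = ex p J (\<lambda>G. pr p I (\<lambda>F. P (F \<union> G)))"
    unfolding pr_def ex_Un[OF assms(1-3)] by (rule ex_swap)
  also have "\<dots> \<le> b" using assms by (intro ex_le_const) auto
  finally show ?thesis .
qed

lemma pr_marginal:
  assumes "finite J" "I \<subseteq> J"
  shows "pr p J (\<lambda>F. P (F \<inter> I)) = pr p I P"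
proof -
  have fin: "finite I" "finite (J - I)" using assms by (auto intro: finite_subset)
  have "J = I \<union> (J - I)" using assms by auto
  then have "pr p J (\<lambda>F. P (F \<inter> I)) = pr p (I \<union> (J - I)) (\<lambda>F. P (F \<inter> I))" by simp
  also have "\<dots> = ex p I (\<lambda>F. ex p (J - I) (\<lambda>G. of_bool (P ((F \<union> G) \<inter> I))))"
    unfolding pr_def using fin by (subst ex_Un) auto
  also have "\<dots> = ex p I (\<lambda>F. ex p (J - I) (\<lambda>G. of_bool (P F)))"
    by (intro ex_cong arg_cong[of _ _ of_bool] arg_cong[of _ _ P]) auto
  also have "\<dots> = pr p I P" using fin unfolding pr_def by simp
  finally show ?thesis .
qed

text \<open>Writing the \<open>i\<close>-th event as \<open>P i (F \<inter> blk i)\<close> makes it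
  depend on its own block only, so disjoint blocks give independent events.\<close>

lemma pr_blocks_le:
  assumes "finite S" "\<And>i. i \<in> S \<Longrightarrow> finite (blk i)"
    and "\<And>i j. i \<in> S \<Longrightarrow> j \<in> S \<Longrightarrow> i \<noteq> j \<Longrightarrow> blk i \<inter> blk j = {}"
    and "\<And>i. i \<in> S \<Longrightarrow> pr p (blk i) (P i) \<le> b"
  shows "pr p (\<Union>i\<in>S. blk i) (\<lambda>F. \<forall>i\<in>S. P i (F \<inter> blk i)) \<le> b ^ card S"
  using assms
proof (induction S rule: finite_induct)
  case empty
  then show ?case by (simp add: pr_def)
next
  case (insert x S)
  let ?U = "\<Union>i\<in>S. blk i"
  have fin: "finite ?U" "finite (blk x)" using insert by auto
  have disj: "blk x \<inter> ?U = {}" using insert.prems(2)[of x] insert.hyps by auto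
  have "pr p (\<Union>i\<in>insert x S. blk i) (\<lambda>F. \<forall>i\<in>insert x S. P i (F \<inter> blk i)) =
      pr p (blk x \<union> ?U) (\<lambda>F. P x (F \<inter> blk x) \<and> (\<forall>i\<in>S. P i (F \<inter> blk i)))"
    by simp
  also have "\<dots> = ex p (blk x) (\<lambda>F. ex p ?U (\<lambda>G.
      of_bool (P x ((F \<union> G) \<inter> blk x) \<and> (\<forall>i\<in>S. P i ((F \<union> G) \<inter> blk i)))))"
    unfolding pr_def using fin disj by (subst ex_Un) auto
  also have "\<dots> = ex p (blk x) (\<lambda>F. ex p ?U (\<lambda>G.
      of_bool (\<forall>i\<in>S. P i (G \<inter> blk i)) * of_bool (P x F)))"
  proof (intro ex_cong)
    fix F G assume "F \<subseteq> blk x" "G \<subseteq> ?U"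
    then have "(F \<union> G) \<inter> blk x = F" "\<And>i. i \<in> S \<Longrightarrow> (F \<union> G) \<inter> blk i = G \<inter> blk i"
      using disj by auto
    then show "of_bool (P x ((F \<union> G) \<inter> blk x) \<and> (\<forall>i\<in>S. P i ((F \<union> G) \<inter> blk i))) =
      (of_bool (\<forall>i\<in>S. P i (G \<inter> blk i)) * of_bool (P x F) :: real)" by auto
  qed
  also have "\<dots> = ex p (blk x) (\<lambda>F. pr p ?U (\<lambda>G. \<forall>i\<in>S. P i (G \<inter> blk i)) * of_bool (P x F))"
    unfolding pr_def by (subst mult.commute) (simp add: ex_cmult mult.commute)
  also have "\<dots> = pr p ?U (\<lambda>G. \<forall>i\<in>S. P i (G \<inter> blk i)) * pr p (blk x) (P x)"
    unfolding ex_cmult by (simp add: pr_def)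
  also have "\<dots> \<le> b ^ card S * b"
  proof (intro mult_mono)
    show "pr p ?U (\<lambda>G. \<forall>i\<in>S. P i (G \<inter> blk i)) \<le> b ^ card S"
      using insert by auto
    show "pr p (blk x) (P x) \<le> b" using insert by auto
    then show "0 \<le> b ^ card S" using pr_nonneg order_trans by (meson zero_le_power)
  qed (rule pr_nonneg)
  finally show ?case using insert.hyps by (simp add: mult.commute)
qed

lemma ex_prod:
  assumes "finite I"
  shows "ex p I (\<lambda>F. \<Prod>i\<in>I. g i (i \<in> F)) = (\<Prod>i\<in>I. p * g i True + (1 - p) * g i False)"
  using assms
proof (induction I rule: finite_induct)
  case (insert x I)
  have "ex p I (\<lambda>F. \<Prod>i\<in>insert x I. g i (i \<in> insert x F)) =
      ex p I (\<lambda>F. g x True * (\<Prod>i\<in>I. g i (i \<in> F)))"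
  proof (rule ex_cong)
    fix F assume "F \<subseteq> I"
    have "g i (i \<in> insert x F) = g i (i \<in> F)" if "i \<in> I" for i
    proof -
      have "(i \<in> insert x F) = (i \<in> F)" using that insert.hyps by auto
      then show ?thesis by simp
    qed
    then have "(\<Prod>i\<in>I. g i (i \<in> insert x F)) = (\<Prod>i\<in>I. g i (i \<in> F))"
      by (rule prod.cong[OF refl])
    then show "(\<Prod>i\<in>insert x I. g i (i \<in> insert x F)) = g x True * (\<Prod>i\<in>I. g i (i \<in> F))"
      using insert.hyps by (subst prod.insert) simp_all
  qed
  moreover have "ex p I (\<lambda>F. \<Prod>i\<in>insert x I. g i (i \<in> F)) =
      ex p I (\<lambda>F. g x False * (\<Prod>i\<in>I. g i (i \<in> F)))"
  proof (rule ex_cong)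
    fix F assume "F \<subseteq> I"
    then have "x \<notin> F" using insert.hyps by auto
    then show "(\<Prod>i\<in>insert x I. g i (i \<in> F)) = g x False * (\<Prod>i\<in>I. g i (i \<in> F))"
      using insert.hyps by simp
  qed
  ultimately show ?case
    using insert by (simp add: ex_insert ex_cmult algebra_simps)
qed simp

lemma pr_present_absent:
  assumes "finite I" "A \<subseteq> I" "B \<subseteq> I" "A \<inter> B = {}"
  shows "pr p I (\<lambda>F. A \<subseteq> F \<and> F \<inter> B = {}) = p ^ card A * (1 - p) ^ card B"
proof -
  define g where "g = (\<lambda>i b. of_bool ((i \<in> A \<longrightarrow> b) \<and> (i \<in> B \<longrightarrow> \<not> b)) :: real)"
  have "pr p I (\<lambda>F. A \<subseteq> F \<and> F \<inter> B = {}) = ex p I (\<lambda>F. \<Prod>i\<in>I. g i (i \<in> F))"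
    unfolding pr_def
  proof (rule ex_cong)
    fix F
    show "of_bool (A \<subseteq> F \<and> F \<inter> B = {}) = (\<Prod>i\<in>I. g i (i \<in> F))"
    proof (cases "A \<subseteq> F \<and> F \<inter> B = {}")
      case True
      then have "(\<Prod>i\<in>I. g i (i \<in> F)) = (\<Prod>i\<in>I. 1)"
        by (intro prod.cong) (auto simp: g_def)
      then show ?thesis using True by simp
    next
      case False
      then obtain i where "i \<in> I" "g i (i \<in> F) = 0" using assms unfolding g_def by auto
      then have "(\<Prod>i\<in>I. g i (i \<in> F)) = 0" using assms(1) by (meson prod_zero)
      then show ?thesis using False by (simp only:) simp
    qed
  qed
  also have "\<dots> = (\<Prod>i\<in>I. p * g i True + (1 - p) * g i False)" by (rule ex_prod[OF assms(1)])
  also have "\<dots> = (\<Prod>i\<in>A \<union> B. p * g i True + (1 - p) * g i False)"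
    using assms by (intro prod.mono_neutral_right) (auto simp: g_def)
  also have "\<dots> = (\<Prod>i\<in>A. p * g i True + (1 - p) * g i False) * (\<Prod>i\<in>B. p * g i True + (1 - p) * g i False)"
    using assms by (intro prod.union_disjoint) (auto intro: finite_subset)
  also have "(\<Prod>i\<in>A. p * g i True + (1 - p) * g i False) = (\<Prod>i\<in>A. p)"
    using assms by (intro prod.cong) (auto simp: g_def)
  also have "(\<Prod>i\<in>B. p * g i True + (1 - p) * g i False) = (\<Prod>i\<in>B. 1 - p)"
    using assms by (intro prod.cong) (auto simp: g_def)
  finally show ?thesis by simp
qed

end

text \<open>Outside \<open>I\<close> the variables are almost surely False, so
  \<open>{i. \<xi> i}\<close> is a random subset of \<open>I\<close> with weights
  \<open>bwt\<close>. This is the link to the probability space of the theorem.\<close>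

lemma Pi_pmf_bernoulli_eq_pr:
  assumes "finite I" "0 \<le> p" "p \<le> 1"
  shows "measure_pmf.prob (Pi_pmf I False (\<lambda>_. bernoulli_pmf p)) {\<xi>. P {i. \<xi> i}} = pr p I P"
proof -
  let ?D = "Pi_pmf I False (\<lambda>_. bernoulli_pmf p)"
  have pmf: "pmf ?D (\<lambda>i. i \<in> F) = bwt p I F" if "F \<subseteq> I" for F
  proof -
    have "pmf ?D (\<lambda>i. i \<in> F) = (\<Prod>i\<in>I. pmf (bernoulli_pmf p) (i \<in> F))"
      using assms that by (intro pmf_Pi') auto
    also have "\<dots> = bwt p I F"
      unfolding bwt_def using assms by (intro prod.cong) auto
    finally show ?thesis .
  qed
  let ?S = "(\<lambda>F i. i \<in> F) ` {F \<in> Pow I. P F}"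
  have inj: "inj_on (\<lambda>F i. i \<in> F) X" for X :: "'a set set"
    unfolding inj_on_def by (auto simp: fun_eq_iff)
  have "measure_pmf.prob ?D {\<xi>. P {i. \<xi> i}} = measure_pmf.prob ?D ?S"
  proof (rule measure_prob_cong_0)
    fix \<xi> assume \<xi>: "\<xi> \<in> {\<xi>. P {i. \<xi> i}} - ?S"
    have "\<not> {i. \<xi> i} \<subseteq> I"
    proof
      assume "{i. \<xi> i} \<subseteq> I"
      then have "\<xi> \<in> ?S" using \<xi> by (intro image_eqI[of _ _ "{i. \<xi> i}"]) auto
      then show False using \<xi> by auto
    qed
    then show "pmf ?D \<xi> = 0" using assms by (intro pmf_Pi_outside) auto
  qed auto
  also have "\<dots> = sum (pmf ?D) ?S" using assms by (intro measure_measure_pmf_finite) auto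
  also have "\<dots> = (\<Sum>F\<in>{F \<in> Pow I. P F}. bwt p I F)"
    using pmf by (subst sum.reindex[OF inj]) (auto intro!: sum.cong)
  also have "\<dots> = (\<Sum>F\<in>Pow I. if P F then bwt p I F else 0)"
    using assms by (subst sum.inter_filter) auto
  also have "\<dots> = pr p I P" unfolding pr_def ex_def by (intro sum.cong) auto
  finally show ?thesis .
qed

section \<open>Anticoncentration\<close>

text \<open>Turns the family of subsets with a given sum into an antichain: if
  \<open>A \<subset> B\<close> had equal sums, \<open>B - A\<close> would be a nonempty set of sum
  0.\<close>

definition zero_sum_free :: "'i set \<Rightarrow> ('i \<Rightarrow> complex) \<Rightarrow> bool" where
  "zero_sum_free T a \<longleftrightarrow> (\<forall>D\<subseteq>T. D \<noteq> {} \<longrightarrow> sum a D \<noteq> 0)"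

lemma zero_sum_free_subset: "zero_sum_free T a \<Longrightarrow> S \<subseteq> T \<Longrightarrow> zero_sum_free S a"
  unfolding zero_sum_free_def by blast

lemma zero_sum_freeD: "zero_sum_free T a \<Longrightarrow> D \<subseteq> T \<Longrightarrow> sum a D = 0 \<Longrightarrow> D = {}"
  unfolding zero_sum_free_def by auto

text \<open>A set of size \<open>a\<close> survives the deletion of a uniformly random element of an
  \<open>m + 1\<close> element set with probability \<open>(m + 1 - a) / (m + 1)\<close>, which is
  the weight needed to pass from \<open>m\<close> to \<open>m + 1\<close> in the LYM sum.\<close>

lemma inverse_binomial_pred:
  assumes "a \<le> m"
  shows "1 / real (Suc m choose a) = (real (Suc m) - real a) / real (Suc m) * (1 / real (m choose a))"
proof -
  have "(Suc m - a) * (Suc m choose a) = Suc m * (m choose a)"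
    using binomial_absorb_comp[of "Suc m" a] by simp
  then have "(real (Suc m) - real a) * real (Suc m choose a) = real (Suc m) * real (m choose a)"
    using assms by (metis le_SucI of_nat_diff of_nat_mult)
  moreover have "real (Suc m choose a) > 0" "real (m choose a) > 0" "real (Suc m) > 0"
    using assms by (auto simp del: binomial_Suc_Suc)
  ultimately show ?thesis by (simp add: divide_simps del: binomial_Suc_Suc of_nat_Suc)
qed

text \<open>The subsets with a prescribed sum form an antichain, so this is an instance of the LYM
  inequality. Deleting a uniformly random element reduces it to smaller sets.\<close>

lemma LYM_sum_level:
  assumes "finite T" "zero_sum_free T a"
  shows "(\<Sum>A | A \<subseteq> T \<and> sum a A = c. 1 / real (card T choose card A)) \<le> 1"
  using assms
proof (induction "card T" arbitrary: T)
  case 0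
  then have "T = {}" by auto
  then have "(\<Sum>A | A \<subseteq> T \<and> sum a A = c. 1 / real (card T choose card A)) \<le>
      (\<Sum>A\<in>{T}. 1 / real (card T choose card A))"
    by (intro sum_mono2) auto
  then show ?case using \<open>T = {}\<close> by simp
next
  case (Suc m T)
  define X where "X = {A. A \<subseteq> T \<and> sum a A = c}"
  have finX: "finite X" unfolding X_def using Suc by auto
  show ?case
  \<comment> \<open>Any other member misses an element and survives some deletion. \<open>T\<close>
    does not, but if it is a member it is the only one, since \<open>T - A\<close> would have sum
    0.\<close>
  proof (cases "T \<in> X")
    case True
    have "X \<subseteq> {T}"
    proof
      fix A assume A: "A \<in> X"
      have "sum a (T - A) = sum a T - sum a A"
        using A Suc unfolding X_def by (intro sum_diff) auto
      then have "sum a (T - A) = 0" using A True unfolding X_def by simp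
      with Suc.prems(2) Diff_subset have "T - A = {}" by (rule zero_sum_freeD)
      then show "A \<in> {T}" using A unfolding X_def by auto
    qed
    then have "(\<Sum>A\<in>X. 1 / real (card T choose card A)) \<le>
        (\<Sum>A\<in>{T}. 1 / real (card T choose card A))"
      by (intro sum_mono2) auto
    then show ?thesis unfolding X_def by simp
  next
    case False
    have cA: "card A \<le> m" if "A \<in> X" for A
    proof -
      have "A \<subset> T" using that False unfolding X_def by auto
      then show ?thesis using psubset_card_mono[of T A] Suc by simp
    qed
    have "(\<Sum>A\<in>X. 1 / real (card T choose card A)) =
        (\<Sum>A\<in>X. (\<Sum>x\<in>T - A. 1 / real (m choose card A)) / real (Suc m))"
    proof (intro sum.cong refl)
      fix A assume A: "A \<in> X"
      then have "A \<subseteq> T" "finite A" using Suc.prems unfolding X_def by (auto intro: finite_subset)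
      then have "card (T - A) = Suc m - card A"
        using Suc.hyps(2) by (simp add: card_Diff_subset)
      then have "(\<Sum>x\<in>T - A. 1 / real (m choose card A)) =
          (real (Suc m) - real (card A)) * (1 / real (m choose card A))"
        using cA[OF A] by (simp add: of_nat_diff)
      then show "1 / real (card T choose card A) = (\<Sum>x\<in>T - A. 1 / real (m choose card A)) / real (Suc m)"
        by (simp only: Suc.hyps(2)[symmetric] inverse_binomial_pred[OF cA[OF A]]) simp
    qed
    also have "\<dots> = (\<Sum>A\<in>X. \<Sum>x\<in>T. if x \<notin> A then 1 / real (m choose card A) else 0) / real (Suc m)"
    proof -
      have "(\<Sum>x\<in>T - A. v) = (\<Sum>x\<in>T. if x \<notin> A then v else 0)" for A and v :: real
        unfolding set_diff_eq by (rule sum.inter_filter[OF Suc.prems(1)])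
      then show ?thesis by (simp only: sum_divide_distrib[of _ X "real (Suc m)", symmetric])
    qed
    also have "\<dots> = (\<Sum>x\<in>T. \<Sum>A\<in>X. if x \<notin> A then 1 / real (m choose card A) else 0) / real (Suc m)"
      by (subst sum.swap) simp
    also have "\<dots> \<le> (\<Sum>x\<in>T. 1) / real (Suc m)"
    proof (intro divide_right_mono sum_mono)
      fix x assume x: "x \<in> T"
      have cm: "card (T - {x}) = m" using Suc x by simp
      have "(\<Sum>A\<in>X. if x \<notin> A then 1 / real (m choose card A) else 0) =
          (\<Sum>A | A \<in> X \<and> x \<notin> A. 1 / real (m choose card A))"
        using finX by (simp add: sum.inter_filter)
      also have "{A. A \<in> X \<and> x \<notin> A} = {A. A \<subseteq> T - {x} \<and> sum a A = c}"
        unfolding X_def by auto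
      also have "(\<Sum>A | A \<subseteq> T - {x} \<and> sum a A = c. 1 / real (m choose card A)) \<le> 1"
        using Suc.hyps(1)[of "T - {x}"] Suc.prems cm
        by (auto intro: zero_sum_free_subset)
      finally show "(\<Sum>A\<in>X. if x \<notin> A then 1 / real (m choose card A) else 0) \<le> 1" .
    qed auto
    also have "\<dots> = 1" using Suc.hyps(2)[symmetric] by simp
    finally show ?thesis unfolding X_def .
  qed
qed

text \<open>A half plane without 0 that is closed under addition and contains exactly one of
  \<open>z\<close> and \<open>- z\<close> for \<open>z \<noteq> 0\<close>; it replaces the sign of a
  real coefficient.\<close>

definition lex_pos :: "complex \<Rightarrow> bool" where
  "lex_pos z \<longleftrightarrow> Re z > 0 \<or> (Re z = 0 \<and> Im z > 0)"

lemma sum_lex_pos: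
  assumes "finite D" "D \<noteq> {}" "\<And>i. i \<in> D \<Longrightarrow> lex_pos (a i)"
  shows "lex_pos (sum a D)"
  using assms
proof (induction D rule: finite_ne_induct)
  case (insert x D)
  have "lex_pos (a x)" "lex_pos (sum a D)" using insert by auto
  then show ?case using insert.hyps unfolding lex_pos_def by auto
qed auto

text \<open>Both sign classes are zero-sum free, and the larger one contains at least half of
  \<open>T\<close>.\<close>

lemma zero_sum_free_half:
  fixes a :: "'i \<Rightarrow> complex"
  assumes "finite T" "\<And>i. i \<in> T \<Longrightarrow> a i \<noteq> 0"
  shows "\<exists>S\<subseteq>T. card T \<le> 2 * card S \<and> zero_sum_free S a"
proof -
  define P where "P = {i \<in> T. lex_pos (a i)}"
  define N where "N = {i \<in> T. \<not> lex_pos (a i)}"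
  have z0: "\<not> lex_pos 0" unfolding lex_pos_def by simp
  have fin: "finite P" "finite N" using assms unfolding P_def N_def by auto
  have "zero_sum_free P a"
    unfolding zero_sum_free_def
  proof (intro allI impI)
    fix D assume "D \<subseteq> P" "D \<noteq> {}"
    then have "lex_pos (sum a D)"
      using fin by (intro sum_lex_pos) (auto simp: P_def intro: finite_subset)
    then show "sum a D \<noteq> 0" using z0 by auto
  qed
  moreover have "zero_sum_free N a"
    unfolding zero_sum_free_def
  proof (intro allI impI)
    fix D assume D: "D \<subseteq> N" "D \<noteq> {}"
    have "lex_pos (- a i)" if "i \<in> N" for i
      using that assms(2)[of i] unfolding N_def lex_pos_def by (auto simp: complex_eq_iff)
    then have "lex_pos (\<Sum>i\<in>D. - a i)"
      using D fin by (intro sum_lex_pos) (auto intro: finite_subset)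
    then show "sum a D \<noteq> 0" using z0 by (auto simp: sum_negf)
  qed
  moreover have "card T = card P + card N"
  proof -
    have "T = P \<union> N" "P \<inter> N = {}" unfolding P_def N_def by auto
    then show ?thesis using fin card_Un_disjoint by metis
  qed
  moreover have "P \<subseteq> T" "N \<subseteq> T" unfolding P_def N_def by auto
  ultimately show ?thesis by (cases "card P \<le> card N") (auto intro: exI[of _ P] exI[of _ N])
qed

definition bin_prob :: "nat \<Rightarrow> real \<Rightarrow> nat \<Rightarrow> real" where
  "bin_prob M p k = real (M choose k) * p ^ k * (1 - p) ^ (M - k)"

lemma bwt_eq:
  assumes "finite I" "F \<subseteq> I"
  shows "bwt p I F = p ^ card F * (1 - p) ^ (card I - card F)"
proof -
  have "bwt p I F = (\<Prod>i\<in>F. p) * (\<Prod>i\<in>I - F. 1 - p)"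
  proof -
    have "bwt p I F = (\<Prod>i\<in>I \<inter> {i. i \<in> F}. p) * (\<Prod>i\<in>I \<inter> - {i. i \<in> F}. 1 - p)"
      unfolding bwt_def using assms by (subst prod.If_cases) auto
    moreover have "I \<inter> {i. i \<in> F} = F" "I \<inter> - {i. i \<in> F} = I - F" using assms by auto
    ultimately show ?thesis by simp
  qed
  moreover have "finite F" using assms by (auto intro: finite_subset)
  ultimately show ?thesis using assms by (simp add: card_Diff_subset)
qed

context bern
begin

lemma bin_prob_nonneg: "0 \<le> bin_prob M p k"
  unfolding bin_prob_def using p0 p1 by auto

lemma sum_bin_prob: "(\<Sum>k\<le>M. bin_prob M p k) = 1"
  using binomial_ring[of p "1 - p" M] unfolding bin_prob_def by simp

lemma sum_bin_prob_le_1: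
  assumes "finite K" "K \<subseteq> {..M}"
  shows "(\<Sum>k\<in>K. bin_prob M p k) \<le> 1"
  unfolding sum_bin_prob[of M, symmetric] using assms bin_prob_nonneg by (intro sum_mono2) auto

lemma bin_prob_le_1: "k \<le> M \<Longrightarrow> bin_prob M p k \<le> 1"
  using sum_bin_prob_le_1[of "{k}" M] by simp

text \<open>Sets of equal size have equal weight, so the weight of \<open>F\<close> is a binomial
  point mass divided by \<open>card T choose card F\<close>, and the LYM inequality bounds the sum
  of the reciprocals by 1. This is the antichain proof of Littlewood-Offord for biased
  coordinates.\<close>

lemma pr_sum_eq_le_aux:
  assumes T: "finite T" "zero_sum_free T a"
    and b: "\<And>k. k \<le> card T \<Longrightarrow> bin_prob (card T) p k \<le> b"
  shows "pr p T (\<lambda>F. sum a F = c) \<le> b"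
proof -
  let ?X = "{A. A \<subseteq> T \<and> sum a A = c}"
  have b0: "0 \<le> b" using b[of 0] bin_prob_nonneg order_trans by blast
  have "pr p T (\<lambda>F. sum a F = c) = (\<Sum>F\<in>Pow T. if sum a F = c then bwt p T F else 0)"
    unfolding pr_def ex_def by (intro sum.cong) auto
  also have "\<dots> = (\<Sum>F\<in>{F\<in>Pow T. sum a F = c}. bwt p T F)"
    using T by (subst sum.inter_filter) auto
  also have "{F\<in>Pow T. sum a F = c} = ?X" by auto
  also have "(\<Sum>F\<in>?X. bwt p T F) \<le> (\<Sum>F\<in>?X. b * (1 / real (card T choose card F)))"
  proof (rule sum_mono)
    fix F assume F: "F \<in> ?X"
    then have cF: "card F \<le> card T" using T by (auto intro: card_mono)
    then have pos: "real (card T choose card F) > 0" by simp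
    have "bwt p T F * real (card T choose card F) = bin_prob (card T) p (card F)"
      using F T by (simp add: bwt_eq bin_prob_def)
    also have "\<dots> \<le> b" using b cF by auto
    finally show "bwt p T F \<le> b * (1 / real (card T choose card F))"
      using pos by (simp add: field_simps)
  qed
  also have "\<dots> = b * (\<Sum>F\<in>?X. 1 / real (card T choose card F))" by (simp add: sum_distrib_left)
  also have "\<dots> \<le> b * 1" using LYM_sum_level[OF T, of c] b0 by (intro mult_left_mono) auto
  finally show ?thesis by simp
qed

text \<open>Condition on all coordinates outside a zero-sum-free set of \<open>M\<close> nonzero
  coefficients. \<open>M\<close> is left free because the sparse bound truncates it to keep
  \<open>M * p \<le> 1\<close>.\<close>

lemma pr_sum_eq_le:
  fixes a :: "'i \<Rightarrow> complex"
  assumes T: "finite T" and M: "2 * M \<le> Suc (card {i \<in> T. a i \<noteq> 0})"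
    and b: "\<And>k. k \<le> M \<Longrightarrow> bin_prob M p k \<le> b"
  shows "pr p T (\<lambda>F. sum a F = c) \<le> b"
proof -
  have "\<exists>S\<subseteq>{i \<in> T. a i \<noteq> 0}. card {i \<in> T. a i \<noteq> 0} \<le> 2 * card S \<and> zero_sum_free S a"
    by (rule zero_sum_free_half) (use T in simp_all)
  then obtain S where S: "S \<subseteq> {i \<in> T. a i \<noteq> 0}" "card {i \<in> T. a i \<noteq> 0} \<le> 2 * card S" "zero_sum_free S a"
    by (elim exE conjE)
  have "M \<le> card S" using S(2) M by linarith
  then obtain S' where S': "S' \<subseteq> S" "card S' = M" "finite S'"
    by (meson obtain_subset_with_card_n)
  have sub: "S' \<subseteq> T" using S S' by auto
  have z: "zero_sum_free S' a" using S(3) S'(1) by (rule zero_sum_free_subset)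
  have "pr p (S' \<union> (T - S')) (\<lambda>F. sum a F = c) \<le> b"
  proof (rule pr_cond_le)
    fix G assume G: "G \<subseteq> T - S'"
    have "pr p S' (\<lambda>F. sum a (F \<union> G) = c) = pr p S' (\<lambda>F. sum a F = c - sum a G)"
    proof (rule pr_cong)
      fix F assume F: "F \<subseteq> S'"
      have "sum a (F \<union> G) = sum a F + sum a G"
        using F G T S'(3) by (intro sum.union_disjoint) (auto intro: finite_subset)
      then show "(sum a (F \<union> G) = c) = (sum a F = c - sum a G)" by (auto simp: algebra_simps)
    qed
    also have "\<dots> \<le> b" using S' z b by (intro pr_sum_eq_le_aux) auto
    finally show "pr p S' (\<lambda>F. sum a (F \<union> G) = c) \<le> b" .
  qed (use S' T in auto)
  moreover have "S' \<union> (T - S') = T" using sub by auto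
  ultimately show ?thesis by simp
qed

end

section \<open>Point masses of the binomial distribution\<close>

lemma bin_prob_ratio:
  assumes "k < M" "0 < p" "p < 1"
  shows "bin_prob M p (Suc k) * (real (Suc k) * (1 - p)) = bin_prob M p k * ((real M - real k) * p)"
proof -
  have "real (Suc k) * real (M choose Suc k) = (real M - real k) * real (M choose k)"
    using assms binomial_absorb_comp[of M k] binomial_absorption[of k M]
    by (metis (no_types, opaque_lifting) Suc_times_binomial_eq binomial_absorption diff_Suc_1 less_imp_le_nat mult.commute of_nat_diff of_nat_mult)
  note e1 = this
  have e2: "(1 - p) ^ (M - k) = (1 - p) * (1 - p) ^ (M - Suc k)"
    using assms by (metis Suc_diff_Suc power_Suc)
  have "bin_prob M p (Suc k) * (real (Suc k) * (1 - p)) =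
      (real (Suc k) * real (M choose Suc k)) * (((1 - p) * (1 - p) ^ (M - Suc k)) * (p * p ^ k))"
    unfolding bin_prob_def power_Suc by (simp only: mult_ac)
  also have "\<dots> = ((real M - real k) * real (M choose k)) * ((1 - p) ^ (M - k) * (p * p ^ k))"
    unfolding e1 e2[symmetric] ..
  also have "\<dots> = bin_prob M p k * ((real M - real k) * p)"
    unfolding bin_prob_def by (simp only: mult_ac)
  finally show ?thesis .
qed

text \<open>Bernoulli's inequality: at most \<open>r\<close> factors \<open>1 - e\<close> lose at
  most \<open>e * r \<le> 1 / 2\<close>.\<close>

lemma slow_decay_half:
  fixes f :: "nat \<Rightarrow> real"
  assumes f: "\<And>j. 0 \<le> f j" "\<And>j. j < r \<Longrightarrow> (1 - e) * f j \<le> f (Suc j)"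
    and e: "0 \<le> e" "e \<le> 1" "e * real r \<le> 1 / 2" and j: "j \<le> r"
  shows "f 0 / 2 \<le> f j"
proof -
  have "(1 - real j * e) * f 0 \<le> f j" using j
  proof (induction j)
    case (Suc j)
    have "(1 - real (Suc j) * e) * f 0 \<le> ((1 - e) * (1 - real j * e)) * f 0"
      using e f by (intro mult_right_mono) (auto simp: algebra_simps)
    also have "\<dots> \<le> (1 - e) * f j" using Suc e by (simp add: mult.assoc mult_left_mono)
    finally show ?case using f(2)[of j] Suc.prems by linarith
  qed simp
  moreover have "1 / 2 * f 0 \<le> (1 - real j * e) * f 0"
  proof (rule mult_right_mono[OF _ f(1)])
    have "real j * e \<le> real r * e" using j e by (intro mult_right_mono) auto
    then show "1 / 2 \<le> 1 - real j * e" using e(3) by (simp add: mult.commute)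
  qed
  ultimately show ?thesis by simp
qed

text \<open>Walking from \<open>k\<close> towards the mean, the masses stay above half of the first
  one for about \<open>sqrt (M * p) / 4\<close> steps, even if the walk overshoots the mean. As they
  sum to at most 1, the first one is small; no Stirling estimate is involved.\<close>

lemma bin_prob_le_sqrt:
  assumes p: "0 < p" "p \<le> 1 / 2" and k: "k \<le> M" and M: "M > 0"
  shows "bin_prob M p k \<le> 8 / sqrt (real M * p)"
proof -
  interpret bern p using p by unfold_locales auto
  define s where "s = sqrt (real M * p)"
  have s2: "real M * p = s * s" and s0: "s > 0" unfolding s_def using p M by auto
  show ?thesis
  proof (cases "s < 8")
    case True
    then have "1 \<le> 8 / s" using s0 by (simp add: field_simps)
    then show ?thesis using bin_prob_le_1[OF k] unfolding s_def by linarith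
  next
    case False
    define r where "r = nat \<lfloor>s / 4\<rfloor>"
    have r: "real r \<le> s / 4" "s / 4 < real r + 1" "r \<ge> 2"
    proof -
      have "real r = of_int \<lfloor>s / 4\<rfloor>" unfolding r_def using s0 by simp
      then show "real r \<le> s / 4" "s / 4 < real r + 1" by linarith+
      then show "r \<ge> 2" using False by linarith
    qed
    define e where "e = 1 / (2 * real r)"
    have e: "0 < e" "e < 1" "e * real r = 1 / 2" unfolding e_def using r by (auto simp: field_simps)
    have "2 * real r * (2 * real r + 1) \<le> 2 * (s / 4) * (2 * (s / 4) + 1)"
      using r s0 by (intro mult_mono) auto
    also have "\<dots> \<le> s * s" using False s0 by (simp add: field_simps)
    \<comment> \<open>Overshooting the mean by at most \<open>r\<close> steps perturbs the ratio of
      neighbouring masses by order \<open>r / (M * p)\<close>; \<open>r \<le> s / 4\<close> keeps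
      this below \<open>e\<close>.\<close>
    finally have key0: "2 * real r + 1 \<le> e * (real M * p)"
      unfolding s2 e_def using r by (simp add: field_simps)
    have key: "real r * (1 - p) + (real r + 1) * p \<le> e * (real M * p) * (1 - p)"
      "real r * p + (real r + 1) * (1 - p) \<le> e * (real M * p) * (1 - p)"
    proof -
      have "(2 * real r + 1) * (1 - p) \<le> e * (real M * p) * (1 - p)"
        using key0 p by (intro mult_right_mono) auto
      moreover have "(real r + 1) * p \<le> (real r + 1) * (1 - p)" "real r * p \<le> real r * (1 - p)"
        using p by (auto intro!: mult_left_mono)
      ultimately show "real r * (1 - p) + (real r + 1) * p \<le> e * (real M * p) * (1 - p)"
        "real r * p + (real r + 1) * (1 - p) \<le> e * (real M * p) * (1 - p)"
        by (auto simp: algebra_simps)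
    qed
    have "\<exists>K\<subseteq>{..M}. card K = Suc r \<and> (\<forall>l\<in>K. bin_prob M p k / 2 \<le> bin_prob M p l)"
    proof (cases "real M * p \<le> real k")
      case True
      have "8 * s \<le> s * s" using False by (intro mult_right_mono) auto
      then have rk: "real r \<le> real k" using True r s0 s2 by linarith
      have half: "bin_prob M p k / 2 \<le> bin_prob M p (k - j)" if "j \<le> r" for j
      proof -
        have "(1 - e) * bin_prob M p (k - j) \<le> bin_prob M p (k - Suc j)" if j: "j < r" for j
        proof -
        let ?l = "k - Suc j"
        have l: "Suc ?l = k - j" "real ?l = real k - real j - 1" "?l < M"
          using j rk k by auto
        have "(1 - e) * ((real M - real ?l) * p) \<le> real (Suc ?l) * (1 - p)"
        proof -
          have "(1 - e) * ((real M - real ?l) * p) \<le> (1 - e) * ((real M - (real M * p - real r - 1)) * p)"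
            using e p True j l by (intro mult_left_mono mult_right_mono) auto
          also have "\<dots> = (1 - e) * (real M * p * (1 - p)) + (1 - e) * ((real r + 1) * p)"
            by (simp add: algebra_simps)
          also have "\<dots> \<le> (1 - e) * (real M * p * (1 - p)) + 1 * ((real r + 1) * p)"
            using e p by (intro add_left_mono mult_right_mono) auto
          also have "\<dots> \<le> (real M * p - real r) * (1 - p)"
            using key(1) by (simp add: algebra_simps)
          also have "\<dots> \<le> real (Suc ?l) * (1 - p)"
            using p True j l by (intro mult_right_mono) auto
          finally show ?thesis .
        qed
        from mult_left_mono[OF this bin_prob_nonneg[of M "Suc ?l"]]
        have "(1 - e) * bin_prob M p (Suc ?l) * ((real M - real ?l) * p) \<le>
            bin_prob M p (Suc ?l) * (real (Suc ?l) * (1 - p))"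
          by (simp only: mult.assoc mult.left_commute)
        also have "\<dots> = bin_prob M p ?l * ((real M - real ?l) * p)"
          using bin_prob_ratio[of ?l M p] l p by simp
        finally show ?thesis using l p by (simp add: mult_le_cancel_right)
        qed
        then show ?thesis
          using slow_decay_half[of "\<lambda>j. bin_prob M p (k - j)" r e j] bin_prob_nonneg e that by simp
      qed
      have "card ((\<lambda>j. k - j) ` {..r}) = Suc r"
        using rk by (subst card_image) (auto simp: inj_on_def)
      then show ?thesis using k half by (intro exI[of _ "(\<lambda>j. k - j) ` {..r}"]) auto
    next
      case False2: False
      have MpM: "real M * p + real r < real M"
      proof -
        have "8 * s \<le> s * s" using False by (intro mult_right_mono) auto
        then have "real r < s * s" using r s0 by linarith
        moreover have "real M * p \<le> real M * (1 / 2)" using p by (intro mult_left_mono) auto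
        ultimately show ?thesis using s2 by linarith
      qed
      have half: "bin_prob M p k / 2 \<le> bin_prob M p (k + j)" if "j \<le> r" for j
      proof -
        have "(1 - e) * bin_prob M p (k + j) \<le> bin_prob M p (k + Suc j)" if j: "j < r" for j
        proof -
        let ?l = "k + j"
        have l: "real ?l \<le> real M * p + real r" "?l < M"
          using j False2 MpM by auto
        have "(1 - e) * (real (Suc ?l) * (1 - p)) \<le> (real M - real ?l) * p"
        proof -
          have "(1 - e) * (real (Suc ?l) * (1 - p)) \<le> (1 - e) * ((real M * p + real r + 1) * (1 - p))"
            using e p l by (intro mult_left_mono mult_right_mono) auto
          also have "\<dots> = (1 - e) * (real M * p * (1 - p)) + (1 - e) * ((real r + 1) * (1 - p))"
            by (simp add: algebra_simps)
          also have "\<dots> \<le> (1 - e) * (real M * p * (1 - p)) + 1 * ((real r + 1) * (1 - p))"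
            using e p by (intro add_left_mono mult_right_mono) auto
          also have "\<dots> \<le> (real M - (real M * p + real r)) * p"
            using key(2) by (simp add: algebra_simps)
          also have "\<dots> \<le> (real M - real ?l) * p"
            using p l by (intro mult_right_mono) auto
          finally show ?thesis .
        qed
        from mult_left_mono[OF this bin_prob_nonneg[of M ?l]]
        have "(1 - e) * bin_prob M p ?l * (real (Suc ?l) * (1 - p)) \<le>
            bin_prob M p ?l * ((real M - real ?l) * p)" by (simp only: mult.assoc mult.left_commute)
        also have "\<dots> = bin_prob M p (Suc ?l) * (real (Suc ?l) * (1 - p))"
          using bin_prob_ratio[of ?l M p] l p by simp
        finally show ?thesis using l p by (simp add: mult_le_cancel_right)
        qed
        then show ?thesis
          using slow_decay_half[of "\<lambda>j. bin_prob M p (k + j)" r e j] bin_prob_nonneg e that by simp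
      qed
      have "card ((\<lambda>j. k + j) ` {..r}) = Suc r"
        by (subst card_image) (auto simp: inj_on_def)
      moreover have "(\<lambda>j. k + j) ` {..r} \<subseteq> {..M}" using False2 MpM by auto
      ultimately show ?thesis using half by (intro exI[of _ "(\<lambda>j. k + j) ` {..r}"]) auto
    qed
    then obtain K where K: "K \<subseteq> {..M}" "card K = Suc r"
      "\<And>l. l \<in> K \<Longrightarrow> bin_prob M p k / 2 \<le> bin_prob M p l" by blast
    have "real (Suc r) * (bin_prob M p k / 2) = (\<Sum>l\<in>K. bin_prob M p k / 2)" using K by simp
    also have "\<dots> \<le> (\<Sum>l\<in>K. bin_prob M p l)" using K by (intro sum_mono)
    also have "\<dots> \<le> 1" using K by (intro sum_bin_prob_le_1) (auto intro: finite_subset)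
    finally have "real (Suc r) * (bin_prob M p k / 2) \<le> 1" .
    moreover have "(s / 4) * (bin_prob M p k / 2) \<le> real (Suc r) * (bin_prob M p k / 2)"
      using r bin_prob_nonneg by (intro mult_right_mono) auto
    ultimately have "(s / 4) * (bin_prob M p k / 2) \<le> 1" by linarith
    then show ?thesis using s0 unfolding s_def[symmetric] by (simp add: field_simps)
  qed
qed

text \<open>Covers the range where the square root bound is trivial. The mass at 0 is
  \<open>(1 - p) ^ M\<close>, and every other mass is at most \<open>1 - (1 - p) ^ M\<close>, hence
  at most \<open>3 / 4\<close>.\<close>

lemma bin_prob_le_exp:
  assumes p: "0 < p" "p \<le> 1 / 2" and k: "k \<le> M" and M: "real M * p \<le> 1"
  shows "bin_prob M p k \<le> exp (- (real M * p) / 4)"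
proof -
  interpret bern p using p by unfold_locales auto
  have b0: "bin_prob M p 0 = (1 - p) ^ M" unfolding bin_prob_def by simp
  have le: "(1 - p) ^ M \<le> exp (- (real M * p))"
  proof -
    have "(1 - p) ^ M \<le> exp (- p) ^ M" using p exp_ge_add_one_self[of "- p"] by (intro power_mono) auto
    then show ?thesis by (simp add: exp_of_nat_mult[symmetric])
  qed
  show ?thesis
  proof (cases "k = 0")
    case True
    have "0 \<le> real M * p" using p by simp
    then have "exp (- (real M * p)) \<le> exp (- (real M * p) / 4)"
      by (intro iffD2[OF exp_le_cancel_iff]) linarith
    moreover have "bin_prob M p k = (1 - p) ^ M" using True b0 by simp
    ultimately show ?thesis using le by linarith
  next
    case False
    have "bin_prob M p k + bin_prob M p 0 = (\<Sum>l\<in>{0, k}. bin_prob M p l)" using False by simp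
    also have "\<dots> \<le> 1" using k by (intro sum_bin_prob_le_1) auto
    finally have "bin_prob M p k \<le> 1 - (1 - p) ^ M" using b0 by simp
    moreover have "1 / 4 \<le> (1 - p) ^ M"
    proof -
      \<comment> \<open>On \<open>[- ln 2, 0]\<close> the exponential lies below its chord, whose
        value at \<open>- 2 * p * ln 2\<close> is \<open>1 - p\<close>.\<close>
      have "exp (- 2 * p * ln 2) \<le> 1 - p"
      proof -
        have c: "convex_on UNIV (exp :: real \<Rightarrow> real)" by (rule exp_convex)
        have "exp ((1 - 2 * p) *\<^sub>R 0 + (2 * p) *\<^sub>R (- ln 2)) \<le> (1 - 2 * p) * exp 0 + (2 * p) * exp (- ln 2 :: real)"
          using p by (intro convex_onD[OF c]) auto
        then show ?thesis by (simp add: exp_minus algebra_simps)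
      qed
      then have "exp (- 2 * p * ln 2) ^ M \<le> (1 - p) ^ M" by (intro power_mono) auto
      moreover have "exp (- 2 * p * ln 2) ^ M = exp ((- 2 * ln 2) * (real M * p))"
        by (simp add: exp_of_nat_mult[symmetric] algebra_simps)
      moreover have "exp ((- 2 * ln 2) * 1) \<le> exp ((- 2 * ln 2) * (real M * p))"
        using M p by (intro iffD2[OF exp_le_cancel_iff] mult_left_mono_neg) auto
      moreover have "exp ((- 2 * ln 2) * 1) = (1 / 4 :: real)"
        by (simp add: exp_minus exp_double)
      ultimately show ?thesis by linarith
    qed
    moreover have "3 / 4 \<le> exp (- (real M * p) / 4)"
      using M exp_ge_add_one_self[of "- (real M * p) / 4"] by simp
    ultimately show ?thesis by linarith
  qed
qed

lemma (in bern) littlewood_offord: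
  fixes a :: "'i \<Rightarrow> complex"
  assumes "finite T" "0 < p" "p \<le> 1 / 2" and m: "0 < m" "m \<le> real (card {i \<in> T. a i \<noteq> 0})"
  shows "pr p T (\<lambda>F. sum a F = c) \<le> 12 / sqrt (m * p)"
proof -
  let ?n = "card {i \<in> T. a i \<noteq> 0}"
  define M where "M = (?n + 1) div 2"
  have M: "2 * M \<le> Suc ?n" "?n \<le> 2 * M" unfolding M_def by auto
  then have M0: "M > 0" using m by (cases M) auto
  have "pr p T (\<lambda>F. sum a F = c) \<le> 8 / sqrt (real M * p)"
    using assms M M0 bin_prob_le_sqrt by (intro pr_sum_eq_le[of T M]) auto
  also have "\<dots> \<le> 12 / sqrt (m * p)"
  proof -
    have "m * p \<le> 2 * real M * p" using m M assms by (intro mult_right_mono) linarith+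
    \<comment> \<open>\<open>9 / 4\<close> instead of 2 has a rational square root;
      \<open>8 * 3 / 2\<close> is the 12.\<close>
    also have "\<dots> \<le> 9 / 4 * (real M * p)" using assms by simp
    finally have "sqrt (m * p) \<le> sqrt (9 / 4 * (real M * p))" by (rule real_sqrt_le_mono)
    also have "\<dots> = 3 / 2 * sqrt (real M * p)"
    proof -
      have "sqrt (9 / 4) = (3 / 2 :: real)" by (rule real_sqrt_unique) (auto simp: power2_eq_square)
      then show ?thesis by (simp only: real_sqrt_mult)
    qed
    finally show ?thesis using m M0 assms by (simp add: field_simps)
  qed
  finally show ?thesis .
qed

text \<open>For small \<open>card T * p\<close> this is only slightly below 1, which suffices
  because it will be raised to a power of order \<open>n\<close>.\<close>

lemma (in bern) sparse_anticoncentration: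
  fixes a :: "'i \<Rightarrow> complex"
  assumes "finite T" "0 < p" "p \<le> 1 / 2" and a: "\<And>i. i \<in> T \<Longrightarrow> a i \<noteq> 0"
  shows "pr p T (\<lambda>F. sum a F = c) \<le> exp (- min (real (card T) * p) 1 / 8)"
proof -
  have T: "{i \<in> T. a i \<noteq> 0} = T" using a by auto
  define h where "h = (card T + 1) div 2"
  \<comment> \<open>Truncation at \<open>1 / p\<close> enters the range of
    \<open>bin_prob_le_exp\<close>; since \<open>1 / p \<ge> 2\<close>, rounding down costs at most
    a factor 2.\<close>
  define M where "M = min h (nat \<lfloor>1 / p\<rfloor>)"
  have h: "2 * h \<le> Suc (card T)" "card T \<le> 2 * h" unfolding h_def by auto
  have inv: "1 / p \<ge> 2" using assms by (simp add: field_simps)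
  have fl: "real (nat \<lfloor>1 / p\<rfloor>) \<le> 1 / p" "1 / p - 1 \<le> real (nat \<lfloor>1 / p\<rfloor>)"
  proof -
    have "real (nat \<lfloor>1 / p\<rfloor>) = of_int \<lfloor>1 / p\<rfloor>" using assms by simp
    then show "real (nat \<lfloor>1 / p\<rfloor>) \<le> 1 / p" "1 / p - 1 \<le> real (nat \<lfloor>1 / p\<rfloor>)" by linarith+
  qed
  have "real M \<le> 1 / p" unfolding M_def using fl by auto
  then have Mp: "real M * p \<le> 1" using assms by (simp add: field_simps)
  have "pr p T (\<lambda>F. sum a F = c) \<le> exp (- (real M * p) / 4)"
    using assms h Mp T bin_prob_le_exp by (intro pr_sum_eq_le[of T M]) (auto simp: M_def)
  also have "\<dots> \<le> exp (- min (real (card T) * p) 1 / 8)"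
  proof -
    have "min (real (card T) * p) 1 \<le> 2 * (real M * p)"
    proof (cases "h \<le> nat \<lfloor>1 / p\<rfloor>")
      case True
      then have "real (card T) * p \<le> (2 * real M) * p" using h assms
        by (intro mult_right_mono) (auto simp: M_def)
      then show ?thesis by simp
    next
      case False
      then have "1 / p / 2 \<le> real M" using fl inv unfolding M_def by auto
      then show ?thesis using assms by (simp add: field_simps)
    qed
    then show ?thesis by simp
  qed
  finally show ?thesis .
qed

section \<open>Quadratic Littlewood-Offord inequality\<close>

context bern
begin

lemma ex_square_le:
  assumes "finite I"
  shows "(ex p I f)\<^sup>2 \<le> ex p I (\<lambda>F. (f F)\<^sup>2)"
proof -
  define \<mu> where "\<mu> = ex p I f"
  have "0 \<le> ex p I (\<lambda>F. (f F - \<mu>)\<^sup>2)" by (intro ex_nonneg) auto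
  also have "\<dots> = ex p I (\<lambda>F. (f F)\<^sup>2 + ((- 2 * \<mu>) * f F + \<mu>\<^sup>2))"
    by (intro ex_cong) (simp add: power2_eq_square algebra_simps)
  also have "\<dots> = ex p I (\<lambda>F. (f F)\<^sup>2) + ((- 2 * \<mu>) * \<mu> + \<mu>\<^sup>2)"
    unfolding ex_add ex_cmult using assms by (simp add: \<mu>_def)
  finally show ?thesis unfolding \<mu>_def[symmetric] by (simp add: power2_eq_square)
qed

lemma quadratic_form_union:
  fixes a :: "'i \<Rightarrow> 'i \<Rightarrow> complex"
  assumes "finite X" "finite Y" "X \<inter> Y = {}"
    and sym: "\<And>j k. j \<in> X \<Longrightarrow> k \<in> Y \<Longrightarrow> a j k = a k j"
  shows "(\<Sum>j\<in>X \<union> Y. \<Sum>k\<in>X \<union> Y. a j k) =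
    (\<Sum>j\<in>X. \<Sum>k\<in>X. a j k) + (\<Sum>j\<in>Y. \<Sum>k\<in>Y. a j k) + 2 * (\<Sum>k\<in>Y. \<Sum>j\<in>X. a j k)"
proof -
  have "(\<Sum>j\<in>Y. \<Sum>k\<in>X. a j k) = (\<Sum>k\<in>Y. \<Sum>j\<in>X. a j k)"
    using sym by (intro sum.cong) auto
  moreover have "(\<Sum>j\<in>X. \<Sum>k\<in>Y. a j k) = (\<Sum>k\<in>Y. \<Sum>j\<in>X. a j k)" by (rule sum.swap)
  ultimately show ?thesis using assms(1-3)
    by (simp add: sum.union_disjoint sum.distrib)
qed

text \<open>Resampling the coordinates in \<open>V1\<close> and applying Cauchy--Schwarz replaces the quadratic form by
  an expression that is linear in the coordinates from \<open>V2\<close>.\<close>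

lemma quadratic_littlewood_offord:
  fixes a :: "'i \<Rightarrow> 'i \<Rightarrow> complex"
  assumes fin: "finite V1" "finite V2" and disj: "V1 \<inter> V2 = {}" and p: "0 < p" "p \<le> 1 / 2"
    and sym: "\<And>j k. j \<in> V1 \<Longrightarrow> k \<in> V2 \<Longrightarrow> a j k = a k j"
    and m: "0 < m" "\<And>k. k \<in> V2 \<Longrightarrow> m \<le> real (card {j \<in> V1. a j k \<noteq> 0})"
    and V2: "V2 \<noteq> {}"
  shows "pr p (V1 \<union> V2) (\<lambda>F. (\<Sum>j\<in>F. \<Sum>k\<in>F. a j k) = c) \<le>
    sqrt (24 / sqrt (m * p) + 12 / sqrt (real (card V2) / 2 * p))"
proof -
  define q where "q = (\<lambda>F. \<Sum>j\<in>F. \<Sum>k\<in>F. a j k)"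
  \<comment> \<open>For two samples \<open>X\<close>, \<open>X'\<close> and a common
    \<open>Y\<close>, the difference of the two values of the form is affine in \<open>Y\<close>
    with coefficients \<open>2 * h X X' k\<close>.\<close>
  define h where "h = (\<lambda>X X' k. (\<Sum>j\<in>X. a j k) - (\<Sum>j\<in>X'. a j k))"
  define E where "E = (\<lambda>X Y. of_bool (q (X \<union> Y) = c) :: real)"
  define M where "M = real (card V2)"
  define L where "L = 12 / sqrt (M / 2 * p)"
  have M0: "M > 0" unfolding M_def using V2 fin by (simp add: card_gt_0_iff)
  have L0: "L \<ge> 0" unfolding L_def using M0 p by auto
  have qu: "q (X \<union> Y) = q X + q Y + 2 * (\<Sum>k\<in>Y. \<Sum>j\<in>X. a j k)" if "X \<subseteq> V1" "Y \<subseteq> V2" for X Y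
    unfolding q_def using that fin disj
    by (intro quadratic_form_union) (auto intro: finite_subset sym)
  \<comment> \<open>If at least half of the \<open>h X X' k\<close> are nonzero, the linear
    inequality in \<open>Y\<close> gives \<open>L\<close>. Otherwise the first summand is at least
    1, which is Markov's inequality for the number of vanishing coefficients.\<close>
  have inner: "ex p V2 (\<lambda>Y. E X Y * E X' Y) \<le>
      2 / M * (\<Sum>k\<in>V2. of_bool (h X X' k = 0)) + L" if X: "X \<subseteq> V1" and X': "X' \<subseteq> V1" for X X'
  proof (cases "M / 2 \<le> real (card {k \<in> V2. h X X' k \<noteq> 0})")
    case True
    have "ex p V2 (\<lambda>Y. E X Y * E X' Y) \<le> pr p V2 (\<lambda>Y. sum (h X X') Y = (q X' - q X) / 2)"
      unfolding pr_def
    proof (rule ex_mono)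
      fix Y assume Y: "Y \<subseteq> V2"
      have "sum (h X X') Y = (q X' - q X) / 2" if "q (X \<union> Y) = c" "q (X' \<union> Y) = c"
      proof -
        have "sum (h X X') Y = (\<Sum>k\<in>Y. \<Sum>j\<in>X. a j k) - (\<Sum>k\<in>Y. \<Sum>j\<in>X'. a j k)"
          unfolding h_def by (rule sum_subtractf)
        moreover have "q X + q Y + 2 * (\<Sum>k\<in>Y. \<Sum>j\<in>X. a j k) = q X' + q Y + 2 * (\<Sum>k\<in>Y. \<Sum>j\<in>X'. a j k)"
          using that qu[OF X Y] qu[OF X' Y] by simp
        then have "q X + 2 * (\<Sum>k\<in>Y. \<Sum>j\<in>X. a j k) = q X' + 2 * (\<Sum>k\<in>Y. \<Sum>j\<in>X'. a j k)"
          by (simp add: algebra_simps)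
        then have "q X' = q X + 2 * (\<Sum>k\<in>Y. \<Sum>j\<in>X. a j k) - 2 * (\<Sum>k\<in>Y. \<Sum>j\<in>X'. a j k)"
          by (simp add: eq_diff_eq)
        ultimately have "q X' = q X + 2 * sum (h X X') Y" by (simp add: right_diff_distrib)
        then show ?thesis by simp
      qed
      then show "E X Y * E X' Y \<le> of_bool (sum (h X X') Y = (q X' - q X) / 2)"
        unfolding E_def by auto
    qed
    also have "\<dots> \<le> L"
      unfolding L_def using fin p M0 True by (intro littlewood_offord) auto
    finally have "ex p V2 (\<lambda>Y. E X Y * E X' Y) \<le> L" .
    moreover have "0 \<le> 2 / M * (\<Sum>k\<in>V2. of_bool (h X X' k = 0))"
      using M0 by (intro mult_nonneg_nonneg sum_nonneg) auto
    ultimately show ?thesis by linarith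
  next
    case False
    have "card V2 = card {k \<in> V2. h X X' k \<noteq> 0} + card {k \<in> V2. h X X' k = 0}"
    proof -
      have "V2 = {k \<in> V2. h X X' k \<noteq> 0} \<union> {k \<in> V2. h X X' k = 0}" by auto
      then show ?thesis using fin by (subst card_Un_disjoint[symmetric]) auto
    qed
    then have "M / 2 \<le> real (card {k \<in> V2. h X X' k = 0})"
      using False unfolding M_def by simp
    also have "\<dots> = (\<Sum>k\<in>V2. of_bool (h X X' k = 0))"
    proof -
      have "{k \<in> V2. h X X' k = 0} = V2 \<inter> {k. h X X' k = 0}" by auto
      then show ?thesis using fin by (simp add: sum_of_bool_eq)
    qed
    finally have "1 \<le> 2 / M * (\<Sum>k\<in>V2. of_bool (h X X' k = 0))"
      using M0 by (simp add: field_simps)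
    moreover have "ex p V2 (\<lambda>Y. E X Y * E X' Y) \<le> 1"
      using fin by (intro ex_le_const) (auto simp: E_def)
    ultimately show ?thesis using L0 by linarith
  qed
  \<comment> \<open>For fixed \<open>X'\<close>, \<open>h X X' k = 0\<close> prescribes the value of
    a linear form in \<open>X\<close> with column \<open>k\<close> of \<open>a\<close> as
    coefficients.\<close>
  have zero: "ex p V1 (\<lambda>X. ex p V1 (\<lambda>X'. of_bool (h X X' k = 0))) \<le> 12 / sqrt (m * p)" if k: "k \<in> V2" for k
  proof -
    have "ex p V1 (\<lambda>X. ex p V1 (\<lambda>X'. of_bool (h X X' k = 0))) =
        ex p V1 (\<lambda>X'. pr p V1 (\<lambda>X. sum (\<lambda>j. a j k) X = (\<Sum>j\<in>X'. a j k)))"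
      unfolding pr_def h_def by (subst ex_swap) simp
    also have "\<dots> \<le> 12 / sqrt (m * p)"
      using fin p m k by (intro ex_le_const littlewood_offord) auto
    finally show ?thesis .
  qed
  have "(pr p (V1 \<union> V2) (\<lambda>F. q F = c))\<^sup>2 = (ex p V2 (\<lambda>Y. ex p V1 (\<lambda>X. E X Y)))\<^sup>2"
    unfolding pr_def E_def ex_Un[OF fin disj] by (subst ex_swap) simp
  also have "\<dots> \<le> ex p V2 (\<lambda>Y. (ex p V1 (\<lambda>X. E X Y))\<^sup>2)" by (rule ex_square_le[OF fin(2)])
  also have "\<dots> = ex p V2 (\<lambda>Y. ex p V1 (\<lambda>X. ex p V1 (\<lambda>X'. E X Y * E X' Y)))"
  proof (intro ex_cong)
    fix Y
    have "(ex p V1 (\<lambda>X. E X Y))\<^sup>2 = ex p V1 (\<lambda>X'. E X' Y) * ex p V1 (\<lambda>X. E X Y)"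
      by (simp add: power2_eq_square)
    also have "\<dots> = ex p V1 (\<lambda>X. ex p V1 (\<lambda>X'. E X' Y) * E X Y)" by (rule ex_cmult[symmetric])
    also have "\<dots> = ex p V1 (\<lambda>X. ex p V1 (\<lambda>X'. E X Y * E X' Y))"
      by (simp add: ex_cmult mult.commute)
    finally show "(ex p V1 (\<lambda>X. E X Y))\<^sup>2 = ex p V1 (\<lambda>X. ex p V1 (\<lambda>X'. E X Y * E X' Y))" .
  qed
  also have "\<dots> = ex p V1 (\<lambda>X. ex p V2 (\<lambda>Y. ex p V1 (\<lambda>X'. E X Y * E X' Y)))" by (rule ex_swap)
  also have "\<dots> = ex p V1 (\<lambda>X. ex p V1 (\<lambda>X'. ex p V2 (\<lambda>Y. E X Y * E X' Y)))"
    by (intro ex_cong ex_swap)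
  also have "\<dots> \<le> ex p V1 (\<lambda>X. ex p V1 (\<lambda>X'. 2 / M * (\<Sum>k\<in>V2. of_bool (h X X' k = 0)) + L))"
    by (intro ex_mono inner)
  also have "\<dots> = 2 / M * (\<Sum>k\<in>V2. ex p V1 (\<lambda>X. ex p V1 (\<lambda>X'. of_bool (h X X' k = 0)))) + L"
    by (simp only: ex_add ex_cmult ex_sum ex_const[OF fin(1)])
  also have "\<dots> \<le> 2 / M * (\<Sum>k\<in>V2. 12 / sqrt (m * p)) + L"
    using M0 by (intro add_right_mono mult_left_mono sum_mono zero) auto
  also have "\<dots> = 24 / sqrt (m * p) + L" using M0 unfolding M_def by simp
  finally have "(pr p (V1 \<union> V2) (\<lambda>F. q F = c))\<^sup>2 \<le> 24 / sqrt (m * p) + L" .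
  then show ?thesis unfolding q_def L_def M_def by (rule real_le_rsqrt)
qed

end

section \<open>Supports of intermediate size\<close>

text \<open>Ordered as in the index set of the model, so that \<open>q i j\<close> and
  \<open>q j i\<close> read the same coordinate; \<open>edge i i\<close> is a loop.\<close>

definition edge :: "nat \<Rightarrow> nat \<Rightarrow> nat \<times> nat" where
  "edge i j = (min i j, max i j)"

definition edges :: "nat set \<Rightarrow> (nat \<times> nat) set" where
  "edges V = {(i, j). i \<in> V \<and> j \<in> V \<and> i \<le> j}"

definition qmat :: "(nat \<Rightarrow> nat \<Rightarrow> complex) \<Rightarrow> (nat \<times> nat) set \<Rightarrow> nat \<Rightarrow> nat \<Rightarrow> complex" where
  "qmat W F i j = W i j * of_bool (edge i j \<in> F)"

lemma edge_commute: "edge i j = edge j i"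
  unfolding edge_def by (simp add: min.commute max.commute)

lemma edge_eq_iff: "edge i j = edge k l \<longleftrightarrow> (i = k \<and> j = l) \<or> (i = l \<and> j = k)"
  unfolding edge_def by (auto simp: min_def max_def split: if_splits)

lemma edge_in_edges_iff [simp]: "edge i j \<in> edges V \<longleftrightarrow> i \<in> V \<and> j \<in> V"
  unfolding edge_def edges_def by (auto simp: min_def max_def)

lemma inj_edge: "inj_on (edge i) T"
  unfolding inj_on_def by (auto simp: edge_eq_iff)

lemma finite_edges [simp]: "finite V \<Longrightarrow> finite (edges V)"
  by (rule finite_subset[of _ "V \<times> V"]) (auto simp: edges_def)

text \<open>\<open>V\<close> is an arbitrary finite index set because the results are also applied
  after deletion of a vertex.\<close>

locale weights =
  fixes W :: "nat \<Rightarrow> nat \<Rightarrow> complex" and V :: "nat set"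
  assumes finV: "finite V"
    and W_sym: "\<And>i j. i \<in> V \<Longrightarrow> j \<in> V \<Longrightarrow> W i j = W j i"
    and W_nz: "\<And>i j. i \<in> V \<Longrightarrow> j \<in> V \<Longrightarrow> i \<noteq> j \<Longrightarrow> W i j \<noteq> 0"
begin

lemma qmat_sym: "i \<in> V \<Longrightarrow> j \<in> V \<Longrightarrow> qmat W F i j = qmat W F j i"
  unfolding qmat_def using W_sym by (simp add: edge_commute)

sublocale sym_matrix V "qmat W F" for F
  using finV qmat_sym by unfold_locales

end

text \<open>The vectors on \<open>T\<close> annihilated by the rows in \<open>R\<close> are annihilated by all rows outside
  \<open>T \<union> H\<close>, and one of them has full support. The rows in \<open>R\<close> determine such a vector, and
  independently of them all other rows outside \<open>T \<union> H\<close> must be orthogonal to it.\<close>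

definition annihilated :: "nat set \<Rightarrow> (nat \<Rightarrow> nat \<Rightarrow> complex) \<Rightarrow> nat set \<Rightarrow> nat set \<Rightarrow> nat set \<Rightarrow> bool" where
  "annihilated V q T H R \<longleftrightarrow>
     (\<exists>f. (\<forall>j\<in>T. f j \<noteq> 0) \<and> (\<forall>i\<in>R. (\<Sum>j\<in>T. q i j * f j) = 0)) \<and>
     (\<forall>f. (\<forall>i\<in>R. (\<Sum>j\<in>T. q i j * f j) = 0) \<longrightarrow>
        (\<forall>i\<in>V - (T \<union> H \<union> R). (\<Sum>j\<in>T. q i j * f j) = 0))"

text \<open>\<open>R\<close> is a basis of the rows outside \<open>T \<union> H\<close> restricted
  to \<open>T\<close>. Such rows live in dimension \<open>card T\<close>, so \<open>R\<close> is
  small enough for a union bound over it.\<close>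

lemma annihilated_support:
  assumes "finite V"
  shows "\<exists>R\<subseteq>V. card R \<le> card (supp_on V r) \<and>
    annihilated V q (supp_on V r) (supp_on V (app V q r)) R"
proof -
  define T where "T = supp_on V r"
  define H where "H = supp_on V (app V q r)"
  have fT: "finite T" and TV: "T \<subseteq> V" unfolding T_def using assms by (auto simp: supp_on_subset)
  have fin: "finite (V - (T \<union> H))" using assms by auto
  obtain R where R: "col_basis (\<lambda>j i. q i j) T (V - (T \<union> H)) R"
    using col_basis_exists[OF fin, of "\<lambda>j i. q i j" T] by blast
  then have RV: "R \<subseteq> V - (T \<union> H)" and ind: "indep_cols (\<lambda>j i. q i j) T R"
    unfolding col_basis_def by auto
  have fR: "finite R" using RV fin finite_subset by blast
  have appT: "app V q r i = (\<Sum>j\<in>T. q i j * r j)" for i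
    by (rule app_restrict[OF assms TV]) (auto simp: T_def supp_on_def)
  have "\<forall>i\<in>R. (\<Sum>j\<in>T. q i j * r j) = 0"
    using RV appT unfolding H_def supp_on_def by auto
  moreover have "\<forall>j\<in>T. r j \<noteq> 0" unfolding T_def supp_on_def by auto
  moreover have "(\<Sum>j\<in>T. q i j * f j) = 0"
    if f: "\<forall>k\<in>R. (\<Sum>j\<in>T. q k j * f j) = 0" and i: "i \<in> V - (T \<union> H \<union> R)" for f i
  proof -
    have "i \<in> V - (T \<union> H)" using i by auto
    then obtain c where c: "\<forall>j\<in>T. q i j = (\<Sum>k\<in>R. q k j * c k)"
      using R unfolding col_basis_def by blast
    have "(\<Sum>j\<in>T. q i j * f j) = (\<Sum>j\<in>T. (\<Sum>k\<in>R. q k j * c k) * f j)"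
      using c by (intro sum.cong) auto
    also have "\<dots> = (\<Sum>k\<in>R. c k * (\<Sum>j\<in>T. q k j * f j))"
      unfolding sum_distrib_left sum_distrib_right
      by (subst sum.swap) (simp add: algebra_simps)
    also have "\<dots> = 0" using f by simp
    finally show ?thesis .
  qed
  ultimately have "annihilated V q T H R" unfolding annihilated_def by blast
  moreover have "card R \<le> card T" by (rule indep_cols_card_le[OF ind fT fR])
  ultimately show ?thesis using RV unfolding T_def H_def by blast
qed

context bern
begin

text \<open>Reveal everything except the entries in rows \<open>S\<close> and columns
  \<open>T\<close>. This fixes the rows in \<open>R\<close> and hence a suitable \<open>f\<close>;
  the rows in \<open>S\<close> must then be orthogonal to \<open>f\<close> independently. As
  \<open>S\<close> avoids \<open>T\<close>, symmetry identifies no two hidden entries.\<close>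

lemma pr_annihilated_le:
  assumes W: "weights W V" and p: "0 < p" "p \<le> 1 / 2"
    and T: "T \<subseteq> V" and R: "R \<subseteq> V"
  shows "pr p (edges V) (\<lambda>F. annihilated V (qmat W F) T H R) \<le>
    exp (- min (real (card T) * p) 1 / 8) ^ card (V - (T \<union> H \<union> R))"
proof -
  interpret weights W V by (rule W)
  define S where "S = V - (T \<union> H \<union> R)"
  define blk where "blk = (\<lambda>i. edge i ` T)"
  define K where "K = (\<Union>i\<in>S. blk i)"
  let ?b = "exp (- min (real (card T) * p) 1 / 8)"
  have fin: "finite S" "finite T" "finite K" "\<And>i. finite (blk i)"
    unfolding S_def K_def blk_def using finV T by (auto intro: finite_subset)
  have KE: "K \<subseteq> edges V" unfolding K_def blk_def S_def using T by auto
  have "pr p (K \<union> (edges V - K)) (\<lambda>F. annihilated V (qmat W F) T H R) \<le> ?b ^ card S"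
  proof (rule pr_cond_le)
    fix G assume G: "G \<subseteq> edges V - K"
    define Z where "Z = (\<lambda>f. (\<forall>j\<in>T. f j \<noteq> 0) \<and> (\<forall>i\<in>R. (\<Sum>j\<in>T. qmat W G i j * f j) = 0))"
    have row_indep: "qmat W (F \<union> G) i j = qmat W G i j" if "F \<subseteq> K" "i \<in> R" "j \<in> T" for F i j
    proof -
      have "edge i j \<notin> K" unfolding K_def blk_def S_def using that by (auto simp: edge_eq_iff)
      then show ?thesis using that unfolding qmat_def by auto
    qed
    show "pr p K (\<lambda>F. annihilated V (qmat W (F \<union> G)) T H R) \<le> ?b ^ card S"
    proof (cases "\<exists>f. Z f")
      case False
      have "\<not> annihilated V (qmat W (F \<union> G)) T H R" if F: "F \<subseteq> K" for F
      proof
        assume "annihilated V (qmat W (F \<union> G)) T H R"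
        then obtain f where f: "\<forall>j\<in>T. f j \<noteq> 0" "\<forall>i\<in>R. (\<Sum>j\<in>T. qmat W (F \<union> G) i j * f j) = 0"
          unfolding annihilated_def by blast
        have "(\<Sum>j\<in>T. qmat W G i j * f j) = 0" if "i \<in> R" for i
          using bspec[OF f(2) that] by (simp add: row_indep[OF F that] cong: sum.cong)
        then show False using False f(1) unfolding Z_def by blast
      qed
      then have "pr p K (\<lambda>F. annihilated V (qmat W (F \<union> G)) T H R) = 0"
        using fin by (intro pr_eq_0) auto
      then show ?thesis by simp
    next
      case True
      then obtain f where f: "Z f" by blast
      define P where "P = (\<lambda>i F. (\<Sum>j\<in>T. qmat W F i j * f j) = 0)"
      have "pr p K (\<lambda>F. annihilated V (qmat W (F \<union> G)) T H R) \<le>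
          pr p K (\<lambda>F. \<forall>i\<in>S. P i (F \<inter> blk i))"
      proof (intro pr_mono ballI)
        fix F i assume F: "F \<subseteq> K" and A: "annihilated V (qmat W (F \<union> G)) T H R" and i: "i \<in> S"
        have "\<forall>k\<in>R. (\<Sum>j\<in>T. qmat W (F \<union> G) k j * f j) = 0"
          using f unfolding Z_def by (simp add: row_indep[OF F] cong: sum.cong)
        then have "(\<Sum>j\<in>T. qmat W (F \<union> G) i j * f j) = 0"
          using A i unfolding annihilated_def S_def by blast
        moreover have "qmat W (F \<union> G) i j = qmat W (F \<inter> blk i) i j" if "j \<in> T" for j
        proof -
          have "edge i j \<in> K" "edge i j \<in> blk i" using i that unfolding K_def blk_def by auto
          then show ?thesis using G unfolding qmat_def by auto
        qed
        ultimately show "P i (F \<inter> blk i)" unfolding P_def by simp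
      qed
      also have "\<dots> \<le> ?b ^ card S"
        unfolding K_def
      proof (rule pr_blocks_le)
        fix i j assume "i \<in> S" "j \<in> S" "i \<noteq> j"
        then show "blk i \<inter> blk j = {}"
          unfolding blk_def S_def by (auto simp: edge_eq_iff)
      next
        fix i assume i: "i \<in> S"
        have iT: "i \<in> V" "i \<notin> T" using i unfolding S_def by auto
        have "pr p (blk i) (P i) = pr p T (\<lambda>F. P i (edge i ` F))"
          unfolding pr_def blk_def by (rule ex_image[OF fin(2) inj_edge])
        also have "\<dots> = pr p T (\<lambda>F. (\<Sum>j\<in>F. W i j * f j) = 0)"
        proof (rule pr_cong)
          fix F assume F: "F \<subseteq> T"
          have "(\<Sum>j\<in>T. qmat W (edge i ` F) i j * f j) = (\<Sum>j\<in>T. if j \<in> F then W i j * f j else 0)"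
            unfolding qmat_def by (intro sum.cong) (auto simp: edge_eq_iff)
          also have "\<dots> = (\<Sum>j\<in>F. W i j * f j)"
            using F fin(2) by (simp add: sum.If_cases Int_absorb1)
          finally show "P i (edge i ` F) = ((\<Sum>j\<in>F. W i j * f j) = 0)" unfolding P_def by simp
        qed
        also have "\<dots> \<le> ?b"
        proof (rule sparse_anticoncentration)
          fix j assume j: "j \<in> T"
          then have "W i j \<noteq> 0" using iT T by (intro W_nz) auto
          then show "W i j * f j \<noteq> 0" using f j unfolding Z_def by simp
        qed (use fin p in auto)
        finally show "pr p (blk i) (P i) \<le> ?b" .
      qed (use fin in auto)
      finally show ?thesis .
    qed
  qed (use fin finV in auto)
  moreover have "K \<union> (edges V - K) = edges V" using KE by auto
  ultimately show ?thesis unfolding S_def by simp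
qed

end

section \<open>Union bound over supports\<close>

lemma card_small_subsets_le:
  assumes "finite V" "0 < k" "k \<le> card V"
  shows "real (card {A. A \<subseteq> V \<and> card A \<le> k}) \<le> (exp 1 * real (card V) / real k) ^ k"
proof -
  define N where "N = card V"
  \<comment> \<open>Weighting \<open>A\<close> by \<open>x ^ card A\<close> gives the total
    \<open>(1 + x) ^ N\<close>, and \<open>x = k / N\<close> minimizes
    \<open>exp (x * N) / x ^ k\<close>.\<close>
  define x where "x = real k / real N"
  have N: "N > 0" unfolding N_def using assms by linarith
  have x: "0 < x" "x \<le> 1" unfolding x_def N_def using assms N unfolding N_def by auto
  have "real (card {A. A \<subseteq> V \<and> card A \<le> k}) * x ^ k = (\<Sum>A | A \<subseteq> V \<and> card A \<le> k. x ^ k)" by simp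
  also have "\<dots> \<le> (\<Sum>A | A \<subseteq> V \<and> card A \<le> k. x ^ card A)"
    using x by (intro sum_mono power_decreasing) auto
  also have "\<dots> \<le> (\<Sum>A\<in>Pow V. x ^ card A)"
    using assms x by (intro sum_mono2) auto
  also have "\<dots> = (\<Sum>A\<in>Pow V. (\<Prod>_\<in>A. x) * (\<Prod>_\<in>V - A. 1))" by simp
  also have "\<dots> = (\<Prod>_\<in>V. x + 1)" using prod_add[OF assms(1), of "\<lambda>_. x" "\<lambda>_. 1"] by simp
  also have "\<dots> \<le> exp x ^ N"
    unfolding N_def using x exp_ge_add_one_self[of x] by (simp add: power_mono add.commute)
  also have "\<dots> = exp (real k)"
    unfolding x_def using N by (simp add: exp_of_nat_mult[symmetric])
  finally have "real (card {A. A \<subseteq> V \<and> card A \<le> k}) * x ^ k \<le> exp (real k)" .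
  then have "real (card {A. A \<subseteq> V \<and> card A \<le> k}) \<le> exp (real k) / x ^ k"
    using x by (simp add: field_simps)
  also have "exp (real k) = exp 1 ^ k" by (simp add: exp_of_nat_mult[symmetric])
  also have "exp 1 ^ k / x ^ k = (exp 1 * real N / real k) ^ k"
    unfolding x_def by (simp add: power_divide power_mult_distrib)
  finally show ?thesis unfolding N_def .
qed

text \<open>The range where the union bound over triples \<open>(T, H, R)\<close> works: there are
  at most \<open>exp (4 * t * (1 + ln (N / t)))\<close> of them, each of probability at most
  \<open>exp (- N * min (t * p) 1 / 16)\<close>, and 128 leaves a surplus beating
  \<open>N ^ 2\<close>. With \<open>8 * t \<le> N\<close>, half of the rows lie outside
  \<open>T \<union> H \<union> R\<close>.\<close>

definition forbidden_size :: "nat \<Rightarrow> real \<Rightarrow> nat \<Rightarrow> bool" where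
  "forbidden_size N p t \<longleftrightarrow> 1 \<le> t \<and> 8 * t \<le> N \<and>
     128 * (real t * (1 + ln (real N / real t))) \<le> real N * min (real t * p) 1"

text \<open>The factor 2 leaves room for images that are nonzero on up to \<open>t0\<close> basis
  rows and on the fewer than \<open>t0\<close> indices outside a column basis, as occurs for rows of
  the generalized inverse.\<close>

definition no_mid_support :: "nat set \<Rightarrow> real \<Rightarrow> (nat \<Rightarrow> nat \<Rightarrow> complex) \<Rightarrow> bool" where
  "no_mid_support V p q \<longleftrightarrow> (\<forall>r. forbidden_size (card V) p (card (supp_on V r)) \<longrightarrow>
     2 * card (supp_on V r) < card (supp_on V (app V q r)))"

context bern
begin

lemma pr_mid_support_le:
  assumes W: "weights W V" and p: "0 < p" "p \<le> 1 / 2" and V: "V \<noteq> {}"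
  shows "pr p (edges V) (\<lambda>F. \<not> no_mid_support V p (qmat W F)) \<le> 1 / real (card V)"
proof -
  interpret weights W V by (rule W)
  define N where "N = card V"
  have N: "N > 0" unfolding N_def using V finV by (simp add: card_gt_0_iff)
  define small where "small = (\<lambda>k. {A. A \<subseteq> V \<and> card A \<le> k})"
  have fs: "finite (small k)" for k unfolding small_def using finV by auto
  define ts where "ts = {t \<in> {1..N}. forbidden_size N p t}"
  define P where "P = (\<lambda>(T, H, R) F. annihilated V (qmat W F) T H R)"
  define X where "X = (\<lambda>t. {T. T \<subseteq> V \<and> card T = t} \<times> small (2 * t) \<times> small t)"
  have fX: "finite (X t)" for t unfolding X_def using fs finV by auto
  have each: "(\<Sum>x\<in>X t. pr p (edges V) (P x)) \<le> 1 / real N ^ 2" if t: "t \<in> ts" for t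
  proof -
    define \<mu> where "\<mu> = min (real t * p) 1"
    define L where "L = 1 + ln (real N / real t)"
    have t1: "1 \<le> t" "8 * t \<le> N" "128 * (real t * L) \<le> real N * \<mu>"
      using t unfolding ts_def forbidden_size_def \<mu>_def L_def by auto
    have \<mu>: "0 < \<mu>" unfolding \<mu>_def using p t1 by auto
    define B where "B = exp L"
    have B: "B = exp 1 * real N / real t"
      unfolding B_def L_def using N t1 by (simp add: exp_add)
    have "pr p (edges V) (P x) \<le> exp (- \<mu> / 8 * (real N / 2))" if "x \<in> X t" for x
    proof -
      obtain T H R where x: "x = (T, H, R)" by (cases x) auto
      have T: "T \<subseteq> V" "card T = t" and H: "H \<subseteq> V" "card H \<le> 2 * t" and R: "R \<subseteq> V" "card R \<le> t"
        using that unfolding x X_def small_def by auto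
      have "card (T \<union> H \<union> R) \<le> card T + card H + card R"
        by (meson add_mono_thms_linordered_semiring(3) card_Un_le order_trans)
      then have "card (T \<union> H \<union> R) \<le> 4 * t" using T H R by linarith
      moreover have "finite (T \<union> H \<union> R)" using T H R finV by (auto intro: finite_subset)
      then have "N - card (T \<union> H \<union> R) \<le> card (V - (T \<union> H \<union> R))"
        unfolding N_def by (rule diff_card_le_card_Diff)
      ultimately have "N \<le> 2 * card (V - (T \<union> H \<union> R))" using t1(2) by linarith
      then have half: "real N / 2 \<le> real (card (V - (T \<union> H \<union> R)))" by linarith
      have "pr p (edges V) (\<lambda>F. annihilated V (qmat W F) T H R) \<le>
          exp (- \<mu> / 8) ^ card (V - (T \<union> H \<union> R))"
        using pr_annihilated_le[OF W p T(1) R(1), of H] T(2) unfolding \<mu>_def by simp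
      also have "\<dots> = exp (real (card (V - (T \<union> H \<union> R))) * (- \<mu> / 8))"
        by (rule exp_of_nat_mult[symmetric])
      also have "\<dots> \<le> exp (real N / 2 * (- \<mu> / 8))"
        using half \<mu> by (intro iffD2[OF exp_le_cancel_iff] mult_right_mono_neg) auto
      finally show ?thesis unfolding x P_def by (simp add: mult.commute)
    qed
    then have "(\<Sum>x\<in>X t. pr p (edges V) (P x)) \<le> real (card (X t)) * exp (- \<mu> / 8 * (real N / 2))"
      by (rule sum_bounded_above)
    also have "\<dots> \<le> (B ^ t * (B ^ (2 * t) * B ^ t)) * exp (- \<mu> / 8 * (real N / 2))"
    proof (rule mult_right_mono)
      show "real (card (X t)) \<le> B ^ t * (B ^ (2 * t) * B ^ t)"
    proof -
      have s1: "real (card (small t)) \<le> B ^ t"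
        unfolding small_def B N_def using t1 finV unfolding N_def
        by (intro card_small_subsets_le) auto
      have "real (card (small (2 * t))) \<le> (exp 1 * real N / real (2 * t)) ^ (2 * t)"
        unfolding small_def N_def using t1 finV unfolding N_def
        by (intro card_small_subsets_le) auto
      also have "\<dots> \<le> B ^ (2 * t)"
        unfolding B using t1 N by (intro power_mono divide_left_mono) auto
      finally have s2: "real (card (small (2 * t))) \<le> B ^ (2 * t)" .
      have "card {T. T \<subseteq> V \<and> card T = t} \<le> card (small t)"
        using fs by (intro card_mono) (auto simp: small_def)
      then have s3: "real (card {T. T \<subseteq> V \<and> card T = t}) \<le> B ^ t" using s1 by linarith
      have "real (card (X t)) =
        real (card {T. T \<subseteq> V \<and> card T = t}) * (real (card (small (2 * t))) * real (card (small t)))"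
        unfolding X_def by (simp add: card_cartesian_product)
      also have "\<dots> \<le> B ^ t * (B ^ (2 * t) * B ^ t)"
        using s1 s2 s3 by (intro mult_mono) (auto simp: B_def)
      finally show ?thesis .
    qed
    qed simp
    also have "B ^ t * (B ^ (2 * t) * B ^ t) = exp (4 * (real t * L))"
    proof -
      have "B ^ t * (B ^ (2 * t) * B ^ t) = B ^ (4 * t)" by (simp add: power_add[symmetric])
      then show ?thesis unfolding B_def by (simp add: exp_of_nat_mult[symmetric] algebra_simps)
    qed
    also have "exp (4 * (real t * L)) * exp (- \<mu> / 8 * (real N / 2)) = exp (4 * (real t * L) - real N * \<mu> / 16)"
      by (simp add: exp_add[symmetric])
    also have "\<dots> \<le> exp (- 2 * ln (real N))"
    proof -
      \<comment> \<open>Shows \<open>t * L \<ge> ln N\<close> uniformly in \<open>t\<close>, so the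
        surplus in the exponent yields \<open>1 / N ^ 2\<close> for each size and
        \<open>1 / N\<close> in total.\<close>
      have "real t * ln (real t) = (real t - 1) * ln (real t) + ln (real t)" by (simp add: algebra_simps)
      also have "\<dots> \<le> (real t - 1) * ln (real N) + (real t - 1)"
        using t1 N ln_le_minus_one[of "real t"] by (intro add_mono mult_left_mono) auto
      finally have "ln (real N) \<le> real t * L"
        unfolding L_def using N t1 by (simp add: ln_div algebra_simps)
      moreover have "0 \<le> ln (real N)" using N by simp
      ultimately show ?thesis using t1(3) by (intro iffD2[OF exp_le_cancel_iff]) linarith
    qed
    also have "\<dots> = 1 / real N ^ 2"
    proof -
      have "exp (2 * ln (real N)) = real N ^ 2" using N by (simp add: exp_double)
      then show ?thesis by (simp add: exp_minus field_simps)
    qed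
    finally show ?thesis .
  qed
  have "pr p (edges V) (\<lambda>F. \<not> no_mid_support V p (qmat W F)) \<le>
      (\<Sum>y\<in>Sigma ts X. pr p (edges V) (P (snd y)))"
  proof (rule pr_union_bound)
    show "finite (Sigma ts X)" using fX unfolding ts_def by auto
    fix F assume "\<not> no_mid_support V p (qmat W F)"
    then obtain r where r: "forbidden_size N p (card (supp_on V r))"
      "card (supp_on V (app V (qmat W F) r)) \<le> 2 * card (supp_on V r)"
      unfolding no_mid_support_def N_def by (auto simp: not_less)
    obtain R where R: "R \<subseteq> V" "card R \<le> card (supp_on V r)"
      "annihilated V (qmat W F) (supp_on V r) (supp_on V (app V (qmat W F) r)) R"
      using annihilated_support[OF finV, of r "qmat W F"] by blast
    have "card (supp_on V r) \<in> ts"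
      using r(1) unfolding ts_def forbidden_size_def by auto
    then show "\<exists>y\<in>Sigma ts X. P (snd y) F"
      using R r(2)
      by (intro bexI[of _ "(card (supp_on V r), supp_on V r, supp_on V (app V (qmat W F) r), R)"])
        (auto simp: X_def P_def small_def supp_on_subset)
  qed
  also have "\<dots> = (\<Sum>t\<in>ts. \<Sum>x\<in>X t. pr p (edges V) (P x))"
    using fX by (subst sum.Sigma) (auto simp: ts_def split_def)
  also have "\<dots> \<le> (\<Sum>t\<in>ts. 1 / real N ^ 2)" by (intro sum_mono each)
  also have "\<dots> \<le> (\<Sum>t\<in>{1..N}. 1 / real N ^ 2)"
    by (intro sum_mono2) (auto simp: ts_def)
  also have "\<dots> = 1 / real N" using N by (simp add: power2_eq_square)
  finally show ?thesis unfolding N_def .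
qed

end

section \<open>Large kernel vectors\<close>

lemma generic_combination_sum:
  fixes f :: "'j \<Rightarrow> 'i \<Rightarrow> complex"
  assumes "finite V" "finite J"
  shows "\<exists>c. supp_on V (\<lambda>i. \<Sum>j\<in>J. c j * f j i) = (\<Union>j\<in>J. supp_on V (f j))"
  using assms(2)
proof (induction J rule: finite_induct)
  case empty
  then show ?case by (simp add: supp_on_def)
next
  case (insert k J)
  then obtain c where c: "supp_on V (\<lambda>i. \<Sum>j\<in>J. c j * f j i) = (\<Union>j\<in>J. supp_on V (f j))"
    by blast
  obtain d where d: "\<forall>i\<in>V. (\<Sum>j\<in>J. c j * f j i) + d * f k i = 0 \<longleftrightarrow>
      (\<Sum>j\<in>J. c j * f j i) = 0 \<and> f k i = 0"
    using generic_combination[OF assms(1), of "\<lambda>i. \<Sum>j\<in>J. c j * f j i" "f k"] by blast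
  have eq: "(\<Sum>j\<in>insert k J. (c(k := d)) j * f j i) = (\<Sum>j\<in>J. c j * f j i) + d * f k i" for i
  proof -
    have "(\<Sum>j\<in>J. (c(k := d)) j * f j i) = (\<Sum>j\<in>J. c j * f j i)"
      using insert.hyps by (intro sum.cong) auto
    then show ?thesis using insert.hyps by simp
  qed
  have "supp_on V (\<lambda>i. \<Sum>j\<in>insert k J. (c(k := d)) j * f j i) =
      supp_on V (f k) \<union> supp_on V (\<lambda>i. \<Sum>j\<in>J. c j * f j i)"
    unfolding supp_on_def eq using d by auto
  then show ?case using c by (intro exI[of _ "c(k := d)"]) simp
qed

lemma app_q_cong:
  "(\<And>j. j \<in> V \<Longrightarrow> q k j = q' k j) \<Longrightarrow> app V q v k = app V q' v k"
  unfolding app_def by (intro sum.cong) auto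

lemma no_mid_support_cong:
  assumes "\<And>i j. i \<in> V \<Longrightarrow> j \<in> V \<Longrightarrow> q i j = q' i j"
  shows "no_mid_support V p q = no_mid_support V p q'"
proof -
  have "supp_on V (app V q r) = supp_on V (app V q' r)" for r
    unfolding supp_on_def using app_q_cong[of V q _ q' r] assms by auto
  then show ?thesis unfolding no_mid_support_def by simp
qed

section \<open>Generalized inverse on a column basis\<close>

context sym_matrix
begin

context
  fixes R r assumes R: "col_basis q V V R"
    and r0: "\<And>j i. j \<in> R \<Longrightarrow> i \<notin> R \<Longrightarrow> r j i = 0"
    and r1: "\<And>j k. j \<in> R \<Longrightarrow> k \<in> R \<Longrightarrow> app V q (r j) k = (if k = j then 1 else 0)"
begin

private lemma RV: "R \<subseteq> V" and fR: "finite R"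
  using R_sub[OF R] finR[OF R] by auto

lemma app_inverse_combination:
  assumes "finite J" "J \<subseteq> R" "k \<in> R"
  shows "app V q (\<lambda>i. \<Sum>j\<in>J. c j * r j i) k = (if k \<in> J then c k else 0)"
proof -
  have "app V q (\<lambda>i. \<Sum>j\<in>J. c j * r j i) k = (\<Sum>j\<in>J. c j * app V q (r j) k)" by (rule app_sum)
  also have "\<dots> = (\<Sum>j\<in>J. if k = j then c j else 0)"
    using assms r1 by (intro sum.cong) auto
  also have "\<dots> = (if k \<in> J then c k else 0)" using assms by simp
  finally show ?thesis .
qed

text \<open>A combination of at most \<open>t0\<close> rows has its image supported on
  \<open>V - R\<close> and those rows, fewer than \<open>2 * t0\<close> places, so its support size
  avoids the window from \<open>t0\<close> to \<open>d\<close>. With \<open>t0\<close> rows of small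
  support, the union of the supports would stay below \<open>t0\<close>, and the rows would be
  dependent, although their images are independent.\<close>

lemma few_small_inverse_rows:
  fixes t0 d :: nat
  assumes mid: "\<And>u. t0 \<le> card (supp_on V u) \<Longrightarrow> card (supp_on V u) \<le> d \<Longrightarrow>
      2 * card (supp_on V u) < card (supp_on V (app V q u))"
    and S: "card (V - R) < t0" and d: "2 * t0 \<le> d"
  shows "card {j \<in> R. card (supp_on V (r j)) \<le> d} < t0"
proof (rule ccontr)
  define Js where "Js = {j \<in> R. card (supp_on V (r j)) \<le> d}"
  assume "\<not> card {j \<in> R. card (supp_on V (r j)) \<le> d} < t0"
  then have "t0 \<le> card Js" unfolding Js_def by simp
  then obtain J where J: "J \<subseteq> Js" "card J = t0" "finite J" by (rule obtain_subset_with_card_n)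
  have sub: "supp_on V (app V q (\<lambda>i. \<Sum>j\<in>J'. c j * r j i)) \<subseteq> (V - R) \<union> J'"
    if "finite J'" "J' \<subseteq> R" for J' c
    using app_inverse_combination[OF that] unfolding supp_on_def by (auto split: if_splits)
  have small: "card (supp_on V (r j)) < t0" if j: "j \<in> Js" for j
  proof (rule ccontr)
    assume ge: "\<not> card (supp_on V (r j)) < t0"
    have "supp_on V (app V q (r j)) \<subseteq> (V - R) \<union> {j}"
      using sub[of "{j}" "\<lambda>_. 1"] j unfolding Js_def by simp
    then have "card (supp_on V (app V q (r j))) \<le> card (insert j (V - R))"
      using finV by (intro card_mono) auto
    also have "\<dots> \<le> t0" using S finV card_insert_le_m1[of t0 "V - R" j] by linarith
    finally show False using mid[of "r j"] ge j unfolding Js_def by auto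
  qed
  \<comment> \<open>Adding one row enlarges the union by fewer than \<open>t0\<close> elements, so
    from below \<open>t0\<close> it cannot jump past \<open>d \<ge> 2 * t0\<close>; a generic
    combination realizes the union as a single support.\<close>
  have union: "card (\<Union>j\<in>J'. supp_on V (r j)) < t0" if "J' \<subseteq> J" for J'
  proof -
    have "finite J'" using that J finite_subset by blast
    then show ?thesis using that
    proof (induction J' rule: finite_induct)
      case empty
      then show ?case using S by simp
    next
      case (insert k J')
      let ?U = "\<Union>j\<in>insert k J'. supp_on V (r j)"
      have "?U = supp_on V (r k) \<union> (\<Union>j\<in>J'. supp_on V (r j))" by auto
      then have "card ?U \<le> card (supp_on V (r k)) + card (\<Union>j\<in>J'. supp_on V (r j))"
        using card_Un_le by metis
      moreover have "card (supp_on V (r k)) < t0" using small insert J by auto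
      ultimately have Ud: "card ?U \<le> d" using insert d by auto
      show ?case
      proof (rule ccontr)
        assume Ut: "\<not> card ?U < t0"
        have kJ: "finite (insert k J')" "insert k J' \<subseteq> R"
          using insert J unfolding Js_def by auto
        obtain c where c: "supp_on V (\<lambda>i. \<Sum>j\<in>insert k J'. c j * r j i) = ?U"
          using generic_combination_sum[OF finV kJ(1), of r] by blast
        have "card (supp_on V (app V q (\<lambda>i. \<Sum>j\<in>insert k J'. c j * r j i))) \<le> card ((V - R) \<union> insert k J')"
          using sub[OF kJ] finV kJ(1) by (intro card_mono) auto
        also have "\<dots> \<le> card (V - R) + card (insert k J')" by (rule card_Un_le)
        also have "card (insert k J') \<le> t0"
          using insert.prems J by (metis card_mono)
        finally have "card (supp_on V (app V q (\<lambda>i. \<Sum>j\<in>insert k J'. c j * r j i))) \<le> 2 * card ?U"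
          using S Ut by linarith
        then show False using mid[of "\<lambda>i. \<Sum>j\<in>insert k J'. c j * r j i"] c Ut Ud by simp
      qed
    qed
  qed
  let ?U = "\<Union>j\<in>J. supp_on V (r j)"
  have "card ?U < card J" using union[of J] J by simp
  moreover have "finite ?U" using J finV by auto
  ultimately obtain l where l: "\<forall>i\<in>?U. (\<Sum>j\<in>J. r j i * l j) = 0" "\<exists>j\<in>J. l j \<noteq> 0"
    using underdetermined_system[of ?U J "\<lambda>i j. r j i"] J by blast
  have "(\<Sum>j\<in>J. l j * r j i) = 0" if "i \<in> V" for i
  proof (cases "i \<in> ?U")
    case True
    then have "(\<Sum>j\<in>J. r j i * l j) = 0" using l(1) by blast
    then show ?thesis by (simp only: mult.commute)
  next
    case False
    then show ?thesis using that unfolding supp_on_def by (intro sum.neutral) auto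
  qed
  then have z: "app V q (\<lambda>i. \<Sum>j\<in>J. l j * r j i) k = 0" for k
    unfolding app_def by simp
  obtain j where j: "j \<in> J" "l j \<noteq> 0" using l by blast
  have "J \<subseteq> R" using J unfolding Js_def by auto
  then show False using app_inverse_combination[OF J(3), of j l] z[of j] j by auto
qed

text \<open>Pairing \<open>r j\<close> with the image of \<open>r k\<close> gives
  \<open>r j k\<close>, and the pairing is symmetric.\<close>

lemma inverse_row_sym:
  assumes "j \<in> R" "k \<in> R"
  shows "r j k = r k j"
proof -
  have *: "(\<Sum>i\<in>V. r j i * app V q (r k) i) = r j k" if "j \<in> R" "k \<in> R" for j k
  proof -
    have "(\<Sum>i\<in>V. r j i * app V q (r k) i) = (\<Sum>i\<in>R. r j i * app V q (r k) i)"
      using that r0 RV finV by (intro sum.mono_neutral_right) auto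
    also have "\<dots> = (\<Sum>i\<in>R. if i = k then r j i else 0)"
      using that r1 by (intro sum.cong) auto
    also have "\<dots> = r j k" using that fR by simp
    finally show ?thesis .
  qed
  show ?thesis using app_sym[of V q "r j" "r k"] *[OF assms] *[OF assms(2,1)] sym by simp
qed

text \<open>\<open>x\<close> lies in the image and is therefore orthogonal to the kernel, so the
  left side is the same for all solutions \<open>z\<close>; the generalized inverse supplies one
  that is linear in \<open>x\<close>.\<close>

lemma generalized_inverse_form:
  assumes z: "\<And>i. i \<in> V \<Longrightarrow> app V q z i = x i"
  shows "(\<Sum>i\<in>V. x i * z i) = (\<Sum>j\<in>R. \<Sum>i\<in>V. x j * x i * r j i)"
proof -
  define y where "y = (\<lambda>i. \<Sum>j\<in>R. x j * r j i)"
  have "app V q (\<lambda>i. y i + (- 1) * z i) k = 0" if "k \<in> R" for k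
    using app_inverse_combination[OF fR subset_refl that, of x] z[of k] that RV
    unfolding app_add y_def by auto
  then have yz: "app V q y k = x k" if "k \<in> V" for k
  proof -
    have "app V q (\<lambda>i. y i + (- 1) * z i) k = 0"
      by (rule app_vanish_basis[OF R _ that]) (rule \<open>\<And>k. k \<in> R \<Longrightarrow> app V q (\<lambda>i. y i + (- 1) * z i) k = 0\<close>)
    then show ?thesis unfolding app_add using z[OF that] by simp
  qed
  have "(\<Sum>i\<in>V. x i * z i) = (\<Sum>i\<in>V. z i * app V q y i)" using yz by (simp add: mult.commute)
  also have "\<dots> = (\<Sum>i\<in>V. y i * app V q z i)" by (rule app_sym) (rule sym)
  also have "\<dots> = (\<Sum>i\<in>V. \<Sum>j\<in>R. x j * x i * r j i)"
    using z unfolding y_def by (simp add: sum_distrib_left sum_distrib_right algebra_simps)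
  also have "\<dots> = (\<Sum>j\<in>R. \<Sum>i\<in>V. x j * x i * r j i)" by (rule sum.swap)
  finally show ?thesis .
qed

end

end

section \<open>Deletion of a vertex\<close>

context bern
begin

text \<open>The event means that the matrix bordered by the column
  \<open>w i * of_bool (i \<in> F)\<close> with corner \<open>c\<close> has a kernel vector that is
  nonzero at the new vertex. A kernel vector of \<open>q\<close> with support above \<open>d\<close>
  imposes a linear equation on the column. Otherwise the corank is below \<open>t0\<close>, and the
  corner equation is quadratic with many nonzero coefficients.\<close>

lemma pr_bordered_solvable_le:
  fixes t0 d :: nat
  assumes q: "sym_matrix V q" and p: "0 < p" "p \<le> 1 / 2"
    and w: "\<And>i. i \<in> V \<Longrightarrow> w i \<noteq> 0"
    and mid: "\<And>u. t0 \<le> card (supp_on V u) \<Longrightarrow> card (supp_on V u) \<le> d \<Longrightarrow>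
      2 * card (supp_on V u) < card (supp_on V (app V q u))"
    and d: "2 * t0 \<le> d" "2 \<le> d" "2 * d \<le> card V"
  shows "pr p V (\<lambda>F. \<exists>z. (\<forall>i\<in>V. app V q z i = w i * of_bool (i \<in> F)) \<and>
      (\<Sum>i\<in>V. w i * of_bool (i \<in> F) * z i) = c)
    \<le> 12 / sqrt (real d * p) + sqrt (36 / sqrt (real d * p / 8))" (is "pr p V ?E \<le> ?b1 + ?b2")
proof -
  interpret sym_matrix V q by (rule q)
  have b0: "0 \<le> ?b1" "0 \<le> ?b2" using p by auto
  have sumF: "(\<Sum>i\<in>V. f i * of_bool (i \<in> F)) = sum f F" if "F \<subseteq> V" for F and f :: "'a \<Rightarrow> complex"
  proof -
    have "(\<Sum>i\<in>V. f i * of_bool (i \<in> F)) = (\<Sum>i\<in>V. if i \<in> F then f i else 0)"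
      by (intro sum.cong) auto
    then show ?thesis using that finV by (simp add: sum.If_cases Int_absorb1)
  qed
  obtain v where v: "v \<in> kern V q" and vmax: "\<And>u. u \<in> kern V q \<Longrightarrow> supp_on V u \<subseteq> supp_on V v"
    using kern_full_support[OF finV, of q] by blast
  have v0: "app V q v i = 0" if "i \<in> V" for i using v that unfolding kern_def by auto
  show ?thesis
  proof (cases "d < card (supp_on V v)")
    case True
    have "pr p V ?E \<le> pr p V (\<lambda>F. (\<Sum>i\<in>F. w i * v i) = 0)"
    proof (rule pr_mono)
      fix F assume F: "F \<subseteq> V" and "?E F"
      then obtain z where z: "\<And>i. i \<in> V \<Longrightarrow> app V q z i = w i * of_bool (i \<in> F)" by blast
      have "(\<Sum>i\<in>F. w i * v i) = (\<Sum>i\<in>V. v i * app V q z i)"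
        unfolding sumF[OF F, symmetric] using z by (intro sum.cong) auto
      also have "\<dots> = (\<Sum>i\<in>V. z i * app V q v i)" by (rule app_sym) (rule sym)
      also have "\<dots> = 0" using v0 by simp
      finally show "(\<Sum>i\<in>F. w i * v i) = 0" .
    qed
    also have "\<dots> \<le> ?b1"
    proof (rule littlewood_offord)
      have "{i \<in> V. w i * v i \<noteq> 0} = supp_on V v" unfolding supp_on_def using w by auto
      then show "real d \<le> real (card {i \<in> V. w i * v i \<noteq> 0})" using True by simp
    qed (use finV p d in auto)
    finally show ?thesis using b0 by linarith
  next
    case False
    have "supp_on V (app V q v) = {}" using v0 unfolding supp_on_def by auto
    then have vt: "card (supp_on V v) < t0" using mid[of v] False by fastforce
    obtain R where R: "col_basis q V V R" using col_basis_exists[OF finV] by blast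
    have RV: "R \<subseteq> V" and fR: "finite R" using R_sub[OF R] finR[OF R] by auto
    have "\<forall>j. \<exists>s. j \<in> R \<longrightarrow> (\<forall>i. i \<notin> R \<longrightarrow> s i = 0) \<and> (\<forall>k\<in>R. app V q s k = (if k = j then 1 else 0))"
      using inverse_row[OF R] by blast
    then obtain r where r: "\<And>j. j \<in> R \<Longrightarrow>
        (\<forall>i. i \<notin> R \<longrightarrow> r j i = 0) \<and> (\<forall>k\<in>R. app V q (r j) k = (if k = j then 1 else 0))"
      by metis
    then have r0: "\<And>j i. j \<in> R \<Longrightarrow> i \<notin> R \<Longrightarrow> r j i = 0"
      and r1: "\<And>j k. j \<in> R \<Longrightarrow> k \<in> R \<Longrightarrow> app V q (r j) k = (if k = j then 1 else 0)" by auto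
    have "card (V - R) \<le> card (supp_on V v)"
      using corank_le_support[OF R vmax] finV by (intro card_mono) auto
    then have S: "card (V - R) < t0" using vt by linarith
    define Js where "Js = {j \<in> R. card (supp_on V (r j)) \<le> d}"
    have Js: "card Js < t0"
      unfolding Js_def using mid S d(1) by (intro few_small_inverse_rows[OF R r0 r1]) auto
    have cRJ: "d \<le> card (R - Js)"
    proof -
      have "card (V - R) = card V - card R" using RV fR by (simp add: card_Diff_subset)
      moreover have "card (R - Js) = card R - card Js"
        using fR by (intro card_Diff_subset) (auto simp: Js_def)
      ultimately show ?thesis using S Js d by linarith
    qed
    \<comment> \<open>A row with support above \<open>d\<close> keeps at least \<open>d / 2\<close>
      nonzero entries after removal of the \<open>h\<close> indices of \<open>V2\<close>.\<close>
    define h where "h = d div 2"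
    have h: "1 \<le> h" "2 * h \<le> d" "d \<le> 4 * h" "real d / 4 \<le> real h" unfolding h_def using d by auto
    have "h \<le> card (R - Js)" using h cRJ by linarith
    then obtain V2 where V2: "V2 \<subseteq> R - Js" "card V2 = h" "finite V2"
      by (meson obtain_subset_with_card_n)
    define V1 where "V1 = V - V2"
    \<comment> \<open>Rows outside \<open>R\<close> are set to zero; those in \<open>R\<close>
      already vanish outside \<open>R\<close>, so \<open>a\<close> is symmetric.\<close>
    define a where "a = (\<lambda>j k. w j * w k * (if j \<in> R then r j k else 0))"
    have V12: "V = V1 \<union> V2" "V1 \<inter> V2 = {}" "finite V1" unfolding V1_def using V2 RV finV by auto
    have rsym: "(if j \<in> R then r j k else 0) = (if k \<in> R then r k j else 0)" for j k
      using inverse_row_sym[OF R r0 r1] r0 by auto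
    have asym: "a j k = a k j" for j k unfolding a_def using rsym[of j k] by simp
    have "pr p V ?E \<le> pr p (V1 \<union> V2) (\<lambda>F. (\<Sum>j\<in>F. \<Sum>k\<in>F. a j k) = c)"
      unfolding V12(1)[symmetric]
    proof (rule pr_mono)
      fix F assume F: "F \<subseteq> V" and "?E F"
      then obtain z where z: "\<And>i. i \<in> V \<Longrightarrow> app V q z i = w i * of_bool (i \<in> F)"
        and c: "(\<Sum>i\<in>V. w i * of_bool (i \<in> F) * z i) = c" by blast
      have "c = (\<Sum>j\<in>R. \<Sum>k\<in>V. w j * of_bool (j \<in> F) * (w k * of_bool (k \<in> F)) * r j k)"
        using generalized_inverse_form[OF R r0 r1 z] c by simp
      also have "\<dots> = (\<Sum>j\<in>V. \<Sum>k\<in>V. a j k * of_bool (k \<in> F) * of_bool (j \<in> F))"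
        using RV finV by (intro sum.mono_neutral_cong_left) (auto simp: a_def intro!: sum.cong)
      also have "\<dots> = (\<Sum>j\<in>V. (\<Sum>k\<in>V. a j k * of_bool (k \<in> F)) * of_bool (j \<in> F))"
        by (simp add: sum_distrib_right)
      also have "\<dots> = (\<Sum>j\<in>F. \<Sum>k\<in>F. a j k)" by (simp only: sumF[OF F])
      finally show "(\<Sum>j\<in>F. \<Sum>k\<in>F. a j k) = c" by simp
    qed
    also have "\<dots> \<le> sqrt (24 / sqrt (real d / 2 * p) + 12 / sqrt (real (card V2) / 2 * p))"
    proof (rule quadratic_littlewood_offord)
      fix k assume k: "k \<in> V2"
      have kR: "k \<in> R" "k \<in> V" "d < card (supp_on V (r k))" using k V2 RV unfolding Js_def by auto
      have "{j \<in> V1. a j k \<noteq> 0} = supp_on V (r k) - V2"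
        unfolding supp_on_def V1_def asym[of _ k] using kR w by (auto simp: a_def)
      moreover have "card (supp_on V (r k)) - card V2 \<le> card (supp_on V (r k) - V2)"
        using V2 by (intro diff_card_le_card_Diff) auto
      ultimately have "d \<le> 2 * card {j \<in> V1. a j k \<noteq> 0}" using kR V2 h by auto
      then show "real d / 2 \<le> real (card {j \<in> V1. a j k \<noteq> 0})" by linarith
    qed (use V12 V2 p d h asym in auto)
    also have "\<dots> \<le> ?b2"
    proof -
      have "real d * p / 8 \<le> real h / 2 * p" using h(4) p by (simp add: field_simps)
      then have s1: "12 / sqrt (real h / 2 * p) \<le> 12 / sqrt (real d * p / 8)"
        using p d h by (intro divide_left_mono real_sqrt_le_mono) auto
      have "24 / sqrt (real d / 2 * p) \<le> 24 / sqrt (real d * p / 8)"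
        using p d by (intro divide_left_mono real_sqrt_le_mono) auto
      then have "24 / sqrt (real d / 2 * p) + 12 / sqrt (real (card V2) / 2 * p) \<le> 36 / sqrt (real d * p / 8)"
        using s1 V2(2) by simp
      then show ?thesis by (rule real_sqrt_le_mono)
    qed
    finally show ?thesis using b0 by linarith
  qed
qed

text \<open>A kernel vector with at least \<open>D\<close> nonzero entries makes at least
  \<open>D\<close> of the events \<open>E i\<close> occur, so the probabilities of the
  \<open>E i\<close> may be summed and divided by \<open>D\<close>. Each is bounded by revealing the
  minor without \<open>i\<close> before the border.\<close>

lemma pr_large_kernel_le:
  fixes t0 d D :: nat
  assumes W: "weights W V" and p: "0 < p" "p \<le> 1 / 2"
    and forb: "\<And>t. t0 \<le> t \<Longrightarrow> t \<le> d \<Longrightarrow> forbidden_size (card V - 1) p t"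
    and d: "2 * t0 \<le> d" "2 \<le> d" "2 * d < card V" and D: "0 < D"
  shows "pr p (edges V) (\<lambda>F. \<exists>v\<in>kern V (qmat W F). D \<le> card (supp_on V v)) \<le>
    real (card V) / real D *
      (1 / real (card V - 1) + (12 / sqrt (real d * p) + sqrt (36 / sqrt (real d * p / 8))))"
    (is "_ \<le> _ * (_ + ?b)")
proof -
  interpret weights W V by (rule W)
  define E where "E = (\<lambda>i F. \<exists>v\<in>kern V (qmat W F). v i \<noteq> 0)"
  have Ei: "pr p (edges V) (E i) \<le> 1 / real (card V - 1) + ?b" if i: "i \<in> V" for i
  proof -
    define U where "U = V - {i}"
    have cU: "card U = card V - 1" unfolding U_def using i finV by simp
    have fU: "finite U" unfolding U_def using finV by simp
    have WU: "weights W U"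
      using W_sym W_nz finV unfolding U_def by unfold_locales auto
    define K where "K = edge i ` U"
    \<comment> \<open>The loop at \<open>i\<close> is revealed together with the minor; it enters
      only as the corner constant.\<close>
    define J where "J = insert (edge i i) (edges U)"
    have KJ: "edges V = K \<union> J" "K \<inter> J = {}"
    proof -
      show "K \<inter> J = {}" unfolding K_def J_def U_def by (auto simp: edge_eq_iff)
      show "edges V = K \<union> J"
      proof
        have "edges U \<subseteq> edges V" unfolding U_def edges_def by auto
        then show "K \<union> J \<subseteq> edges V" unfolding K_def J_def using i by (auto simp: U_def)
        show "edges V \<subseteq> K \<union> J"
        proof
          fix e assume "e \<in> edges V"
          then obtain a b where "e = (a, b)" "a \<in> V" "b \<in> V" "a \<le> b"
            unfolding edges_def by blast
          then have ab: "e = edge a b" "a \<in> V" "b \<in> V" unfolding edge_def by auto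
          have e: "e = edge b a" unfolding ab(1) by (rule edge_commute)
          consider "a = i" "b = i" | "a = i" "b \<in> U" | "b = i" "a \<in> U" | "a \<in> U" "b \<in> U"
            using ab unfolding U_def by blast
          then show "e \<in> K \<union> J"
          proof cases
            case 1
            then show ?thesis unfolding ab(1) J_def by simp
          next
            case 2
            then show ?thesis unfolding ab(1) K_def by simp
          next
            case 3
            then show ?thesis unfolding e K_def by simp
          next
            case 4
            then show ?thesis unfolding ab(1) J_def by simp
          qed
        qed
      qed
    qed
    have fin: "finite K" "finite J" unfolding K_def J_def using fU by auto
    have reg: "pr p (edges V) (\<lambda>F. E i F \<and> no_mid_support U p (qmat W F)) \<le> ?b"
      unfolding KJ(1)
    proof (rule pr_cond_le[OF fin KJ(2)])
      fix G assume G: "G \<subseteq> J"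
      have same: "qmat W (F \<union> G) k j = qmat W G k j" if "F \<subseteq> K" "k \<in> U" "j \<in> U" for F k j
      proof -
        have "edge k j \<notin> K" using that unfolding K_def U_def by (auto simp: edge_eq_iff)
        then show ?thesis using that unfolding qmat_def by auto
      qed
      have mids: "no_mid_support U p (qmat W (F \<union> G)) = no_mid_support U p (qmat W G)" if "F \<subseteq> K" for F
        using same[OF that] by (intro no_mid_support_cong) auto
      show "pr p K (\<lambda>F. E i (F \<union> G) \<and> no_mid_support U p (qmat W (F \<union> G))) \<le> ?b"
      proof (cases "no_mid_support U p (qmat W G)")
        case False
        then have "pr p K (\<lambda>F. E i (F \<union> G) \<and> no_mid_support U p (qmat W (F \<union> G))) = 0"
          using mids fin by (intro pr_eq_0) auto
        then show ?thesis using p by simp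
      next
        case True
        let ?x = "\<lambda>F k. W i k * of_bool (k \<in> F)"
        let ?S = "\<lambda>F. \<exists>z. (\<forall>k\<in>U. app U (qmat W G) z k = ?x F k) \<and> (\<Sum>k\<in>U. ?x F k * z k) = qmat W G i i"
        have "pr p K (\<lambda>F. E i (F \<union> G) \<and> no_mid_support U p (qmat W (F \<union> G))) \<le>
            pr p K (\<lambda>F. E i (F \<union> G))" by (rule pr_mono) auto
        also have "\<dots> = pr p U (\<lambda>F. E i (edge i ` F \<union> G))"
          unfolding pr_def K_def by (rule ex_image[OF fU inj_edge])
        also have "\<dots> \<le> pr p U ?S"
        proof (rule pr_mono)
          fix F assume F: "F \<subseteq> U" and "E i (edge i ` F \<union> G)"
          then obtain v where v: "\<And>k. k \<in> V \<Longrightarrow> app V (qmat W (edge i ` F \<union> G)) v k = 0"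
            and vi: "v i \<noteq> 0" unfolding E_def kern_def by auto
          let ?q = "qmat W (edge i ` F \<union> G)"
          have FK: "edge i ` F \<subseteq> K" using F unfolding K_def by auto
          have qx: "?q i k = ?x F k" if k: "k \<in> U" for k
          proof -
            have "edge i k \<notin> G" using G k KJ(2) unfolding K_def by auto
            then show ?thesis unfolding qmat_def by (auto simp: edge_eq_iff)
          qed
          have qi: "?q i i = qmat W G i i"
          proof -
            have "edge i i \<notin> edge i ` F" using F unfolding U_def by (auto simp: edge_eq_iff)
            then show ?thesis unfolding qmat_def by auto
          qed
          have split: "app V ?q v k = ?q k i * v i + app U ?q v k" for k
            unfolding app_def U_def using i finV by (simp add: sum.remove)
          \<comment> \<open>The kernel vector is normalized to \<open>- 1\<close> at
            \<open>i\<close>: the rows in \<open>U\<close> make \<open>z\<close> a solution with the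
            border as right-hand side, and row \<open>i\<close> is the corner equation.\<close>
          define z where "z = (\<lambda>k. - v k / v i)"
          have appz: "app U ?q z k = - app U ?q v k / v i" for k
            unfolding app_def z_def by (simp add: sum_negf sum_divide_distrib)
          have qv: "app U ?q z k = ?q k i" if "k \<in> V" for k
          proof -
            have "?q k i * v i + app U ?q v k = 0" using split[of k] v[OF that] by simp
            then have "app U ?q v k = - (?q k i * v i)" by (simp only: add_eq_0_iff)
            then show ?thesis unfolding appz using vi by simp
          qed
          have "app U (qmat W G) z k = ?x F k" if k: "k \<in> U" for k
          proof -
            have kV: "k \<in> V" using k unfolding U_def by auto
            have "app U (qmat W G) z k = app U ?q z k"
              using same[OF FK k] by (intro app_q_cong) simp
            also have "\<dots> = ?q k i" by (rule qv[OF kV])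
            also have "\<dots> = ?x F k" using qmat_sym[OF kV i] qx[OF k] by simp
            finally show ?thesis .
          qed
          moreover have "(\<Sum>k\<in>U. ?x F k * z k) = qmat W G i i"
          proof -
            have "(\<Sum>k\<in>U. ?x F k * z k) = app U ?q z i"
              unfolding app_def by (intro sum.cong) (auto simp: qx)
            also have "\<dots> = ?q i i" by (rule qv[OF i])
            finally show ?thesis using qi by simp
          qed
          ultimately show "?S F" by blast
        qed
        also have "\<dots> \<le> ?b"
        proof (rule pr_bordered_solvable_le)
          show "sym_matrix U (qmat W G)"
            using weights.qmat_sym[OF WU] fU by unfold_locales auto
          show "W i k \<noteq> 0" if "k \<in> U" for k using that i W_nz unfolding U_def by auto
          show "2 * card (supp_on U u) < card (supp_on U (app U (qmat W G) u))"
            if "t0 \<le> card (supp_on U u)" "card (supp_on U u) \<le> d" for u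
            using True forb[OF that] unfolding no_mid_support_def cU by blast
        qed (use p d cU in auto)
        finally show ?thesis .
      qed
    qed
    have irr: "pr p (edges V) (\<lambda>F. \<not> no_mid_support U p (qmat W F)) \<le> 1 / real (card V - 1)"
    proof -
      have "pr p (edges V) (\<lambda>F. \<not> no_mid_support U p (qmat W F)) =
          pr p (edges V) (\<lambda>F. \<not> no_mid_support U p (qmat W (F \<inter> edges U)))"
        by (intro pr_cong arg_cong[of _ _ Not] no_mid_support_cong) (auto simp: qmat_def)
      also have "\<dots> = pr p (edges U) (\<lambda>F. \<not> no_mid_support U p (qmat W F))"
        by (rule pr_marginal[OF finite_edges[OF finV]]) (use KJ(1) in \<open>auto simp: J_def\<close>)
      also have "\<dots> \<le> 1 / real (card U)"
        using d cU by (intro pr_mid_support_le[OF WU p]) auto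
      finally show ?thesis unfolding cU .
    qed
    have "pr p (edges V) (E i) \<le>
        pr p (edges V) (\<lambda>F. \<not> no_mid_support U p (qmat W F)) +
        pr p (edges V) (\<lambda>F. E i F \<and> no_mid_support U p (qmat W F))"
      by (rule pr_disj_le) auto
    also have "\<dots> \<le> 1 / real (card V - 1) + ?b" by (rule add_mono[OF irr reg])
    finally show ?thesis .
  qed
  have "real D * pr p (edges V) (\<lambda>F. \<exists>v\<in>kern V (qmat W F). D \<le> card (supp_on V v)) \<le>
      (\<Sum>i\<in>V. pr p (edges V) (E i))"
    unfolding pr_def ex_cmult[symmetric] ex_sum[symmetric]
  proof (rule ex_mono)
    fix F
    show "real D * of_bool (\<exists>v\<in>kern V (qmat W F). D \<le> card (supp_on V v)) \<le> (\<Sum>i\<in>V. of_bool (E i F))"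
    proof (cases "\<exists>v\<in>kern V (qmat W F). D \<le> card (supp_on V v)")
      case True
      then obtain v where v: "v \<in> kern V (qmat W F)" "D \<le> card (supp_on V v)" by blast
      have "card (supp_on V v) \<le> card (V \<inter> {i. E i F})"
        using v finV by (intro card_mono) (auto simp: supp_on_def E_def)
      then have "real D \<le> real (card (V \<inter> {i. E i F}))" using v(2) by linarith
      also have "\<dots> = (\<Sum>i\<in>V. of_bool (E i F))" using finV by (simp add: sum_of_bool_eq)
      finally show ?thesis using True by simp
    qed (auto intro: sum_nonneg)
  qed
  also have "\<dots> \<le> (\<Sum>i\<in>V. 1 / real (card V - 1) + ?b)" by (intro sum_mono Ei)
  also have "\<dots> = real (card V) * (1 / real (card V - 1) + ?b)" by simp
  finally show ?thesis using D by (simp add: field_simps)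
qed

end

section \<open>Small supports\<close>

text \<open>A certificate is a connected set \<open>M\<close> of vertices, given by a spanning tree with root \<open>r\<close> and
  parent function \<open>f\<close>, with an additional edge from \<open>a\<close> to \<open>b\<close> inside \<open>M\<close>, such that the
  neighbours of \<open>S\<close> lie in \<open>M\<close> and the vertices of \<open>M - S\<close> have two neighbours in \<open>S\<close>.\<close>

definition cert_edges :: "nat set \<Rightarrow> nat \<Rightarrow> (nat \<Rightarrow> nat) \<Rightarrow> nat \<Rightarrow> nat \<Rightarrow> (nat \<times> nat) set" where
  "cert_edges M r f a b = insert (edge a b) ((\<lambda>v. edge v (f v)) ` (M - {r}))"

definition cert_gaps :: "nat set \<Rightarrow> nat set \<Rightarrow> nat set \<Rightarrow> (nat \<times> nat) set" where
  "cert_gaps V M S = (\<lambda>(x, y). edge x y) ` (S \<times> (V - M))"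

definition doubly_covered :: "(nat \<times> nat) set \<Rightarrow> nat set \<Rightarrow> nat \<Rightarrow> bool" where
  "doubly_covered F S y \<longleftrightarrow> (\<exists>x\<in>S. \<exists>x'\<in>S. x \<noteq> x' \<and> edge y x \<in> F \<and> edge y x' \<in> F)"

definition certificate ::
  "nat set \<Rightarrow> (nat \<times> nat) set \<Rightarrow> nat set \<Rightarrow> nat set \<Rightarrow> nat \<Rightarrow> (nat \<Rightarrow> nat) \<Rightarrow> nat \<Rightarrow> nat \<Rightarrow> bool" where
  "certificate V F M S r f a b \<longleftrightarrow> M \<subseteq> V \<and> S \<subseteq> M \<and> S \<noteq> {} \<and> r \<in> M \<and> f \<in> M \<rightarrow>\<^sub>E M \<and> a \<in> M \<and> b \<in> M \<and>
     card (cert_edges M r f a b) = card M \<and> cert_edges M r f a b \<subseteq> F \<and> F \<inter> cert_gaps V M S = {} \<and>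
     (\<forall>y\<in>M - S. doubly_covered F S y)"

section \<open>Cycles forced by dependent rows\<close>

context weights
begin

lemma qmat_nonzero_edge: "qmat W F i j \<noteq> 0 \<Longrightarrow> edge i j \<in> F"
  unfolding qmat_def by (auto split: if_splits)

lemma edge_qmat_nonzero: "edge i j \<in> F \<Longrightarrow> i \<in> V \<Longrightarrow> j \<in> V \<Longrightarrow> i \<noteq> j \<Longrightarrow> qmat W F i j \<noteq> 0"
  unfolding qmat_def using W_nz by auto

lemma second_nonzero:
  fixes g h :: "nat \<Rightarrow> complex"
  assumes "finite T" "(\<Sum>j\<in>T. g j * h j) = 0" "x \<in> T" "g x \<noteq> 0" "h x \<noteq> 0"
  shows "\<exists>x'\<in>T. x' \<noteq> x \<and> g x' \<noteq> 0 \<and> h x' \<noteq> 0"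
proof (rule ccontr)
  assume "\<not> ?thesis"
  then have "(\<Sum>j\<in>T - {x}. g j * h j) = 0" by (intro sum.neutral) auto
  then have "g x * h x = 0" using assms(1-3) by (simp add: sum.remove)
  then show False using assms by simp
qed

text \<open>A vanishing sum cannot have a single nonzero term. So \<open>v\<close> gives each vertex
  adjacent to \<open>T\<close> a second neighbour in \<open>T\<close>, and \<open>l\<close> gives
  each vertex of \<open>T\<close> adjacent to \<open>Y\<close> a second neighbour in
  \<open>Y\<close>. A finite tree does not allow this: a vertex of \<open>Z\<close> farthest from
  the root has only its parent to offer.\<close>

lemma dependent_rows_certificate:
  assumes TV: "T \<subseteq> V"
    and v: "\<And>i. i \<in> V \<Longrightarrow> (\<Sum>j\<in>T. qmat W F i j * v j) = 0" "\<And>j. j \<in> T \<Longrightarrow> v j \<noteq> 0"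
    and N: "N = {y \<in> V. \<exists>x\<in>T. qmat W F y x \<noteq> 0}"
    and dep: "\<not> indep_cols (qmat W F) T N"
  shows "\<exists>M S r f a b. certificate V F M S r f a b \<and> S \<subseteq> T"
proof -
  define q where "q = qmat W F"
  have fT: "finite T" and fN: "finite N" using TV finV finite_subset N by auto
  have qs: "q i j = q j i" if "i \<in> V" "j \<in> V" for i j unfolding q_def using qmat_sym that by auto
  have "\<exists>l. (\<forall>x\<in>T. (\<Sum>y\<in>N. q x y * l y) = 0) \<and> (\<exists>y\<in>N. l y \<noteq> 0)"
    using dep unfolding q_def by (simp only: indep_cols_def Ball_def Bex_def not_all not_imp)
  then obtain l where l: "\<And>x. x \<in> T \<Longrightarrow> (\<Sum>y\<in>N. q x y * l y) = 0" "\<exists>y\<in>N. l y \<noteq> 0" by blast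
  define Y where "Y = {y \<in> N. l y \<noteq> 0}"
  have H1: "\<exists>x'\<in>T. x' \<noteq> x \<and> q y x' \<noteq> 0" if "y \<in> V" "x \<in> T" "q y x \<noteq> 0" for x y
    using second_nonzero[OF fT v(1)[OF that(1)] that(2)] that(3) v(2)[OF that(2)] unfolding q_def by blast
  have H2: "\<exists>y'\<in>Y. y' \<noteq> y \<and> q x y' \<noteq> 0" if "x \<in> T" "y \<in> Y" "q x y \<noteq> 0" for x y
    using second_nonzero[OF fN l(1)[OF that(1)], of y] that unfolding Y_def by auto
  obtain y0 where y0: "y0 \<in> Y" using l(2) unfolding Y_def by auto
  then obtain x0 where x0: "x0 \<in> T" "q y0 x0 \<noteq> 0" "y0 \<in> V" unfolding Y_def N q_def by auto
  have YV: "Y \<subseteq> V" unfolding Y_def N by auto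
  \<comment> \<open>Only edges meeting \<open>T\<close> are followed. The parent of a vertex outside
    \<open>T\<close> therefore lies in \<open>T\<close>, and no edge leaves the component from
    \<open>S\<close>.\<close>
  define H where "H = {(u, w). u \<in> V \<and> w \<in> V \<and> q u w \<noteq> 0 \<and> (u \<in> T \<or> w \<in> T)}"
  define M where "M = {w. (x0, w) \<in> H\<^sup>*}"
  define S where "S = M \<inter> T"
  have x0M: "x0 \<in> M" unfolding M_def by simp
  have step: "w \<in> M" if "u \<in> M" "(u, w) \<in> H" for u w using that unfolding M_def by auto
  have Hsym: "(w, u) \<in> H" if "(u, w) \<in> H" for u w using that qs unfolding H_def by auto
  have MV: "M \<subseteq> V"
  proof
    fix w assume "w \<in> M"
    then have "(x0, w) \<in> H\<^sup>*" unfolding M_def by simp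
    then show "w \<in> V" using x0 TV by (cases rule: rtranclE) (auto simp: H_def)
  qed
  \<comment> \<open>Breadth-first distance; a parent is exactly one step closer to the root, which
    makes the parent edges distinct.\<close>
  define dst where "dst = (\<lambda>w. LEAST n. (x0, w) \<in> H ^^ n)"
  have dst: "(x0, w) \<in> H ^^ dst w" if "w \<in> M" for w
  proof -
    have "\<exists>n. (x0, w) \<in> H ^^ n" using that unfolding M_def by (simp add: rtrancl_is_UN_relpow)
    then show ?thesis unfolding dst_def by (rule LeastI_ex)
  qed
  have dst_le: "dst w \<le> n" if "(x0, w) \<in> H ^^ n" for w n unfolding dst_def using that by (rule Least_le)
  have parent: "\<exists>u. u \<in> M \<and> (u, w) \<in> H \<and> dst w = Suc (dst u)" if w: "w \<in> M" "w \<noteq> x0" for w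
  proof (cases "dst w")
    case 0
    then show ?thesis using dst[OF w(1)] w(2) by simp
  next
    case (Suc m)
    then obtain u where u: "(x0, u) \<in> H ^^ m" "(u, w) \<in> H" using dst[OF w(1)] by auto
    have uM: "u \<in> M" using relpow_imp_rtrancl[OF u(1)] unfolding M_def by simp
    have "(x0, w) \<in> H ^^ Suc (dst u)" using dst[OF uM] u(2) by auto
    then have "dst w \<le> Suc (dst u)" by (rule dst_le)
    moreover have "dst u \<le> m" using u(1) by (rule dst_le)
    ultimately show ?thesis using Suc uM u(2) by (intro exI[of _ u]) auto
  qed
  define par where "par = (\<lambda>w. SOME u. u \<in> M \<and> (u, w) \<in> H \<and> dst w = Suc (dst u))"
  have par: "par w \<in> M \<and> (par w, w) \<in> H \<and> dst w = Suc (dst (par w))" if "w \<in> M" "w \<noteq> x0" for w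
    unfolding par_def by (rule someI_ex) (rule parent[OF that])
  define f where "f = (\<lambda>w\<in>M. if w = x0 then x0 else par w)"
  have f: "f w \<in> M" "(f w, w) \<in> H" "dst w = Suc (dst (f w))" if "w \<in> M - {x0}" for w
    using par[of w] that unfolding f_def by auto
  have fE: "f \<in> M \<rightarrow>\<^sub>E M" unfolding f_def using par x0M by auto
  define TE where "TE = (\<lambda>w. edge w (f w)) ` (M - {x0})"
  have fM: "finite M" using MV finV finite_subset by blast
  have cTE: "card TE = card M - 1"
  proof -
    have "inj_on (\<lambda>w. edge w (f w)) (M - {x0})"
    proof (rule inj_onI)
      fix u w assume u: "u \<in> M - {x0}" and w: "w \<in> M - {x0}" and e: "edge u (f u) = edge w (f w)"
      then have "u = w \<or> (u = f w \<and> f u = w)" by (auto simp: edge_eq_iff)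
      moreover have "\<not> (u = f w \<and> f u = w)" using f(3)[OF u] f(3)[OF w] by auto
      ultimately show "u = w" by blast
    qed
    then show ?thesis unfolding TE_def using x0M fM by (simp add: card_image)
  qed
  define Z where "Z = {z \<in> M. z \<in> Y \<or> (z \<in> T \<and> (\<exists>y\<in>Y. q z y \<noteq> 0))}"
  have "(x0, y0) \<in> H" using x0 TV qs unfolding H_def by auto
  then have "y0 \<in> Z" using y0 step[OF x0M] unfolding Z_def by auto
  moreover have "finite Z" unfolding Z_def using fM by auto
  ultimately obtain z where z: "z \<in> Z" and zmax: "\<And>u. u \<in> Z \<Longrightarrow> dst u \<le> dst z"
    using finite_has_maximal[of "dst ` Z"] by (metis (no_types, lifting) empty_iff finite_imageI image_iff linear)
  have "\<exists>u u'. u \<noteq> u' \<and> u \<in> Z \<and> u' \<in> Z \<and> (z, u) \<in> H \<and> (z, u') \<in> H"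
  proof (cases "z \<in> Y")
    case True
    then obtain x where x: "x \<in> T" "q z x \<noteq> 0" "z \<in> V" unfolding Y_def N q_def by auto
    then obtain x' where x': "x' \<in> T" "x' \<noteq> x" "q z x' \<noteq> 0" using H1 by blast
    have H: "(z, x) \<in> H" "(z, x') \<in> H" using x x' TV unfolding H_def by auto
    have "z \<in> M" using z unfolding Z_def by auto
    then have "x \<in> M" "x' \<in> M" using step H by auto
    moreover have "q x z \<noteq> 0" "q x' z \<noteq> 0" using x x' qs TV by (metis subsetD)+
    ultimately have "x \<in> Z" "x' \<in> Z" using True x x' unfolding Z_def by auto
    then show ?thesis using H x'(2) by blast
  next
    case False
    then obtain y where y: "z \<in> T" "z \<in> M" "y \<in> Y" "q z y \<noteq> 0" using z unfolding Z_def by auto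
    then obtain y' where y': "y' \<in> Y" "y' \<noteq> y" "q z y' \<noteq> 0" using H2 by blast
    have H: "(z, y) \<in> H" "(z, y') \<in> H" using y y' TV YV unfolding H_def by auto
    then have "y \<in> Z" "y' \<in> Z" using step y y' unfolding Z_def by auto
    then show ?thesis using H y'(2) by blast
  qed
  then obtain u u' where u: "u \<noteq> u'" "u \<in> Z" "u' \<in> Z" "(z, u) \<in> H" "(z, u') \<in> H" by blast
  \<comment> \<open>A tree edge from \<open>z\<close> into \<open>Z\<close> cannot lead to a child,
    which would be farther away than \<open>z\<close>. Of the two edges to \<open>u\<close> and
    \<open>u'\<close>, at least one thus closes a cycle.\<close>
  have tree: "w = f z" if zw: "edge z w \<in> TE" "w \<in> Z" for w
  proof -
    obtain k where k: "k \<in> M - {x0}" "edge z w = edge k (f k)" using zw(1) unfolding TE_def by blast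
    then have "(z = k \<and> w = f k) \<or> (z = f k \<and> w = k)" by (simp add: edge_eq_iff)
    moreover have "\<not> (z = f k \<and> w = k)" using f(3)[OF k(1)] zmax[OF zw(2)] by auto
    ultimately show ?thesis by auto
  qed
  have "edge z u \<notin> TE \<or> edge z u' \<notin> TE" using tree u by blast
  then obtain b where b: "edge z b \<notin> TE" "b \<in> Z" "(z, b) \<in> H" using u by blast
  have zM: "z \<in> M" and bM: "b \<in> M" using z b unfolding Z_def by auto
  have SV: "S \<subseteq> M" unfolding S_def by auto
  have HF: "edge i j \<in> F" if "(i, j) \<in> H" for i j
    using that qmat_nonzero_edge unfolding H_def q_def by auto
  have "certificate V F M S x0 f z b"
    unfolding certificate_def
  proof (intro conjI ballI)
    show "S \<noteq> {}" unfolding S_def using x0M x0 by auto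
    have "cert_edges M x0 f z b = insert (edge z b) TE" unfolding cert_edges_def TE_def ..
    moreover have "finite TE" unfolding TE_def using fM by auto
    ultimately show "card (cert_edges M x0 f z b) = card M"
      using b(1) cTE x0M fM by (simp add: card_gt_0_iff) (metis Suc_pred card_gt_0_iff empty_iff)
    show "cert_edges M x0 f z b \<subseteq> F"
    proof -
      have "edge w (f w) \<in> F" if w: "w \<in> M - {x0}" for w using HF[OF Hsym[OF f(2)[OF w]]] .
      then show ?thesis unfolding cert_edges_def using HF[OF b(3)] by blast
    qed
    show "F \<inter> cert_gaps V M S = {}"
    proof (rule ccontr)
      assume "F \<inter> cert_gaps V M S \<noteq> {}"
      then obtain x y where xy: "edge x y \<in> F" "x \<in> S" "y \<in> V" "y \<notin> M"
        unfolding cert_gaps_def by auto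
      have "q x y \<noteq> 0" unfolding q_def using xy MV SV by (intro edge_qmat_nonzero) auto
      then have "(x, y) \<in> H" using xy MV unfolding H_def S_def by auto
      then show False using step[of x y] xy SV by auto
    qed
    fix y assume y: "y \<in> M - S"
    then have yT: "y \<notin> T" "y \<in> M - {x0}" using x0 unfolding S_def by auto
    have "f y \<in> T" "q y (f y) \<noteq> 0" "y \<in> V"
      using Hsym[OF f(2)[OF yT(2)]] yT(1) unfolding H_def by auto
    then obtain x' where x': "x' \<in> T" "x' \<noteq> f y" "q y x' \<noteq> 0" using H1 by blast
    have H': "(y, x') \<in> H" "(y, f y) \<in> H"
      using x' \<open>y \<in> V\<close> TV Hsym[OF f(2)[OF yT(2)]] unfolding H_def by auto
    have "x' \<in> M" using step[OF _ H'(1)] yT by auto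
    then show "doubly_covered F S y"
      unfolding doubly_covered_def S_def
      using x' HF[OF H'(1)] HF[OF H'(2)] f(1)[OF yT(2)] \<open>f y \<in> T\<close> by blast
  qed (use MV SV x0M fE zM bM in auto)
  then show ?thesis unfolding S_def by blast
qed

end

section \<open>First moment bounds for certificates\<close>

context bern
begin

lemma pr_doubly_covered_le:
  assumes "finite S" "y \<notin> S"
  shows "pr p (edge y ` S) (\<lambda>F. doubly_covered F S y) \<le> (real (card S) * p)\<^sup>2"
proof -
  define X where "X = {e \<in> S \<times> S. fst e \<noteq> snd e}"
  have "pr p (edge y ` S) (\<lambda>F. doubly_covered F S y) \<le>
      (\<Sum>e\<in>X. pr p (edge y ` S) (\<lambda>F. {edge y (fst e), edge y (snd e)} \<subseteq> F \<and> F \<inter> {} = {}))"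
    using assms by (intro pr_union_bound) (auto simp: X_def doubly_covered_def)
  also have "\<dots> = (\<Sum>e\<in>X. p ^ 2)"
  proof (intro sum.cong refl)
    fix e assume "e \<in> X"
    then have e: "fst e \<in> S" "snd e \<in> S" "fst e \<noteq> snd e" unfolding X_def by auto
    have "card {edge y (fst e), edge y (snd e)} = 2"
      using e by (auto simp: edge_eq_iff)
    then show "pr p (edge y ` S) (\<lambda>F. {edge y (fst e), edge y (snd e)} \<subseteq> F \<and> F \<inter> {} = {}) = p ^ 2"
      using e assms by (subst pr_present_absent) auto
  qed
  also have "\<dots> = real (card X) * p ^ 2" by simp
  also have "\<dots> \<le> real (card (S \<times> S)) * p ^ 2"
  proof -
    have "card X \<le> card (S \<times> S)" using assms by (intro card_mono) (auto simp: X_def)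
    then show ?thesis by (intro mult_right_mono) auto
  qed
  also have "\<dots> = (real (card S) * p)\<^sup>2" by (simp add: card_cartesian_product power2_eq_square)
  finally show ?thesis .
qed

lemma pr_all_doubly_covered_le:
  assumes V: "finite V" "S \<subseteq> V" "U \<subseteq> V - S"
  shows "pr p (edges V) (\<lambda>F. \<forall>y\<in>U. doubly_covered F S y) \<le> ((real (card S) * p)\<^sup>2) ^ card U"
proof -
  define B where "B = (\<Union>y\<in>U. edge y ` S)"
  have fin: "finite S" "finite U" using V by (auto intro: finite_subset)
  have BE: "B \<subseteq> edges V" unfolding B_def using V by auto
  have "doubly_covered F S y = doubly_covered (F \<inter> edge y ` S) S y" for F y
    unfolding doubly_covered_def by auto
  moreover have "F \<inter> B \<inter> edge y ` S = F \<inter> edge y ` S" if "y \<in> U" for F y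
    using that unfolding B_def by auto
  ultimately have "pr p (edges V) (\<lambda>F. \<forall>y\<in>U. doubly_covered F S y) =
      pr p (edges V) (\<lambda>F. \<forall>y\<in>U. doubly_covered (F \<inter> B \<inter> edge y ` S) S y)"
    by (intro pr_cong ball_cong) auto
  also have "\<dots> = pr p B (\<lambda>F. \<forall>y\<in>U. doubly_covered (F \<inter> edge y ` S) S y)"
    by (rule pr_marginal[OF finite_edges[OF V(1)] BE])
  also have "\<dots> \<le> ((real (card S) * p)\<^sup>2) ^ card U"
    unfolding B_def
  proof (rule pr_blocks_le)
    fix y assume "y \<in> U"
    then show "pr p (edge y ` S) (\<lambda>F. doubly_covered F S y) \<le> (real (card S) * p)\<^sup>2"
      using V fin by (intro pr_doubly_covered_le) auto
  next
    fix y z assume "y \<in> U" "z \<in> U" "y \<noteq> z"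
    then show "edge y ` S \<inter> edge z ` S = {}" using V by (auto simp: edge_eq_iff)
  qed (use fin in auto)
  finally show ?thesis .
qed

text \<open>A cyclic component needs as many edges as vertices, so \<open>p ^ card M\<close> meets
  the order \<open>n ^ card M\<close> of the count of certificates and no spare factor
  \<open>n\<close> remains. The forbidden edges leave \<open>M\<close> and are disjoint from the
  required ones.\<close>

lemma pr_tree_and_gaps_le:
  assumes V: "finite V" "M \<subseteq> V" "S \<subseteq> M" and c: "r \<in> M" "f \<in> M \<rightarrow>\<^sub>E M" "a \<in> M" "b \<in> M"
    "card (cert_edges M r f a b) = card M"
  shows "pr p (edges V) (\<lambda>F. cert_edges M r f a b \<subseteq> F \<and> F \<inter> cert_gaps V M S = {}) \<le>
    p ^ card M * exp (- p * (real (card S) * (real (card V) - real (card M))))"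
proof -
  have fin: "finite M" "finite S" using V by (auto intro: finite_subset)
  have fM: "f v \<in> M" if "v \<in> M" for v using c that by auto
  have sub: "cert_edges M r f a b \<subseteq> edges M" unfolding cert_edges_def using c fM by auto
  have ME: "edges M \<subseteq> edges V" using V unfolding edges_def by auto
  have gap: "cert_gaps V M S \<subseteq> edges V" unfolding cert_gaps_def using V by auto
  have dis: "edges M \<inter> cert_gaps V M S = {}" unfolding cert_gaps_def by auto
  have "inj_on (\<lambda>(x, y). edge x y) (S \<times> (V - M))"
    using V unfolding inj_on_def by (auto simp: edge_eq_iff)
  then have "card (cert_gaps V M S) = card S * card (V - M)"
    unfolding cert_gaps_def by (simp add: card_image card_cartesian_product)
  also have "card (V - M) = card V - card M" using V fin by (simp add: card_Diff_subset)
  finally have cg: "real (card (cert_gaps V M S)) = real (card S) * (real (card V) - real (card M))"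
    using V by (simp add: of_nat_diff card_mono)
  have "pr p (edges V) (\<lambda>F. cert_edges M r f a b \<subseteq> F \<and> F \<inter> cert_gaps V M S = {}) =
      p ^ card (cert_edges M r f a b) * (1 - p) ^ card (cert_gaps V M S)"
    using sub ME gap dis V(1) by (intro pr_present_absent) auto
  also have "\<dots> \<le> p ^ card M * exp (- p) ^ card (cert_gaps V M S)"
    unfolding c(5) using p0 p1 exp_ge_add_one_self[of "- p"]
    by (intro mult_left_mono power_mono) auto
  also have "exp (- p) ^ card (cert_gaps V M S) = exp (real (card (cert_gaps V M S)) * - p)"
    by (rule exp_of_nat_mult[symmetric])
  finally show ?thesis unfolding cg by (simp add: algebra_simps)
qed

end

text \<open>\<open>m ^ m / fact m\<close> is one term of the exponential series at
  \<open>m\<close>.\<close>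

lemma power_self_le_exp_fact: "real m ^ m \<le> exp (real m) * fact m"
proof -
  have "real m ^ m / fact m \<le> (\<Sum>k. real m ^ k /\<^sub>R fact k)"
    using sum_le_suminf[OF summable_exp_generic[of "real m"], of "{m}"] by (simp add: divide_inverse mult.commute)
  also have "\<dots> = exp (real m)" by (simp add: exp_def)
  finally show ?thesis by (simp add: field_simps)
qed

text \<open>The \<open>m ^ m\<close> parent functions cancel against the factorial in the binomial
  coefficient and leave \<open>(exp 1 * n) ^ m\<close>; the subset and the three marked vertices
  cost at most \<open>2 ^ m\<close> each.\<close>

lemma card_certificates_le:
  assumes V: "finite V" and m: "m \<ge> 1"
  shows "real (card (SIGMA M:{M. M \<subseteq> V \<and> card M = m}. Pow M \<times> M \<times> (M \<rightarrow>\<^sub>E M) \<times> M \<times> M))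
    \<le> (16 * exp 1 * real (card V)) ^ m"
proof -
  define n where "n = card V"
  let ?Ms = "{M. M \<subseteq> V \<and> card M = m}"
  have c: "card (Pow M \<times> M \<times> (M \<rightarrow>\<^sub>E M) \<times> M \<times> M) = 2 ^ m * (m * (m ^ m * (m * m)))" if "M \<in> ?Ms" for M
  proof -
    have "finite M" using that V finite_subset by auto
    then show ?thesis using that by (simp add: card_cartesian_product card_Pow card_funcsetE)
  qed
  have fMs: "finite ?Ms" using V by auto
  have fM: "finite (Pow M \<times> M \<times> (M \<rightarrow>\<^sub>E M) \<times> M \<times> M)" if "M \<in> ?Ms" for M
  proof -
    have "finite M" using that V finite_subset by auto
    then show ?thesis by (intro finite_cartesian_product finite_PiE) auto
  qed
  have "card (SIGMA M:?Ms. Pow M \<times> M \<times> (M \<rightarrow>\<^sub>E M) \<times> M \<times> M) = (\<Sum>M\<in>?Ms. 2 ^ m * (m * (m ^ m * (m * m))))"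
    using c fM fMs by (subst card_SigmaI) auto
  also have "\<dots> = (n choose m) * (2 ^ m * (m * (m ^ m * (m * m))))"
    unfolding n_def using V by (simp add: n_subsets)
  finally have "real (card (SIGMA M:?Ms. Pow M \<times> M \<times> (M \<rightarrow>\<^sub>E M) \<times> M \<times> M)) =
      real (n choose m) * real m ^ m * (2 ^ m * (real m * (real m * real m)))"
    by (simp add: algebra_simps)
  also have "\<dots> \<le> (exp 1 * real n) ^ m * (2 ^ m * (2 ^ m * (2 ^ m * 2 ^ m)))"
  proof (intro mult_mono)
    have "real (n choose m) * fact m \<le> real n ^ m"
      using binomial_fact_pow[of n m] by (metis of_nat_fact of_nat_le_iff of_nat_mult of_nat_power)
    then have "real (n choose m) * (fact m * exp (real m)) \<le> real n ^ m * exp (real m)"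
      using mult_right_mono[of _ _ "exp (real m)"] by (simp add: mult.assoc)
    moreover have "real (n choose m) * real m ^ m \<le> real (n choose m) * (fact m * exp (real m))"
      using power_self_le_exp_fact[of m] by (intro mult_left_mono) (auto simp: mult.commute)
    moreover have "real n ^ m * exp (real m) = (exp 1 * real n) ^ m"
      by (simp add: power_mult_distrib exp_of_nat_mult[symmetric])
    ultimately show "real (n choose m) * real m ^ m \<le> (exp 1 * real n) ^ m" by linarith
    show "real m \<le> 2 ^ m" "real m \<le> 2 ^ m" "real m \<le> 2 ^ m"
      using of_nat_less_two_power[of m, where ?'a = real] by auto
  qed auto
  also have "\<dots> = (16 * exp 1 * real n) ^ m"
  proof -
    have "(2::real) ^ m * (2 ^ m * (2 ^ m * 2 ^ m)) = 16 ^ m"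
      by (simp flip: power_mult_distrib)
    then show ?thesis by (simp add: power_mult_distrib)
  qed
  finally show ?thesis unfolding n_def .
qed

lemma geometric_sum_le:
  fixes x :: real
  assumes "0 \<le> x" "x \<le> 1 / 2"
  shows "(\<Sum>t = 1..k. x ^ t) \<le> 2 * x"
proof -
  have "(\<Sum>t = 1..k. x ^ t) + 2 * x ^ Suc k \<le> 2 * x"
  proof (induction k)
    case (Suc k)
    have "x ^ Suc k * (2 * x) \<le> x ^ Suc k * 1" using assms by (intro mult_left_mono) auto
    moreover have "x ^ Suc k * (2 * x) = 2 * x ^ Suc (Suc k)" by simp
    moreover have "(\<Sum>t = 1..Suc k. x ^ t) = (\<Sum>t = 1..k. x ^ t) + x ^ Suc k" by simp
    ultimately show ?case using Suc by linarith
  qed simp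
  moreover have "0 \<le> 2 * x ^ Suc k" using assms by simp
  ultimately show ?thesis by linarith
qed

context bern
begin

text \<open>Disposes of certificates with \<open>card M\<close> much larger than
  \<open>card S\<close>. Choosing \<open>S\<close> and \<open>U\<close> costs
  \<open>n ^ t * (exp 1 * n / t) ^ (K * t)\<close>, and each vertex of \<open>U\<close> gains
  \<open>(t * p) ^ 2\<close>; replacing \<open>t\<close> by \<open>t0\<close> in the base leaves a
  geometric series.\<close>

lemma pr_many_doubly_covered_le:
  fixes K t0 :: nat
  assumes V: "finite V" "V \<noteq> {}" and K: "1 \<le> K" and t0: "(K + 1) * t0 \<le> card V"
    and th: "real (card V) * (exp 1 * (real (card V) * p)\<^sup>2 * real t0 / real (card V)) ^ K \<le> 1 / 2"
  shows "pr p (edges V) (\<lambda>F. \<exists>S U. S \<subseteq> V \<and> S \<noteq> {} \<and> card S \<le> t0 \<and> U \<subseteq> V - S \<and> card U = K * card S \<and>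
      (\<forall>y\<in>U. doubly_covered F S y)) \<le>
    2 * (real (card V) * (exp 1 * (real (card V) * p)\<^sup>2 * real t0 / real (card V)) ^ K)"
    (is "pr _ _ ?E \<le> 2 * ?th")
proof -
  define n where "n = card V"
  have n: "n > 0" unfolding n_def using V by (simp add: card_gt_0_iff)
  define X where "X = (\<lambda>t. {S. S \<subseteq> V \<and> card S = t} \<times> {U. U \<subseteq> V \<and> card U = K * t})"
  have fX: "finite (X t)" for t unfolding X_def using V by auto
  define Q where "Q = (\<lambda>y F. snd y \<subseteq> V - fst y \<and> (\<forall>z\<in>snd y. doubly_covered F (fst y) z))"
  have each: "(\<Sum>y\<in>X t. pr p (edges V) (Q y)) \<le> ?th ^ t" if t: "t \<in> {1..t0}" for t
  proof -
    have Kt: "0 < K * t" "K * t \<le> n"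
    proof -
      have "K * t \<le> (K + 1) * t0" using t by (intro mult_mono) auto
      then show "K * t \<le> n" using t0 unfolding n_def by linarith
      show "0 < K * t" using K t by auto
    qed
    have "1 * t \<le> K * t" using K by (rule mult_le_mono1)
    then have tn: "t \<le> n" using Kt by linarith
    have "pr p (edges V) (Q y) \<le> ((real t * p)\<^sup>2) ^ (K * t)" if y: "y \<in> X t" for y
    proof (cases "snd y \<subseteq> V - fst y")
      case True
      then show ?thesis
        using pr_all_doubly_covered_le[OF V(1) _ True] y unfolding X_def Q_def by auto
    next
      case False
      then have "pr p (edges V) (Q y) = 0" using V by (intro pr_eq_0) (auto simp: Q_def)
      then show ?thesis by simp
    qed
    then have "(\<Sum>y\<in>X t. pr p (edges V) (Q y)) \<le> real (card (X t)) * ((real t * p)\<^sup>2) ^ (K * t)"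
      by (rule sum_bounded_above)
    also have "\<dots> \<le> (real n ^ t * (exp 1 * real n / real t) ^ (K * t)) * ((real t * p)\<^sup>2) ^ (K * t)"
    proof (rule mult_right_mono)
      have "real (card {U. U \<subseteq> V \<and> card U = K * t}) \<le> real (card {U. U \<subseteq> V \<and> card U \<le> K * t})"
        using V by (intro of_nat_mono card_mono) auto
      also have "\<dots> \<le> (exp 1 * real n / real (K * t)) ^ (K * t)"
        unfolding n_def using V Kt unfolding n_def by (intro card_small_subsets_le) auto
      also have "\<dots> \<le> (exp 1 * real n / real t) ^ (K * t)"
        using t K n by (intro power_mono divide_left_mono) auto
      finally have u: "real (card {U. U \<subseteq> V \<and> card U = K * t}) \<le> (exp 1 * real n / real t) ^ (K * t)" .
      have "card {S. S \<subseteq> V \<and> card S = t} = n choose t" unfolding n_def using V by (simp add: n_subsets)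
      also have "\<dots> \<le> n ^ t" using tn by (rule binomial_le_pow)
      finally have "real (card {S. S \<subseteq> V \<and> card S = t}) \<le> real n ^ t"
        by (metis of_nat_le_iff of_nat_power)
      then show "real (card (X t)) \<le> real n ^ t * (exp 1 * real n / real t) ^ (K * t)"
        unfolding X_def card_cartesian_product of_nat_mult using u by (intro mult_mono) auto
    qed auto
    also have "\<dots> = (real n * (exp 1 * real n / real t * (real t * p)\<^sup>2) ^ K) ^ t"
      by (simp only: power_mult_distrib power_mult mult.assoc)
    also have "exp 1 * real n / real t * (real t * p)\<^sup>2 = exp 1 * (real n * p)\<^sup>2 * real t / real n"
      using t n by (simp add: field_simps power2_eq_square)
    also have "(real n * (exp 1 * (real n * p)\<^sup>2 * real t / real n) ^ K) ^ t \<le>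
        (real n * (exp 1 * (real n * p)\<^sup>2 * real t0 / real n) ^ K) ^ t"
      using t n by (intro power_mono mult_left_mono divide_right_mono) auto
    finally show ?thesis unfolding n_def .
  qed
  have "pr p (edges V) ?E \<le> (\<Sum>y\<in>Sigma {1..t0} X. pr p (edges V) (Q (snd y)))"
  proof (rule pr_union_bound)
    show "finite (Sigma {1..t0} X)" using fX by auto
    fix F assume "?E F"
    then obtain S U where SU: "S \<subseteq> V" "S \<noteq> {}" "card S \<le> t0" "U \<subseteq> V - S" "card U = K * card S"
      "\<forall>y\<in>U. doubly_covered F S y" by blast
    have "card S \<ge> 1" using SU V by (metis Suc_leI card_gt_0_iff finite_subset One_nat_def)
    then show "\<exists>y\<in>Sigma {1..t0} X. Q (snd y) F"
      using SU by (intro bexI[of _ "(card S, S, U)"]) (auto simp: X_def Q_def)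
  qed
  also have "\<dots> = (\<Sum>t\<in>{1..t0}. \<Sum>y\<in>X t. pr p (edges V) (Q y))"
    using fX by (subst sum.Sigma) (auto simp: split_def)
  also have "\<dots> \<le> (\<Sum>t\<in>{1..t0}. ?th ^ t)" by (intro sum_mono each)
  also have "\<dots> \<le> 2 * ?th" using th by (intro geometric_sum_le) auto
  finally show ?thesis .
qed

text \<open>Each vertex of \<open>S\<close> gains about \<open>exp (- n * p)\<close> from its
  missing edges and pays for at most \<open>K + 1\<close> vertices of \<open>M\<close>, at a factor
  \<open>32 * exp 1 * n * p\<close> each.\<close>

lemma pr_bounded_certificate_le:
  fixes K t0 :: nat
  assumes V: "finite V" "V \<noteq> {}" and K: "p * real ((K + 1) * t0) \<le> 1"
    and lam: "1 \<le> real (card V) * p"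
    and th: "(32 * exp 1 * (real (card V) * p)) ^ (K + 1) * exp (1 - real (card V) * p) \<le> 1 / 2"
  shows "pr p (edges V) (\<lambda>F. \<exists>M S r f a b. certificate V F M S r f a b \<and> card S \<le> t0 \<and>
      card M \<le> (K + 1) * card S) \<le>
    2 * ((32 * exp 1 * (real (card V) * p)) ^ (K + 1) * exp (1 - real (card V) * p))"
    (is "pr _ _ ?E \<le> 2 * ?th")
proof -
  define n where "n = card V"
  define la where "la = real n * p"
  have l1: "1 \<le> la" using lam unfolding la_def n_def .
  define C where "C = (\<lambda>m. SIGMA M:{M. M \<subseteq> V \<and> card M = m}. Pow M \<times> M \<times> (M \<rightarrow>\<^sub>E M) \<times> M \<times> M)"
  have fC: "finite (C m)" for m
    unfolding C_def
  proof (intro finite_SigmaI)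
    fix M assume "M \<in> {M. M \<subseteq> V \<and> card M = m}"
    then have "finite M" using V finite_subset by auto
    then show "finite (Pow M)" "finite M" "finite (M \<rightarrow>\<^sub>E M)" "finite M" "finite M"
      by (auto intro: finite_PiE)
  qed (use V in auto)
  define Q where "Q = (\<lambda>t (M, S, r, f, a, b) F. card S = t \<and> card (cert_edges M r f a b) = card M \<and>
      cert_edges M r f a b \<subseteq> F \<and> F \<inter> cert_gaps V M S = {})"
  have Qle: "pr p (edges V) (Q t y) \<le> p ^ m * exp (- p * (real t * (real n - real m)))"
    if y: "y \<in> C m" for t m y
  proof -
    obtain M S r f a b where yy: "y = (M, S, r, f, a, b)" by (cases y) auto
    have *: "M \<subseteq> V" "card M = m" "S \<subseteq> M" "r \<in> M" "f \<in> M \<rightarrow>\<^sub>E M" "a \<in> M" "b \<in> M"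
      using y unfolding yy C_def by auto
    show ?thesis
    proof (cases "card S = t \<and> card (cert_edges M r f a b) = card M")
      case True
      have "pr p (edges V) (Q t y) \<le>
          pr p (edges V) (\<lambda>F. cert_edges M r f a b \<subseteq> F \<and> F \<inter> cert_gaps V M S = {})"
        by (rule pr_mono) (auto simp: Q_def yy)
      also have "\<dots> \<le> p ^ card M * exp (- p * (real (card S) * (real (card V) - real (card M))))"
        using * True V by (intro pr_tree_and_gaps_le) auto
      finally show ?thesis using True * unfolding n_def by simp
    next
      case False
      then have "pr p (edges V) (Q t y) = 0" using V by (intro pr_eq_0) (auto simp: Q_def yy)
      then show ?thesis using p0 by simp
    qed
  qed
  have each: "(\<Sum>m = 1..(K + 1) * t. \<Sum>y\<in>C m. pr p (edges V) (Q t y)) \<le> ?th ^ t"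
    if t: "t \<in> {1..t0}" for t
  proof -
    define L where "L = (K + 1) * t"
    have "(\<Sum>y\<in>C m. pr p (edges V) (Q t y)) \<le> (16 * exp 1 * la) ^ L * exp (real t - la * real t)"
      if m: "m \<in> {1..L}" for m
    proof -
      \<comment> \<open>Counting missing edges only towards \<open>V - M\<close> loses
        \<open>exp (t * p * m)\<close>; this caps the loss at \<open>exp 1\<close> per vertex of
        \<open>S\<close>, the 1 in \<open>exp (1 - n * p)\<close>.\<close>
      have pm: "p * real m \<le> 1"
      proof -
        have "m \<le> (K + 1) * t0" using m t mult_le_mono2[of t t0 "K + 1"] unfolding L_def by simp
        then have "p * real m \<le> p * real ((K + 1) * t0)" using p0 by (intro mult_left_mono of_nat_mono)
        then show ?thesis using K by linarith
      qed
      have "(\<Sum>y\<in>C m. pr p (edges V) (Q t y)) \<le> real (card (C m)) * (p ^ m * exp (- p * (real t * (real n - real m))))"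
        using Qle by (rule sum_bounded_above)
      also have "\<dots> \<le> (16 * exp 1 * real n) ^ m * (p ^ m * exp (- p * (real t * (real n - real m))))"
        using card_certificates_le[OF V(1), of m] m p0 unfolding C_def n_def by (intro mult_right_mono) auto
      also have "\<dots> = (16 * exp 1 * la) ^ m * exp (real t * (p * real m) - la * real t)"
        unfolding la_def by (simp add: power_mult_distrib algebra_simps)
      also have "\<dots> \<le> (16 * exp 1 * la) ^ L * exp (real t * 1 - la * real t)"
      proof (rule mult_mono)
        have "1 \<le> exp (1::real)" by simp
        then have "1 * 1 * 1 \<le> 16 * exp 1 * la" using l1 by (intro mult_mono) auto
        then show "(16 * exp 1 * la) ^ m \<le> (16 * exp 1 * la) ^ L"
          using m by (intro power_increasing) auto
        have "real t * (p * real m) \<le> real t * 1" using pm by (intro mult_left_mono) auto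
        then show "exp (real t * (p * real m) - la * real t) \<le> exp (real t * 1 - la * real t)" by simp
      qed (use l1 in auto)
      finally show ?thesis by simp
    qed
    then have "(\<Sum>m = 1..L. \<Sum>y\<in>C m. pr p (edges V) (Q t y)) \<le>
        (\<Sum>m = 1..L. (16 * exp 1 * la) ^ L * exp (real t - la * real t))" by (intro sum_mono) auto
    also have "\<dots> = real L * ((16 * exp 1 * la) ^ L * exp (real t - la * real t))" by simp
    \<comment> \<open>The number of sizes \<open>m\<close> is absorbed into the base, turning 16
      into 32.\<close>
    also have "\<dots> \<le> 2 ^ L * ((16 * exp 1 * la) ^ L * exp (real t - la * real t))"
      using l1 of_nat_less_two_power[of L, where ?'a = real] by (intro mult_right_mono) auto
    also have "\<dots> = (32 * exp 1 * la) ^ L * exp (real t * (1 - la))"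
    proof -
      have "2 ^ L * (16 * exp 1 * la) ^ L = (2 * (16 * exp 1 * la)) ^ L" by (rule power_mult_distrib[symmetric])
      then show ?thesis by (simp add: algebra_simps)
    qed
    also have "\<dots> = ((32 * exp 1 * la) ^ (K + 1) * exp (1 - la)) ^ t"
      unfolding L_def by (simp only: power_mult power_mult_distrib exp_of_nat_mult)
    finally show ?thesis unfolding L_def la_def n_def .
  qed
  have "pr p (edges V) ?E \<le>
      (\<Sum>x\<in>(SIGMA t:{1..t0}. SIGMA m:{1..(K + 1) * t}. C m). pr p (edges V) (Q (fst x) (snd (snd x))))"
  proof (rule pr_union_bound)
    show "finite (SIGMA t:{1..t0}. SIGMA m:{1..(K + 1) * t}. C m)" using fC by auto
    fix F assume "?E F"
    then obtain M S r f a b where c: "certificate V F M S r f a b" "card S \<le> t0" "card M \<le> (K + 1) * card S"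
      by (elim exE conjE)
    note d = c(1)[unfolded certificate_def]
    have "M \<subseteq> V" "S \<subseteq> M" using d by simp_all
    then have "finite M" "finite S" using V by (meson finite_subset)+
    then have "1 \<le> card S" "1 \<le> card M" using d by (auto simp: Suc_le_eq card_gt_0_iff)
    then show "\<exists>x\<in>(SIGMA t:{1..t0}. SIGMA m:{1..(K + 1) * t}. C m). Q (fst x) (snd (snd x)) F"
      using d c by (intro bexI[of _ "(card S, card M, M, S, r, f, a, b)"]) (auto simp: C_def Q_def)
  qed
  also have "\<dots> = (\<Sum>t\<in>{1..t0}. \<Sum>m = 1..(K + 1) * t. \<Sum>y\<in>C m. pr p (edges V) (Q t y))"
    using fC by (simp add: sum.Sigma split_def)
  also have "\<dots> \<le> (\<Sum>t\<in>{1..t0}. ?th ^ t)" by (intro sum_mono each)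
  also have "\<dots> \<le> 2 * ?th" using th lam by (intro geometric_sum_le) auto
  finally show ?thesis .
qed

text \<open>If \<open>card M\<close> exceeds \<open>(K + 1) * card S\<close>, any
  \<open>K * card S\<close> vertices of \<open>M - S\<close> serve as a doubly covered
  \<open>U\<close>; otherwise the bounded count applies.\<close>

lemma pr_certificate_le:
  fixes K t0 :: nat
  assumes V: "finite V" "V \<noteq> {}" and K: "1 \<le> K" "(K + 1) * t0 \<le> card V" "p * real ((K + 1) * t0) \<le> 1"
    and lam: "1 \<le> real (card V) * p"
    and th1: "real (card V) * (exp 1 * (real (card V) * p)\<^sup>2 * real t0 / real (card V)) ^ K \<le> 1 / 2"
    and th2: "(32 * exp 1 * (real (card V) * p)) ^ (K + 1) * exp (1 - real (card V) * p) \<le> 1 / 2"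
  shows "pr p (edges V) (\<lambda>F. \<exists>M S r f a b. certificate V F M S r f a b \<and> card S \<le> t0) \<le>
    2 * (real (card V) * (exp 1 * (real (card V) * p)\<^sup>2 * real t0 / real (card V)) ^ K) +
    2 * ((32 * exp 1 * (real (card V) * p)) ^ (K + 1) * exp (1 - real (card V) * p))"
proof (rule order_trans[OF pr_disj_le add_mono[OF
      pr_many_doubly_covered_le[OF V K(1,2) th1] pr_bounded_certificate_le[OF V K(3) lam th2]]])
  fix F assume "\<exists>M S r f a b. certificate V F M S r f a b \<and> card S \<le> t0"
  then obtain M S r f a b where c: "certificate V F M S r f a b" and S: "card S \<le> t0" by (elim exE conjE)
  note d = c[unfolded certificate_def]
  have sub: "M \<subseteq> V" "S \<subseteq> M" "S \<noteq> {}" using d by simp_all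
  then have fin: "finite M" "finite S" using V by (meson finite_subset)+
  show "(\<exists>S U. S \<subseteq> V \<and> S \<noteq> {} \<and> card S \<le> t0 \<and> U \<subseteq> V - S \<and> card U = K * card S \<and>
      (\<forall>y\<in>U. doubly_covered F S y)) \<or>
    (\<exists>M S r f a b. certificate V F M S r f a b \<and> card S \<le> t0 \<and> card M \<le> (K + 1) * card S)"
  proof (cases "card M \<le> (K + 1) * card S")
    case True
    show ?thesis by (intro disjI2 exI conjI) (rule c, rule S, rule True)
  next
    case False
    have "card (M - S) = card M - card S" using sub fin by (intro card_Diff_subset) auto
    then have "K * card S \<le> card (M - S)" using False by simp
    then obtain U where U: "U \<subseteq> M - S" "card U = K * card S" "finite U"
      by (rule obtain_subset_with_card_n)
    have "\<forall>y\<in>M - S. doubly_covered F S y" using d by simp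
    then have "\<forall>y\<in>U. doubly_covered F S y" using U(1) by blast
    then show ?thesis using sub S U
      by (intro disjI1 exI[of _ S] exI[of _ U] conjI) auto
  qed
qed

end

section \<open>Rank and unobstructed sets\<close>

lemma rank_eq_card_col_basis:
  fixes A :: "complex mat"
  assumes A: "A \<in> carrier_mat n n"
    and R: "col_basis (\<lambda>i j. A $$ (i, j)) {..<n} {..<n} R"
  shows "vec_space.rank n A = card R"
proof -
  interpret vec_space "TYPE(complex)" n .
  have RV: "R \<subseteq> {..<n}" and ind: "indep_cols (\<lambda>i j. A $$ (i, j)) {..<n} R"
    using R unfolding col_basis_def by auto
  have fR: "finite R" using RV finite_subset by blast
  have cA: "col A j \<in> carrier_vec n" for j using A by (simp add: carrier_vecI)
  have ci: "col A j $ i = A $$ (i, j)" if "i < n" "j < n" for i j using that A by simp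
  have setc: "set (cols A) = col A ` {..<n}" using A by (auto simp: cols_def)
  define S where "S = col A ` R"
  have SC: "S \<subseteq> carrier_vec n" and fS: "finite S" unfolding S_def using cA fR by auto
  \<comment> \<open>The rank is computed from sets of column vectors, so equal columns at two
    indices of \<open>R\<close> must be ruled out.\<close>
  have inj: "inj_on (col A) R"
  proof (rule inj_onI, rule ccontr)
    fix j k assume j: "j \<in> R" and k: "k \<in> R" and e: "col A j = col A k" and ne: "j \<noteq> k"
    define v where "v = (\<lambda>i. if i = j then 1 else if i = k then - 1 else 0 :: complex)"
    have "(\<Sum>l\<in>R. A $$ (i, l) * v l) = 0" if i: "i \<in> {..<n}" for i
    proof -
      have "(\<Sum>l\<in>R. A $$ (i, l) * v l) = (\<Sum>l\<in>{j, k}. A $$ (i, l) * v l)"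
        using j k fR by (intro sum.mono_neutral_right) (auto simp: v_def)
      also have "\<dots> = A $$ (i, j) - A $$ (i, k)" using ne by (simp add: v_def)
      also have "\<dots> = 0"
      proof -
        have "i < n" "j < n" "k < n" using i j k RV by auto
        then show ?thesis using e ci[of i j] ci[of i k] by simp
      qed
      finally show ?thesis .
    qed
    then have "v j = 0" using j by (rule indep_colsD[OF ind])
    then show False unfolding v_def by simp
  qed
  have indS: "lin_indpt S"
  proof
    assume "lin_dep S"
    then obtain a v where av: "lincomb a S = 0\<^sub>v n" "v \<in> S" "a v \<noteq> 0"
      using finite_lin_dep[OF fS _] SC by auto
    have "(\<Sum>l\<in>R. A $$ (i, l) * a (col A l)) = 0" if i: "i \<in> {..<n}" for i
    proof -
      have "(\<Sum>l\<in>R. A $$ (i, l) * a (col A l)) = (\<Sum>x\<in>S. a x * x $ i)"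
        unfolding S_def sum.reindex[OF inj] comp_def using i RV ci
        by (intro sum.cong) (auto simp: mult.commute)
      also have "\<dots> = lincomb a S $ i" using i SC by (intro lincomb_index[symmetric]) auto
      also have "\<dots> = 0" using av i by simp
      finally show ?thesis .
    qed
    then have "a (col A l) = 0" if "l \<in> R" for l
      using that by (rule indep_colsD[OF ind, of "\<lambda>l. a (col A l)"])
    then show False using av unfolding S_def by auto
  qed
  have max: "T = S" if T: "S \<subseteq> T" "T \<subseteq> set (cols A)" "lin_indpt T" for T
  proof (rule ccontr)
    assume "T \<noteq> S"
    then obtain t where t: "t \<in> T" "t \<notin> S" using T by auto
    then obtain j where j: "t = col A j" "j < n" using T setc by auto
    have "\<exists>c. \<forall>i\<in>{..<n}. A $$ (i, j) = (\<Sum>k\<in>R. A $$ (i, k) * c k)"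
      using R j(2) unfolding col_basis_def by simp
    then obtain c where "\<forall>i\<in>{..<n}. A $$ (i, j) = (\<Sum>k\<in>R. A $$ (i, k) * c k)" ..
    then have c: "A $$ (i, j) = (\<Sum>k\<in>R. A $$ (i, k) * c k)" if "i < n" for i using that by simp
    define a where "a = (\<lambda>x. if x = t then - 1 else c (the_inv_into R (col A) x))"
    have aR: "a (col A k) = c k" if k: "k \<in> R" for k
    proof -
      have "col A k \<noteq> t" using k t(2) unfolding S_def by auto
      then show ?thesis unfolding a_def using the_inv_into_f_f[OF inj k] by simp
    qed
    have tC: "insert t S \<subseteq> carrier_vec n" using SC cA j by auto
    have lc: "lincomb a (insert t S) = 0\<^sub>v n"
    proof (rule eq_vecI)
      fix i assume "i < dim_vec (0\<^sub>v n)"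
      then have i: "i < n" by simp
      have "lincomb a (insert t S) $ i = (\<Sum>x\<in>insert t S. a x * x $ i)"
        by (rule lincomb_index[OF i tC])
      also have "\<dots> = - t $ i + (\<Sum>x\<in>S. a x * x $ i)"
        using fS t(2) by (simp add: a_def)
      also have "(\<Sum>x\<in>S. a x * x $ i) = (\<Sum>k\<in>R. A $$ (i, k) * c k)"
        unfolding S_def sum.reindex[OF inj] comp_def
        by (intro sum.cong) (use aR ci[OF i] RV in \<open>auto simp: mult.commute\<close>)
      also have "- t $ i + \<dots> = 0" using c[OF i] ci[OF i j(2)] j(1) by simp
      finally show "lincomb a (insert t S) $ i = 0\<^sub>v n $ i" using i by simp
    next
      show "dim_vec (lincomb a (insert t S)) = dim_vec (0\<^sub>v n)"
        using lincomb_dim[of "insert t S" a] fS tC by simp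
    qed
    have "lin_dep T"
    proof (rule lin_dep_crit)
      show "insert t S \<subseteq> T" using t T by auto
      show "t \<in> insert t S" "a t \<noteq> 0" by (auto simp: a_def)
      show "lincomb a (insert t S) = 0\<^sub>v n" by (rule lc)
    qed (use fS in auto)
    then show False using T by simp
  qed
  have "maximal S (\<lambda>T. T \<subseteq> set (cols A) \<and> lin_indpt T)"
    unfolding maximal_def
  proof (intro conjI allI impI)
    show "S \<subseteq> set (cols A)" unfolding S_def setc using RV by auto
    show "lin_indpt S" by (rule indS)
    fix T assume "S \<subseteq> T \<and> T \<subseteq> set (cols A) \<and> lin_indpt T"
    then show "T = S" using max by blast
  qed
  then have "rank A = card S" by (rule rank_card_indpt[OF A])
  also have "\<dots> = card R" unfolding S_def by (rule card_image[OF inj])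
  finally show ?thesis .
qed

lemma neighbourhood_mono: "S \<subseteq> T \<Longrightarrow> neighbourhood Q S \<subseteq> neighbourhood Q T"
  unfolding neighbourhood_def by auto

lemma finite_neighbourhood: "finite (neighbourhood Q T)"
  unfolding neighbourhood_def graph_verts_def by auto

text \<open>\<open>S \<inter> T\<close> expands into the neighbourhood of \<open>T\<close>, while
  \<open>S \<union> T\<close> has at most \<open>n\<close> elements.\<close>

lemma unobstructed_card_le:
  assumes Q: "Q \<in> carrier_mat n n" and S: "unobstructed Q S" and T: "T \<subseteq> {..<n}"
  shows "card S + card T \<le> n + card (neighbourhood Q T)"
proof -
  have SV: "S \<subseteq> {..<n}" using S Q unfolding unobstructed_def graph_verts_def by auto
  have fin: "finite S" "finite T" using SV T finite_subset by blast+
  have "\<not> non_expanding Q (S \<inter> T)" using S unfolding unobstructed_def by auto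
  then have "card (S \<inter> T) \<le> card (neighbourhood Q (S \<inter> T))" unfolding non_expanding_def by simp
  also have "\<dots> \<le> card (neighbourhood Q T)"
    by (intro card_mono finite_neighbourhood neighbourhood_mono) auto
  finally have 1: "card (S \<inter> T) \<le> card (neighbourhood Q T)" .
  have "card (S \<union> T) \<le> card {..<n}" using SV T by (intro card_mono) auto
  then show ?thesis using 1 card_Un_Int[OF fin] by simp
qed

text \<open>The columns of a non-expanding set are nonzero in fewer rows than there are columns,
  hence dependent.\<close>

lemma col_basis_unobstructed:
  assumes Q: "Q \<in> carrier_mat n n" and sym: "\<And>i j. i < n \<Longrightarrow> j < n \<Longrightarrow> Q $$ (i, j) = Q $$ (j, i)"
    and R: "col_basis (\<lambda>i j. Q $$ (i, j)) {..<n} {..<n} R"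
  shows "unobstructed Q R"
proof -
  have RV: "R \<subseteq> {..<n}" and ind: "indep_cols (\<lambda>i j. Q $$ (i, j)) {..<n} R"
    using R unfolding col_basis_def by auto
  have fR: "finite R" using RV finite_subset by blast
  have "\<not> non_expanding Q U" if U: "U \<subseteq> R" for U
  proof
    assume ne: "non_expanding Q U"
    let ?N = "neighbourhood Q U"
    have fU: "finite U" using U fR finite_subset by blast
    obtain v where v: "\<forall>i\<in>?N. (\<Sum>j\<in>U. Q $$ (i, j) * v j) = 0" "\<exists>j\<in>U. v j \<noteq> 0"
      using underdetermined_system[OF finite_neighbourhood fU, of Q U "\<lambda>i j. Q $$ (i, j)"] ne
      unfolding non_expanding_def by auto
    define w where "w = (\<lambda>j. if j \<in> U then v j else 0)"
    have "(\<Sum>j\<in>R. Q $$ (i, j) * w j) = 0" if i: "i \<in> {..<n}" for i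
    proof -
      have "(\<Sum>j\<in>R. Q $$ (i, j) * w j) = (\<Sum>j\<in>U. Q $$ (i, j) * v j)"
        using U fR by (intro sum.mono_neutral_cong_right) (auto simp: w_def)
      also have "\<dots> = 0"
      proof (cases "i \<in> ?N")
        case False
        then have "Q $$ (i, j) = 0" if "j \<in> U" for j
          using i that U RV Q sym[of i j]
          unfolding neighbourhood_def graph_adj_def graph_verts_def by auto
        then show ?thesis by simp
      qed (use v in auto)
      finally show ?thesis .
    qed
    then have w0: "w j = 0" if "j \<in> R" for j using that by (rule indep_colsD[OF ind])
    obtain j where "j \<in> U" "v j \<noteq> 0" using v(2) by blast
    then show False using w0[of j] U unfolding w_def by auto
  qed
  then show ?thesis using RV Q unfolding unobstructed_def graph_verts_def by auto
qed

lemma rank_eq_max_unobstructed_size: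
  assumes Q: "Q \<in> carrier_mat n n" and sym: "\<And>i j. i < n \<Longrightarrow> j < n \<Longrightarrow> Q $$ (i, j) = Q $$ (j, i)"
    and R: "col_basis (\<lambda>i j. Q $$ (i, j)) {..<n} {..<n} R"
    and T: "T \<subseteq> {..<n}" "card ({..<n} - R) + card (neighbourhood Q T) \<le> card T"
  shows "vec_space.rank n Q = max_unobstructed_size Q"
proof -
  have RV: "R \<subseteq> {..<n}" using R unfolding col_basis_def by auto
  then have "finite R" using finite_subset by blast
  then have "card ({..<n} - R) = n - card R" "card R \<le> n"
    using RV card_mono[of "{..<n}" R] by (auto simp: card_Diff_subset)
  then have le: "card S \<le> card R" if "unobstructed Q S" for S
    using unobstructed_card_le[OF Q that T(1)] T(2) by linarith
  let ?C = "{card S | S. unobstructed Q S}"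
  have "?C \<subseteq> {..card R}" using le by auto
  then have "finite ?C" using finite_subset by blast
  moreover have "card R \<in> ?C" using col_basis_unobstructed[OF Q sym R] by auto
  ultimately have "Max ?C = card R" using le by (intro Max_eqI) auto
  then show ?thesis unfolding max_unobstructed_size_def using rank_eq_card_col_basis[OF Q R] by simp
qed

text \<open>The corank is at most the deficiency \<open>card T - card N\<close> for the
  neighbourhood \<open>N\<close> of some \<open>T\<close>, stated for every basis and without
  truncated subtraction.\<close>

definition corank_witnessed :: "nat set \<Rightarrow> (nat \<Rightarrow> nat \<Rightarrow> complex) \<Rightarrow> bool" where
  "corank_witnessed V q \<longleftrightarrow> (\<forall>R. col_basis q V V R \<longrightarrow>
     (\<exists>T\<subseteq>V. card (V - R) + card {y \<in> V. \<exists>x\<in>T. q y x \<noteq> 0} \<le> card T))"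

context weights
begin

text \<open>A kernel vector has zero image, so \<open>large\<close> and \<open>mid\<close> push the
  full support below \<open>t0\<close>. For \<open>t0 = 1\<close> it is empty and cannot produce a
  certificate, whence the premise \<open>1 < t0\<close>.\<close>

lemma corank_witnessedI:
  fixes t0 d :: nat
  assumes large: "\<not> (\<exists>v\<in>kern V (qmat W F). d \<le> card (supp_on V v))"
    and mid: "\<And>u. t0 \<le> card (supp_on V u) \<Longrightarrow> card (supp_on V u) \<le> d \<Longrightarrow>
      2 * card (supp_on V u) < card (supp_on V (app V (qmat W F) u))"
    and cert: "1 < t0 \<Longrightarrow> \<not> (\<exists>M S r f a b. certificate V F M S r f a b \<and> card S \<le> t0)"
  shows "corank_witnessed V (qmat W F)"
  unfolding corank_witnessed_def
proof (intro allI impI)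
  fix R assume R: "col_basis (qmat W F) V V R"
  obtain v where v: "v \<in> kern V (qmat W F)"
    and vmax: "\<And>u. u \<in> kern V (qmat W F) \<Longrightarrow> supp_on V u \<subseteq> supp_on V v"
    using kern_full_support[OF finV, of "qmat W F"] by blast
  define T where "T = supp_on V v"
  define N where "N = {y \<in> V. \<exists>x\<in>T. qmat W F y x \<noteq> 0}"
  have TV: "T \<subseteq> V" unfolding T_def by (rule supp_on_subset)
  have v0: "app V (qmat W F) v i = 0" if "i \<in> V" for i using v that unfolding kern_def by auto
  have "card T < d" using large v unfolding T_def by (meson not_le)
  moreover have "supp_on V (app V (qmat W F) v) = {}" using v0 unfolding supp_on_def by auto
  ultimately have tt: "card T < t0" using mid[of v] unfolding T_def by fastforce
  have vT: "(\<Sum>j\<in>T. qmat W F i j * v j) = 0" if "i \<in> V" for i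
    using v0[OF that] app_restrict[OF finV TV, of v "qmat W F" i] unfolding T_def supp_on_def by auto
  have "indep_cols (qmat W F) T N"
  proof (rule ccontr)
    assume dep: "\<not> indep_cols (qmat W F) T N"
    then obtain M S r f a b where c: "certificate V F M S r f a b" "S \<subseteq> T"
      using dependent_rows_certificate[OF TV vT _ N_def] unfolding T_def supp_on_def by blast
    have fT: "finite T" using TV finV finite_subset by blast
    have "S \<noteq> {}" using c(1) unfolding certificate_def by simp
    then have "T \<noteq> {}" using c(2) by auto
    then have "1 < t0" using tt fT by (metis One_nat_def Suc_lessI card_gt_0_iff less_trans not_less_eq)
    moreover have "card S \<le> t0" using card_mono[OF fT c(2)] tt by linarith
    ultimately show False using cert c(1) by blast
  qed
  moreover have "N \<subseteq> V" unfolding N_def by auto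
  ultimately have "card (V - R) + card N \<le> card T"
    using corank_le_deficiency[OF R TV vmax[folded T_def]] by blast
  then show "\<exists>T\<subseteq>V. card (V - R) + card {y \<in> V. \<exists>x\<in>T. qmat W F y x \<noteq> 0} \<le> card T"
    using TV unfolding N_def by blast
qed

end

section \<open>Asymptotics\<close>

text \<open>For \<open>t * p \<le> 1\<close> the factor \<open>t\<close> cancels and
  \<open>p\<close> is the claim. Otherwise \<open>128 * (1 + ln (N / t)) \<le> N / t\<close> is
  needed, which holds from \<open>65536\<close>, the square of 256, onwards.\<close>

lemma forbidden_sizeI:
  assumes t: "1 \<le> t" "65536 * t \<le> N" and p: "128 * (1 + ln (real N / real t)) \<le> real N * p"
  shows "forbidden_size N p t"
proof -
  have "128 * (real t * (1 + ln (real N / real t))) \<le> real N * min (real t * p) 1"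
  proof (cases "real t * p \<le> 1")
    case True
    have "real t * (128 * (1 + ln (real N / real t))) \<le> real t * (real N * p)"
      using p by (intro mult_left_mono) auto
    then show ?thesis using True by (simp add: min_def algebra_simps)
  next
    case False
    define y where "y = sqrt (real N / real t)"
    have tN: "65536 \<le> real N / real t" using t by (simp add: field_simps)
    have "sqrt 65536 \<le> y" unfolding y_def using tN by (rule real_sqrt_le_mono)
    moreover have "sqrt 65536 = (256 :: real)" by (rule real_sqrt_unique) auto
    ultimately have y: "256 \<le> y" by simp
    have y2: "real N = real t * (y * y)" unfolding y_def using t by simp
    have "ln (real N / real t) = 2 * ln y"
      unfolding y_def using tN by (subst ln_sqrt) auto
    also have "\<dots> \<le> 2 * (y - 1)" using y ln_le_minus_one[of y] by simp
    finally have "128 * (1 + ln (real N / real t)) \<le> 256 * y" by simp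
    also have "\<dots> \<le> y * y" using y by (intro mult_right_mono) auto
    finally have "real t * (128 * (1 + ln (real N / real t))) \<le> real t * (y * y)"
      by (intro mult_left_mono) auto
    then show ?thesis using False y2 by (simp add: min_def algebra_simps)
  qed
  then show ?thesis using t unfolding forbidden_size_def by auto
qed

text \<open>The groups come from large kernel vectors, intermediate supports and certificates.
  \<open>262144 = 2 ^ 18\<close> bounds \<open>n / d\<close>, and \<open>2097152\<close> is 8 times
  that, from \<open>d * p / 8\<close> in the quadratic step. The dominant term is of order
  \<open>ln n powr (- 1 / 4)\<close>.\<close>

definition error_bound :: "real \<Rightarrow> nat \<Rightarrow> real" where
  "error_bound c n = 262144 * (1 / (real n - 1) +
      (12 / sqrt (c * ln (real n) / 2097152) + sqrt (36 / sqrt (c * ln (real n) / 2097152)))) +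
    1 / real n + (2 / real n + 2 * exp 1 * real n powr (- (c / 2)))"

lemma error_bound_bigo:
  assumes c: "c > 0"
  shows "error_bound c \<in> O(\<lambda>n. 1 / ln (ln (real n)) powr (1 / 4))"
proof -
  have "(\<lambda>n. 262144 * (1 / (real n - 1) + (12 / sqrt (c * ln (real n) / 2097152) +
      sqrt (36 / sqrt (c * ln (real n) / 2097152))))) \<in> O(\<lambda>n. 1 / ln (ln (real n)) powr (1 / 4))"
    using c by real_asymp
  moreover have "(\<lambda>n. 1 / real n) \<in> O(\<lambda>n. 1 / ln (ln (real n)) powr (1 / 4))" by real_asymp
  moreover have "(\<lambda>n. 2 / real n) \<in> O(\<lambda>n. 1 / ln (ln (real n)) powr (1 / 4))" by real_asymp
  moreover have "(\<lambda>n. 2 * exp 1 * real n powr (- (c / 2))) \<in> O(\<lambda>n. 1 / ln (ln (real n)) powr (1 / 4))"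
    using c by real_asymp
  ultimately show ?thesis unfolding error_bound_def by (intro sum_in_bigo(1))
qed

lemma error_bound_smallo:
  assumes c: "c > 0"
  shows "error_bound c \<in> o(\<lambda>_. 1)"
proof -
  have "(\<lambda>n::nat. 1 / ln (ln (real n)) powr (1 / 4)) \<in> o(\<lambda>_. 1)" by real_asymp
  then show ?thesis using error_bound_bigo[OF c] by (rule landau_o.big_small_trans[rotated])
qed

text \<open>\<open>256 * (1 + ln n)\<close> bounds \<open>n * p\<close> in the sparse regime, and
  \<open>2 * n powr (1 - a)\<close> bounds \<open>t0\<close> there.\<close>

definition large_enough :: "real \<Rightarrow> real \<Rightarrow> nat \<Rightarrow> nat \<Rightarrow> bool" where
  "large_enough c a K n \<longleftrightarrow> 262144 \<le> n \<and> 4 * real n powr (1 - a) \<le> real n / 262144 \<and>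
      512 \<le> c * ln (real n) \<and>
      256 * (1 + ln (real n)) * (real (K + 1) * (2 * real n powr (1 - a))) \<le> real n \<and>
      2 * exp 1 * (256 * (1 + ln (real n)))\<^sup>2 * real n powr (- a) \<le> real n powr (- (a / 2)) \<and>
      32 * exp 1 * (256 * (1 + ln (real n))) \<le> real n powr (c / (2 * real (K + 1))) \<and>
      exp 1 * real n powr (- (c / 2)) \<le> 1 / 2"

lemma eventually_large_enough:
  fixes c a :: real and K :: nat
  assumes c: "c > 0" and a: "0 < a" "a \<le> 1 / 2" and K: "4 \<le> a * real K"
  shows "eventually (large_enough c a K) sequentially"
  unfolding large_enough_def
proof (intro eventually_conj)
  define b where "b = c / (2 * real (K + 1))"
  have b: "b > 0" unfolding b_def using c by simp
  define k where "k = real (K + 1)"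
  have k: "k > 0" unfolding k_def by simp
  show "eventually (\<lambda>n::nat. 262144 \<le> n) sequentially" by (rule eventually_ge_at_top)
  show "eventually (\<lambda>n::nat. 4 * real n powr (1 - a) \<le> real n / 262144) sequentially"
    using a by real_asymp
  show "eventually (\<lambda>n::nat. 512 \<le> c * ln (real n)) sequentially" using c by real_asymp
  show "eventually (\<lambda>n::nat. 256 * (1 + ln (real n)) * (real (K + 1) * (2 * real n powr (1 - a))) \<le> real n) sequentially"
    unfolding k_def[symmetric] using a k by real_asymp
  show "eventually (\<lambda>n::nat. 2 * exp 1 * (256 * (1 + ln (real n)))\<^sup>2 * real n powr (- a) \<le> real n powr (- (a / 2))) sequentially"
    using a by real_asymp
  show "eventually (\<lambda>n::nat. 32 * exp 1 * (256 * (1 + ln (real n))) \<le> real n powr (c / (2 * real (K + 1)))) sequentially"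
    unfolding b_def[symmetric] using b by real_asymp
  show "eventually (\<lambda>n::nat. exp 1 * real n powr (- (c / 2)) \<le> 1 / 2) sequentially"
    using c by real_asymp
qed

lemma (in bern) pr_not_corank_witnessed_le:
  fixes c a :: real and K n :: nat
  assumes W: "weights W {..<n}" and p: "c * ln (real n) / real n < p" "p < 1 / 2"
    and c: "c > 0" and a: "0 < a" "a \<le> 1 / 2" "512 * a \<le> c" and K: "4 \<le> a * real K"
    and n: "large_enough c a K n"
  shows "pr p (edges {..<n}) (\<lambda>F. \<not> corank_witnessed {..<n} (qmat W F)) \<le> error_bound c n"
proof -
  have n: "262144 \<le> n" and n1: "4 * real n powr (1 - a) \<le> real n / 262144"
    and n2: "512 \<le> c * ln (real n)"
    and n3: "256 * (1 + ln (real n)) * (real (K + 1) * (2 * real n powr (1 - a))) \<le> real n"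
    and n4: "2 * exp 1 * (256 * (1 + ln (real n)))\<^sup>2 * real n powr (- a) \<le> real n powr (- (a / 2))"
    and n5: "32 * exp 1 * (256 * (1 + ln (real n))) \<le> real n powr (c / (2 * real (K + 1)))"
    and n6: "exp 1 * real n powr (- (c / 2)) \<le> 1 / 2"
    using n unfolding large_enough_def by blast+
  define V where "V = {..<n}"
  interpret weights W V using W unfolding V_def .
  have cV: "card V = n" and fV: "finite V" unfolding V_def by auto
  have "0 \<in> V" unfolding V_def using n by simp
  then have V0: "V \<noteq> {}" by blast
  have ln0: "ln (real n) > 0" using n by simp
  have np: "c * ln (real n) < real n * p" using p n by (simp add: field_simps)
  have p0': "0 < p" using np n c ln0 by (smt (verit) mult_nonneg_nonpos of_nat_0_le_iff mult_pos_pos)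
  have p12: "p \<le> 1 / 2" using p by simp
  \<comment> \<open>Above this threshold every size from 1 to \<open>d\<close> is forbidden, so
    \<open>t0 = 1\<close> and certificates cannot arise; below it \<open>n * p\<close> is small
    enough for the certificate bounds.\<close>
  define dense where "dense \<longleftrightarrow> 256 * (1 + ln (real n)) \<le> real n * p"
  define t0 where "t0 = (if dense then 1 else nat \<lceil>real n powr (1 - a)\<rceil>)"
  \<comment> \<open>\<open>131072\<close> is twice \<open>65536\<close>, so that
    \<open>forbidden_sizeI\<close> applies to the matrix and also to its minors of size
    \<open>n - 1\<close>.\<close>
  define d where "d = n div 131072"
  have d2: "2 \<le> d" and dn: "131072 * d \<le> n" "real n \<le> 262144 * real d" "2 * d < n"
    unfolding d_def using n by linarith+
  have pw1: "1 \<le> real n powr (1 - a)" using n a by (intro ge_one_powr_ge_zero) auto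
  have sparse: "real n powr (1 - a) \<le> real t0" "real t0 \<le> 2 * real n powr (1 - a)" if "\<not> dense"
  proof -
    have "real t0 = of_int \<lceil>real n powr (1 - a)\<rceil>" using that unfolding t0_def by simp
    then show "real n powr (1 - a) \<le> real t0" "real t0 \<le> 2 * real n powr (1 - a)"
      using pw1 by linarith+
  qed
  have t01: "1 \<le> t0"
  proof (cases dense)
    case False
    then show ?thesis using sparse(1) pw1 by linarith
  qed (simp add: t0_def)
  have t0d: "2 * t0 \<le> d"
  proof (cases dense)
    case False
    then have "2 * real t0 \<le> real d" using sparse(2) n1 dn(2) by linarith
    then show ?thesis by linarith
  qed (use d2 in \<open>simp add: t0_def\<close>)
  have forb: "forbidden_size N p t" if N: "N = n \<or> N = n - 1" and t: "t0 \<le> t" "t \<le> d" for N t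
  proof (rule forbidden_sizeI)
    have N2: "real n / 2 \<le> real N" "real N \<le> real n" "n \<le> 2 * N" using N n by auto
    show "1 \<le> t" using t t01 by simp
    then have t1: "1 \<le> real t" by simp
    have "131072 * t \<le> n" using t dn(1) by linarith
    then show "65536 * t \<le> N" using N2(3) by linarith
    have Np: "real n * p / 2 \<le> real N * p" using mult_right_mono[OF N2(1) p0] by simp
    have Nt: "real N / real t \<le> real n / real t" using N2 by (intro divide_right_mono) auto
    have pos: "0 < real N / real t" using N2 n t1 by simp
    show "128 * (1 + ln (real N / real t)) \<le> real N * p"
    proof (cases dense)
      case True
      have "real n / real t \<le> real n" using t1 n by (simp add: field_simps)
      then have "ln (real N / real t) \<le> ln (real n)" using Nt pos by (intro ln_mono) auto
      then have "128 * (1 + ln (real N / real t)) \<le> 128 * (1 + ln (real n))" by simp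
      also have "\<dots> \<le> real n * p / 2" using True unfolding dense_def by simp
      finally show ?thesis using Np by (rule order_trans)
    next
      case False
      have "real n powr (1 - a) \<le> real t" using sparse(1)[OF False] t by linarith
      then have "real n powr a * real n powr (1 - a) \<le> real n powr a * real t"
        by (intro mult_left_mono) auto
      then have "real n \<le> real n powr a * real t" using n by (simp flip: powr_add)
      then have "real n / real t \<le> real n powr a" using t1 by (simp add: field_simps)
      then have "ln (real N / real t) \<le> ln (real n powr a)"
        using Nt pos n by (intro ln_mono) auto
      then have "ln (real N / real t) \<le> a * ln (real n)" using n by (simp add: ln_powr)
      then have "128 * (1 + ln (real N / real t)) \<le> 128 + 128 * (a * ln (real n))" by simp
      \<comment> \<open>Half of the right side pays for 128, by \<open>512 \<le> c * ln n\<close>,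
        and half for the logarithm, by \<open>512 * a \<le> c\<close>.\<close>
      also have "\<dots> \<le> c * ln (real n) / 2"
      proof -
        have "512 * a * ln (real n) \<le> c * ln (real n)" using a ln0 by (intro mult_right_mono) auto
        then show ?thesis using n2 by simp
      qed
      also have "\<dots> \<le> real n * p / 2" using np by simp
      finally show ?thesis using Np by (rule order_trans)
    qed
  qed
  define E1 where "E1 = (\<lambda>F. \<exists>v\<in>kern V (qmat W F). d \<le> card (supp_on V v))"
  define E2 where "E2 = (\<lambda>F. \<not> no_mid_support V p (qmat W F))"
  define E3 where "E3 = (\<lambda>F. 1 < t0 \<and> (\<exists>M S r f a b. certificate V F M S r f a b \<and> card S \<le> t0))"
  have e1: "pr p (edges V) E1 \<le> 262144 * (1 / (real n - 1) +
      (12 / sqrt (c * ln (real n) / 2097152) + sqrt (36 / sqrt (c * ln (real n) / 2097152))))"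
  proof -
    define u where "u = c * ln (real n) / 2097152"
    have u0: "u > 0" unfolding u_def using c ln0 by simp
    have "real n * p \<le> 262144 * real d * p" using dn(2) p0 by (intro mult_right_mono) auto
    then have ud: "u \<le> real d * p / 8" unfolding u_def using np by simp
    have "pr p (edges V) E1 \<le> real (card V) / real d *
        (1 / real (card V - 1) + (12 / sqrt (real d * p) + sqrt (36 / sqrt (real d * p / 8))))"
      unfolding E1_def
    proof (rule pr_large_kernel_le)
      show "weights W V" by unfold_locales
      show "forbidden_size (card V - 1) p t" if "t0 \<le> t" "t \<le> d" for t
        unfolding cV using that by (intro forb) auto
    qed (use p0' p12 t0d d2 dn cV in auto)
    also have "\<dots> \<le> 262144 * (1 / (real n - 1) + (12 / sqrt u + sqrt (36 / sqrt u)))"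
    proof (intro mult_mono add_mono)
      show "real (card V) / real d \<le> 262144" unfolding cV using dn(2) d2 by (simp add: field_simps)
      show "1 / real (card V - 1) \<le> 1 / (real n - 1)" unfolding cV using n by (simp add: of_nat_diff)
      have "real d * p / 8 \<le> real d * p" using p0' by simp
      with ud have "u \<le> real d * p" by (rule order_trans)
      then show "12 / sqrt (real d * p) \<le> 12 / sqrt u"
        using u0 by (intro divide_left_mono real_sqrt_le_mono mult_pos_pos) auto
      show "sqrt (36 / sqrt (real d * p / 8)) \<le> sqrt (36 / sqrt u)"
        using u0 ud by (intro divide_left_mono real_sqrt_le_mono mult_pos_pos) auto
    qed (use p0' in auto)
    finally show ?thesis unfolding u_def .
  qed
  have e2: "pr p (edges V) E2 \<le> 1 / real n"
    unfolding E2_def cV[symmetric] using p0' p12 V0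
    by (intro pr_mid_support_le) (auto intro: weights_axioms)
  have e3: "pr p (edges V) E3 \<le> 2 / real n + 2 * exp 1 * real n powr (- (c / 2))"
  proof (cases "1 < t0")
    case False
    then have "pr p (edges V) E3 = 0" using fV by (intro pr_eq_0) (auto simp: E3_def)
    then show ?thesis by simp
  next
    case True
    then have nd: "\<not> dense" unfolding t0_def by auto
    define B where "B = 256 * (1 + ln (real n))"
    have B: "real n * p \<le> B" "1 \<le> B" using nd ln0 unfolding dense_def B_def by auto
    have K1: "1 \<le> K" using K by (cases K) auto
    have Kt: "real ((K + 1) * t0) \<le> real (K + 1) * (2 * real n powr (1 - a))"
      unfolding of_nat_mult using sparse(2)[OF nd] by (intro mult_left_mono) auto
    have "1 * real ((K + 1) * t0) \<le> B * (real (K + 1) * (2 * real n powr (1 - a)))"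
      using Kt B by (intro mult_mono) auto
    then have Kn: "(K + 1) * t0 \<le> n" using n3 unfolding B_def by linarith
    have "real n * p * real ((K + 1) * t0) \<le> B * (real (K + 1) * (2 * real n powr (1 - a)))"
      using Kt B p0 by (intro mult_mono) auto
    then have "real n * (p * real ((K + 1) * t0)) \<le> real n * 1" using n3 unfolding B_def by (simp add: mult.assoc)
    then have Kp: "p * real ((K + 1) * t0) \<le> 1" using n by (simp only: mult_le_cancel_left_pos)
    define th1 where "th1 = real n * (exp 1 * (real n * p)\<^sup>2 * real t0 / real n) ^ K"
    define th2 where "th2 = (32 * exp 1 * (real n * p)) ^ (K + 1) * exp (1 - real n * p)"
    have th1: "th1 \<le> 1 / real n"
    proof -
      have "exp 1 * (real n * p)\<^sup>2 * real t0 / real n \<le> exp 1 * B\<^sup>2 * (2 * real n powr (1 - a)) / real n"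
        using B p0 sparse(2)[OF nd] by (intro divide_right_mono mult_mono power_mono) auto
      also have "\<dots> = 2 * exp 1 * B\<^sup>2 * real n powr (- a)"
        using n by (simp add: powr_diff powr_minus_divide)
      also have "\<dots> \<le> real n powr (- (a / 2))" using n4 unfolding B_def .
      finally have "(exp 1 * (real n * p)\<^sup>2 * real t0 / real n) ^ K \<le> (real n powr (- (a / 2))) ^ K"
        using p0 by (intro power_mono) auto
      also have "\<dots> = real n powr (- (a / 2) * real K)"
        using n by (simp add: powr_realpow[symmetric] powr_powr)
      \<comment> \<open>\<open>a * K \<ge> 4\<close> is chosen for this exponent; after the factor
        \<open>n\<close> in \<open>th1\<close>, \<open>1 / n\<close> remains.\<close>
      also have "\<dots> \<le> real n powr (- 2)" using K n by (intro powr_mono) auto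
      also have "\<dots> = 1 / (real n)\<^sup>2" using n by (simp add: powr_minus_divide powr_numeral)
      finally have "th1 \<le> real n * (1 / (real n)\<^sup>2)" unfolding th1_def by (intro mult_left_mono) auto
      then show ?thesis using n by (simp add: power2_eq_square)
    qed
    have th2: "th2 \<le> exp 1 * real n powr (- (c / 2))"
    proof -
      have "32 * exp 1 * (real n * p) \<le> 32 * exp 1 * B" using B by (intro mult_left_mono) auto
      also have "\<dots> \<le> real n powr (c / (2 * real (K + 1)))" using n5 unfolding B_def .
      finally have "(32 * exp 1 * (real n * p)) ^ (K + 1) \<le> (real n powr (c / (2 * real (K + 1)))) ^ (K + 1)"
        using p0 by (intro power_mono) auto
      also have "\<dots> = real n powr (c / (2 * real (K + 1)) * real (K + 1))"
        using n by (subst powr_realpow[symmetric]) (auto simp: powr_powr)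
      \<comment> \<open>The logarithmic factors may spend half of the gain
        \<open>n powr (- c)\<close>, shared among \<open>K + 1\<close> of them.\<close>
      also have "c / (2 * real (K + 1)) * real (K + 1) = c / 2" by (simp add: field_simps)
      finally have 1: "(32 * exp 1 * (real n * p)) ^ (K + 1) \<le> real n powr (c / 2)" .
      have "exp (1 - real n * p) \<le> exp (1 - c * ln (real n))" using np by simp
      also have "\<dots> = exp 1 * real n powr (- c)" using n by (simp add: powr_def exp_diff exp_minus field_simps)
      finally have "th2 \<le> real n powr (c / 2) * (exp 1 * real n powr (- c))"
        unfolding th2_def using 1 by (intro mult_mono) auto
      also have "\<dots> = exp 1 * real n powr (c / 2 + - c)" by (simp only: powr_add mult_ac)
      finally show ?thesis by simp
    qed
    have "pr p (edges V) E3 \<le> pr p (edges V) (\<lambda>F. \<exists>M S r f a b. certificate V F M S r f a b \<and> card S \<le> t0)"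
      unfolding E3_def by (intro pr_mono) (rule conjunct2)
    also have "\<dots> \<le> 2 * th1 + 2 * th2"
      unfolding th1_def th2_def cV[symmetric]
    proof (rule pr_certificate_le[OF fV V0 K1])
      show "(K + 1) * t0 \<le> card V" "p * real ((K + 1) * t0) \<le> 1" using Kn Kp cV by auto
      show "1 \<le> real (card V) * p" unfolding cV using np n2 by linarith
      have "1 / real n \<le> 1 / 2" using n by (simp add: field_simps)
      then show "real (card V) * (exp 1 * (real (card V) * p)\<^sup>2 * real t0 / real (card V)) ^ K \<le> 1 / 2"
        using th1 unfolding th1_def cV by linarith
      show "(32 * exp 1 * (real (card V) * p)) ^ (K + 1) * exp (1 - real (card V) * p) \<le> 1 / 2"
        using th2 n6 unfolding th2_def cV by linarith
    qed
    also have "\<dots> \<le> 2 / real n + 2 * exp 1 * real n powr (- (c / 2))"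
      using th1 th2 by simp
    finally show ?thesis .
  qed
  have "pr p (edges V) (\<lambda>F. \<not> corank_witnessed V (qmat W F)) \<le>
    pr p (edges V) (\<lambda>F. E1 F \<or> E2 F) + pr p (edges V) E3"
  proof (rule pr_disj_le, rule ccontr)
    fix F assume bad: "\<not> corank_witnessed V (qmat W F)" and ne: "\<not> ((E1 F \<or> E2 F) \<or> E3 F)"
    have "corank_witnessed V (qmat W F)"
    proof (rule corank_witnessedI)
      show "\<not> (\<exists>v\<in>kern V (qmat W F). d \<le> card (supp_on V v))" using ne unfolding E1_def by simp
      show "2 * card (supp_on V u) < card (supp_on V (app V (qmat W F) u))"
        if "t0 \<le> card (supp_on V u)" "card (supp_on V u) \<le> d" for u
        using ne forb[OF _ that, of n] unfolding E2_def no_mid_support_def cV by simp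
      show "\<not> (\<exists>M S r f a b. certificate V F M S r f a b \<and> card S \<le> t0)" if "1 < t0"
        using ne that unfolding E3_def by simp
    qed
    then show False using bad by simp
  qed
  also have "pr p (edges V) (\<lambda>F. E1 F \<or> E2 F) \<le> pr p (edges V) E1 + pr p (edges V) E2"
    by (rule pr_disj_le) simp
  finally show ?thesis
    using e1 e2 e3 unfolding V_def error_bound_def by linarith
qed

section \<open>Transfer to the random matrix model\<close>

lemma masked_mat_index:
  assumes W: "admissible_weights n W" and ij: "i < n" "j < n"
  shows "masked_mat n W \<xi> $$ (i, j) = qmat (\<lambda>i j. W $$ (i, j)) {e. \<xi> e} i j"
proof -
  have "transpose_mat W = W" "W \<in> carrier_mat n n" using W unfolding admissible_weights_def by auto
  then have "W $$ (i, j) = W $$ (j, i)" using ij by (metis carrier_matD index_transpose_mat(1))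
  then show ?thesis
    using ij unfolding masked_mat_def qmat_def edge_def by (auto simp: min_def max_def)
qed

lemma admissible_weights_imp_weights:
  assumes W: "admissible_weights n W"
  shows "weights (\<lambda>i j. W $$ (i, j)) {..<n}"
proof
  have t: "transpose_mat W = W" "W \<in> carrier_mat n n" using W unfolding admissible_weights_def by auto
  show "W $$ (i, j) = W $$ (j, i)" if "i \<in> {..<n}" "j \<in> {..<n}" for i j
    using that t by (metis carrier_matD index_transpose_mat(1) lessThan_iff)
  show "W $$ (i, j) \<noteq> 0" if "i \<in> {..<n}" "j \<in> {..<n}" "i \<noteq> j" for i j
    using that W unfolding admissible_weights_def by auto
qed simp

lemma rank_masked_mat:
  assumes W: "admissible_weights n W"
    and wit: "corank_witnessed {..<n} (qmat (\<lambda>i j. W $$ (i, j)) {e. \<xi> e})"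
  shows "vec_space.rank n (masked_mat n W \<xi>) = max_unobstructed_size (masked_mat n W \<xi>)"
proof -
  define Q where "Q = masked_mat n W \<xi>"
  define q where "q = qmat (\<lambda>i j. W $$ (i, j)) {e. \<xi> e}"
  interpret weights "\<lambda>i j. W $$ (i, j)" "{..<n}" by (rule admissible_weights_imp_weights[OF W])
  have Qq: "Q $$ (i, j) = q i j" if "i < n" "j < n" for i j
    unfolding Q_def q_def by (rule masked_mat_index[OF W that])
  have qs: "q i j = q j i" if "i < n" "j < n" for i j
    unfolding q_def using qmat_sym that by simp
  have QC: "Q \<in> carrier_mat n n" unfolding Q_def masked_mat_def by simp
  obtain R where R0: "col_basis q {..<n} {..<n} R" using col_basis_exists[of "{..<n}" q "{..<n}"] by auto
  then obtain T where T: "T \<subseteq> {..<n}"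
    "card ({..<n} - R) + card {y \<in> {..<n}. \<exists>x\<in>T. q y x \<noteq> 0} \<le> card T"
    using wit unfolding q_def corank_witnessed_def by blast
  have RV: "R \<subseteq> {..<n}" using R0 unfolding col_basis_def by simp
  have sumQ: "(\<Sum>k\<in>R. Q $$ (i, k) * v k) = (\<Sum>k\<in>R. q i k * v k)" if "i < n" for i v
    using Qq RV that by (intro sum.cong) auto
  have "col_basis (\<lambda>i j. Q $$ (i, j)) {..<n} {..<n} R"
    using R0 unfolding col_basis_def indep_cols_def by (simp add: Qq sumQ)
  moreover have "neighbourhood Q T = {y \<in> {..<n}. \<exists>x\<in>T. q y x \<noteq> 0}"
    using T(1) QC qs Qq unfolding neighbourhood_def graph_adj_def graph_verts_def
    by (auto simp: subset_iff)
  moreover have "Q $$ (i, j) = Q $$ (j, i)" if "i < n" "j < n" for i j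
    using Qq qs that by simp
  ultimately show ?thesis
    using rank_eq_max_unobstructed_size[OF QC _ _ T(1)] T(2) unfolding Q_def by simp
qed

theorem corollary1p6:
  fixes s :: nat and c :: real
  assumes "s > 0" and "c > 1 / real s"
  shows "\<exists>\<epsilon> :: nat \<Rightarrow> real.
    \<epsilon> \<in> O(\<lambda>n. 1 / ln (ln (real n)) powr (1 / 4)) \<and>
    \<epsilon> \<in> o(\<lambda>_. 1) \<and>
    (\<forall>(n :: nat) (p :: real) (W :: complex mat).
       c * ln (real n) / real n < p \<and> p < 1 / 2 \<and> admissible_weights n W \<longrightarrow>
       measure_pmf.prob (Q_pmf n W p) {Q. vec_space.rank n Q = max_unobstructed_size Q}
         \<ge> 1 - \<epsilon> n)"
proof -
  have c: "c > 0" using assms by (meson divide_nonneg_nonneg less_le_trans not_less of_nat_0_le_iff zero_le_one)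
  \<comment> \<open>\<open>512 * a \<le> c\<close> makes sizes above \<open>n powr (1 - a)\<close>
    forbidden even at \<open>n * p\<close> close to \<open>c * ln n\<close>.\<close>
  define a where "a = min (1 / 2) (c / 512)"
  define K where "K = nat \<lceil>4 / a\<rceil>"
  have a: "0 < a" "a \<le> 1 / 2" "512 * a \<le> c" unfolding a_def using c by auto
  have "4 / a \<le> real K" unfolding K_def by (rule real_nat_ceiling_ge)
  then have K: "4 \<le> a * real K" using a by (simp add: field_simps)
  obtain n0 where n0: "\<And>n. n \<ge> n0 \<Longrightarrow> large_enough c a K n"
    using eventually_large_enough[OF c a(1,2) K] unfolding eventually_sequentially by blast
  \<comment> \<open>Below \<open>n0\<close> the value 1 makes the claim trivial without affecting
    the asymptotics.\<close>
  define \<epsilon> where "\<epsilon> = (\<lambda>n. if n0 \<le> n then error_bound c n else 1)"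
  have ev: "eventually (\<lambda>n. \<epsilon> n = error_bound c n) sequentially"
    using eventually_ge_at_top[of n0] by eventually_elim (simp add: \<epsilon>_def)
  show ?thesis
  proof (intro exI[of _ \<epsilon>] conjI allI impI)
    show "\<epsilon> \<in> O(\<lambda>n. 1 / ln (ln (real n)) powr (1 / 4))"
      using landau_o.big.in_cong[OF ev] error_bound_bigo[OF c] by blast
    show "\<epsilon> \<in> o(\<lambda>_. 1)"
      using landau_o.small.in_cong[OF ev] error_bound_smallo[OF c] by blast
    fix n p and W :: "complex mat"
    assume A: "c * ln (real n) / real n < p \<and> p < 1 / 2 \<and> admissible_weights n W"
    then have W: "admissible_weights n W" and p: "c * ln (real n) / real n < p" "p < 1 / 2" by auto
    let ?S = "{Q. vec_space.rank n Q = max_unobstructed_size Q}"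
    show "1 - \<epsilon> n \<le> measure_pmf.prob (Q_pmf n W p) ?S"
    proof (cases "n0 \<le> n")
      case False
      then show ?thesis unfolding \<epsilon>_def by simp
    next
      case True
      note cond = n0[OF True]
      have "0 \<le> c * ln (real n) / real n"
        using c cond unfolding large_enough_def by (intro divide_nonneg_nonneg mult_nonneg_nonneg) auto
      then have p01: "0 \<le> p" "p \<le> 1" using p by linarith+
      interpret bern p using p01 by unfold_locales
      define V where "V = {..<n}"
      define good where "good = (\<lambda>F. corank_witnessed V (qmat (\<lambda>i j. W $$ (i, j)) F))"
      have "{(i, j). i \<le> j \<and> j < n} = edges V" unfolding edges_def V_def by auto
      then have Qp: "Q_pmf n W p = map_pmf (masked_mat n W) (Pi_pmf (edges V) False (\<lambda>_. bernoulli_pmf p))"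
        unfolding Q_pmf_def by simp
      have "pr p (edges V) (\<lambda>F. \<not> good F) \<le> error_bound c n"
        unfolding good_def V_def
        by (rule pr_not_corank_witnessed_le[OF admissible_weights_imp_weights[OF W] p c a K cond])
      then have "1 - \<epsilon> n \<le> 1 - pr p (edges V) (\<lambda>F. \<not> good F)" unfolding \<epsilon>_def using True by simp
      also have "\<dots> = pr p (edges V) good" by (simp add: pr_compl V_def)
      also have "\<dots> = measure_pmf.prob (Pi_pmf (edges V) False (\<lambda>_. bernoulli_pmf p)) {\<xi>. good {e. \<xi> e}}"
        by (rule Pi_pmf_bernoulli_eq_pr[symmetric]) (use p01 in \<open>auto simp: V_def\<close>)
      also have "\<dots> \<le> measure_pmf.prob (Pi_pmf (edges V) False (\<lambda>_. bernoulli_pmf p)) (masked_mat n W -` ?S)"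
      proof (rule measure_pmf.finite_measure_mono)
        show "{\<xi>. good {e. \<xi> e}} \<subseteq> masked_mat n W -` ?S"
          using rank_masked_mat[OF W] unfolding good_def V_def by auto
      qed simp
      also have "\<dots> = measure_pmf.prob (Q_pmf n W p) ?S" unfolding Qp by simp
      finally show ?thesis .
    qed
  qed
qed

end
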